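(* Let $N>1$ and let $\mathcal H$ denote either $H^2(B_N)$ or $A^2_\alpha(B_N)$ with $\alpha>-1$. Suppose $\varphi$ and $\psi$ are linear-fractional self-maps of $B_N$ with $\|\varphi\|_\infty=\|\psi\|_\infty=1$, and assume at least one of $\varphi,\psi$ is univalent (one-to-one) on $B_N$. If $C_\varphi-C_\psi$ is compact on $\mathcal H$, then $\varphi=\psi$.
   Context: $B_N$ is the open unit ball of $\mathbb C^N$ with inner product $\langle z,w\rangle=\sum z_j\overline{w_j}$. $H^2(B_N)$ is the space of analytic $f$ on $B_N$ with $\sup_{0<r<1}\int_{\partial B_N}|f(r\zeta)|^2d\sigma(\zeta)<\infty$ ($\sigma$ normalized surface measure); $A^2_\alpha(B_N)$ is the space of analytic $f$ with $\int_{B_N}|f|^2\frac{\Gamma(N+\alpha+1)}{\Gamma(N+1)\Gamma(\alpha+1)}(1-|z|^2)^\alpha d\nu<\infty$ ($\nu$ normalized volume measure). A linear-fractional self-map of $B_N$ is a map $\varphi(z)=\frac{Az+B}{\langle z,C\rangle+d}$ ($A$ an $N\times N$ matrix, $B,C\in\mathbb C^N$, $d\in\mathbb C$) analytic on $B_N$ with $\varphi(B_N)\subseteq B_N$; it is analytic on a neighborhood of $\overline{B_N}$. $C_\varphi f=f\circ\varphi$ and $\|\varphi\|_\infty=\sup_{z\in B_N}|\varphi(z)|$. *)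

theory Defs
  imports "HOL-Analysis.Analysis"
begin

definition cinner :: "complex^'n::finite \<Rightarrow> complex^'n \<Rightarrow> complex" where
  "cinner z w = (\<Sum>j\<in>UNIV. z $ j * cnj (w $ j))"

definition holo_ball :: "(complex^'n::finite \<Rightarrow> complex) \<Rightarrow> bool" where
  "holo_ball f \<longleftrightarrow> (\<forall>z\<in>ball 0 1. \<exists>L. (f has_derivative L) (at z) \<and>
                        (\<forall>c v. L (c *s v) = c * L v))"

definition nu_ball :: "(complex^'n::finite) measure" where
  "nu_ball = uniform_measure lborel (ball 0 1)"

text \<open>Normalized surface measure on the unit sphere: the image of nu under
  radial projection x / |x| (the standard cone-measure description of sigma).\<close>
definition sigma_sphere :: "(complex^'n::finite) measure" where
  "sigma_sphere = distr nu_ball borel (\<lambda>x. x /\<^sub>R norm x)"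

definition hardy_norm2 :: "(complex^'n::finite \<Rightarrow> complex) \<Rightarrow> ennreal" where
  "hardy_norm2 f = (SUP r\<in>{0<..<1::real}.
      \<integral>\<^sup>+ \<zeta>. ennreal ((cmod (f (r *\<^sub>R \<zeta>)))\<^sup>2) \<partial>sigma_sphere)"

definition hardy_space :: "(complex^'n::finite \<Rightarrow> complex) set" where
  "hardy_space = {f. holo_ball f \<and> hardy_norm2 f < \<infinity>}"

definition bergman_const :: "real \<Rightarrow> nat \<Rightarrow> real" where
  "bergman_const \<alpha> N = Gamma (real N + \<alpha> + 1) / (Gamma (real N + 1) * Gamma (\<alpha> + 1))"

definition bergman_norm2 :: "real \<Rightarrow> (complex^'n::finite \<Rightarrow> complex) \<Rightarrow> ennreal" where
  "bergman_norm2 \<alpha> f = (\<integral>\<^sup>+ z. ennreal ((cmod (f z))\<^sup>2 * bergman_const \<alpha> CARD('n)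
        * (1 - (norm z)\<^sup>2) powr \<alpha>) \<partial>nu_ball)"

definition bergman_space :: "real \<Rightarrow> (complex^'n::finite \<Rightarrow> complex) set" where
  "bergman_space \<alpha> = {f. holo_ball f \<and> bergman_norm2 \<alpha> f < \<infinity>}"

definition lin_frac_selfmap :: "(complex^'n::finite \<Rightarrow> complex^'n) \<Rightarrow> bool" where
  "lin_frac_selfmap \<phi> \<longleftrightarrow>
     (\<exists>(A::complex^'n^'n) B C d.
        (\<forall>z\<in>ball 0 1. cinner z C + d \<noteq> 0) \<and>
        (\<forall>z. \<phi> z = (1 / (cinner z C + d)) *s (A *v z + B))) \<and>
     \<phi> ` ball 0 1 \<subseteq> ball 0 1"

definition compact_op ::
  "('a \<Rightarrow> complex) set \<Rightarrow> (('a \<Rightarrow> complex) \<Rightarrow> ennreal) \<Rightarrow>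
   (('a \<Rightarrow> complex) \<Rightarrow> ('a \<Rightarrow> complex)) \<Rightarrow> bool" where
  "compact_op H Q T \<longleftrightarrow>
     (\<forall>f\<in>H. T f \<in> H) \<and>
     (\<forall>fs::nat \<Rightarrow> 'a \<Rightarrow> complex. (\<forall>k. fs k \<in> H) \<and> (\<exists>M::real. \<forall>k. Q (fs k) \<le> ennreal M) \<longrightarrow>
        (\<exists>r g. strict_mono r \<and> g \<in> H \<and>
               (\<lambda>j. Q (\<lambda>z. T (fs (r j)) z - g z)) \<longlonglongrightarrow> 0))"

definition comp_diff :: "('a \<Rightarrow> 'b) \<Rightarrow> ('a \<Rightarrow> 'b) \<Rightarrow> ('b \<Rightarrow> complex) \<Rightarrow> ('a \<Rightarrow> complex)" where
  "comp_diff \<phi> \<psi> f = (\<lambda>z. f (\<phi> z) - f (\<psi> z))"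

end

theory Submission
  imports Defs "HOL-Complex_Analysis.Cauchy_Integral_Formula"
begin

text \<open>
  Let \<open>g = N\<close> for the Hardy space and \<open>g = N + 1 + \<alpha>\<close> for the Bergman space. Point evaluation at \<open>z\<close> has
  squared norm at most \<open>C (1 - |z|)\<^sup>-\<^sup>g\<close>, and the functions
  \<open>f\<^sub>w(z) = (1 - |w|\<^sup>2)\<^bsup>m - g/2\<^esup> / (1 - \<langle>z, w\<rangle>)\<^sup>m\<close> with \<open>2 m > g\<close> are bounded in norm and tend to \<open>0\<close> pointwise as
  \<open>|w| \<rightarrow> 1\<close>. If the difference \<open>T\<close> of the composition operators is compact, then evaluating \<open>T f\<^sub>w\<close> for
  \<open>w = \<phi>(z\<^sub>n)\<close> at \<open>z\<^sub>n\<close> gives \<open>\<langle>\<phi>(z\<^sub>n) - \<psi>(z\<^sub>n), \<phi>(z\<^sub>n)\<rangle> = o(1 - |\<phi>(z\<^sub>n)|\<^sup>2)\<close> whenever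
  \<open>1 - |\<phi>(z\<^sub>n)|\<close> is dominated by \<open>1 - |z\<^sub>n|\<close>, and the same with \<open>\<phi>\<close> and \<open>\<psi>\<close> exchanged.

  Fix \<open>\<zeta>\<close> on the sphere with \<open>|\<phi>(\<zeta>)| = 1\<close> and write \<open>\<phi>(\<zeta> + h) = \<phi>(\<zeta>) + D h / (1 + \<langle>h, c\<rangle>)\<close>. Along
  the parabolas \<open>h = \<epsilon> v - K \<epsilon>\<^sup>2 \<zeta>\<close> with \<open>Re \<langle>v, \<zeta>\<rangle> = 0\<close> both defects are of order \<open>\<epsilon>\<^sup>2\<close>, so
  \<open>|\<phi> - \<psi>|\<^sup>2 = o(\<epsilon>\<^sup>2)\<close> and \<open>\<langle>\<phi> - \<psi>, \<phi>\<rangle> = o(\<epsilon>\<^sup>2)\<close>. The first relation shows that \<open>\<psi>\<close> has the same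
  value and the same \<open>D\<close> at \<open>\<zeta>\<close>, the second that it has the same \<open>c\<close>; hence \<open>\<phi> = \<psi>\<close>.
\<close>

subsection \<open>The Hermitian inner product\<close>

text \<open>Exponents must match exactly: the growth exponent \<open>g\<close> of point evaluations
  has to be the one with which the test functions peak at their own centre, since a larger exponent
  in the evaluation bound would leave no information in the limit. This is why mean values are taken
  over regions of size \<open>d\<close> in the complex normal direction and \<open>sqrt d\<close> in
  the complex tangential ones; Euclidean balls would give a wrong exponent for N > 1. Multiplicative
  constants are irrelevant, so one-sided integral estimates suffice. The approach to \<zeta>
  resolves a conflict: tangential vectors must enter at first order, while boundary defects must
  stay of second order. A tangent line leaves the ball, hence the quadratic correction of the path.
  The image defect is of second order because \<phi> maps into the ball: its first-order term has a
  sign, and replacing \<open>v\<close> by \<open>- v\<close> makes it vanish. Both orders of \<phi>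
  and \<psi> are used because the two inner products add up to |\<phi> - \<psi>|^2, whereas one of
  them sees only one component of the difference.\<close>

lemma cinner_add_left: "cinner (x + y) z = cinner x z + cinner y z"
  by (simp add: cinner_def algebra_simps sum.distrib)

lemma cinner_add_right: "cinner x (y + z) = cinner x y + cinner x z"
  by (simp add: cinner_def algebra_simps sum.distrib)

lemma cinner_smult_left: "cinner (c *s x) z = c * cinner x z"
  by (simp add: cinner_def sum_distrib_left mult.assoc)

lemma cinner_smult_right: "cinner x (c *s z) = cnj c * cinner x z"
  by (simp add: cinner_def sum_distrib_left mult_ac)

lemma cinner_commute: "cinner y x = cnj (cinner x y)"
  by (simp add: cinner_def mult_ac)

lemma scaleR_eq_smult: "r *\<^sub>R (x :: complex^'n) = complex_of_real r *s x"
  by (simp add: vec_eq_iff scaleR_conv_of_real[where 'a=complex])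

lemma cinner_scaleR_left: "cinner (r *\<^sub>R x) z = of_real r * cinner x z"
  by (simp add: scaleR_eq_smult cinner_smult_left)

lemma cinner_scaleR_right: "cinner x (r *\<^sub>R z) = of_real r * cinner x z"
  by (simp add: scaleR_eq_smult cinner_smult_right)

lemma cinner_zero [simp]: "cinner 0 x = 0" "cinner x 0 = 0"
  by (simp_all add: cinner_def)

lemma cinner_minus_left: "cinner (- x) y = - cinner x y"
  by (simp add: cinner_def sum_negf)

lemma cinner_diff_left: "cinner (x - y) z = cinner x z - cinner y z"
  by (simp add: cinner_def algebra_simps sum_subtractf)

lemma cinner_diff_right: "cinner x (y - z) = cinner x y - cinner x z"
  by (simp add: cinner_def algebra_simps sum_subtractf)

text \<open>Links two notions of tangency used below: \<open>inner v \<zeta> = 0\<close> is real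
  tangency to the sphere and admits \<open>v = \<i> *s \<zeta>\<close>, while
  \<open>cinner v \<zeta> = 0\<close> is complex tangency.\<close>

lemma Re_cinner: "Re (cinner x y) = inner x y"
  by (simp add: cinner_def inner_vec_def inner_complex_def)

lemma cinner_self: "cinner x x = of_real ((norm x)\<^sup>2)"
proof -
  have "cinner x x = (\<Sum>j\<in>UNIV. of_real ((cmod (x $ j))\<^sup>2))"
    by (simp add: cinner_def complex_norm_square del: of_real_power)
  also have "\<dots> = of_real ((norm x)\<^sup>2)"
    by (simp add: norm_vec_def L2_set_def sum_nonneg)
  finally show ?thesis .
qed

lemma norm_smult: "norm (c *s (x :: complex^'n)) = cmod c * norm x"
  by (simp add: norm_vec_def L2_set_def norm_mult power_mult_distrib real_sqrt_mult flip: sum_distrib_left)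

lemma norm_cinner_le: "cmod (cinner x y) \<le> norm x * norm y"
proof (cases "cinner x y = 0")
  case False
  \<comment> \<open>A unimodular factor turns the Hermitian product into its modulus, so that the
    real Cauchy-Schwarz inequality applies.\<close>
  define c where "c = cnj (cinner x y) / of_real (cmod (cinner x y))"
  have c: "cmod c = 1" using False by (simp add: c_def norm_divide)
  have "c * cinner x y = of_real ((cmod (cinner x y))\<^sup>2) / of_real (cmod (cinner x y))"
    unfolding complex_norm_square by (simp add: c_def)
  also have "\<dots> = of_real (cmod (cinner x y))" using False by (simp add: power2_eq_square)
  finally have "c * cinner x y = of_real (cmod (cinner x y))" .
  then have "cmod (cinner x y) = Re (cinner (c *s x) y)" by (simp add: cinner_smult_left)
  also have "\<dots> \<le> norm (c *s x) * norm y"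
    unfolding Re_cinner by (rule norm_cauchy_schwarz)
  finally show ?thesis by (simp add: norm_smult c)
qed simp

lemma bounded_bilinear_cinner: "bounded_bilinear (cinner :: complex^'n::finite \<Rightarrow> _)"
proof
  show "\<exists>K. \<forall>a b. norm (cinner a b) \<le> norm (a :: complex^'n) * norm b * K"
    by (rule exI[of _ 1]) (simp add: norm_cinner_le)
qed (simp_all add: cinner_add_left cinner_add_right cinner_scaleR_left cinner_scaleR_right scaleR_conv_of_real[where 'a=complex])

lemma bounded_bilinear_smult: "bounded_bilinear ((*s) :: complex \<Rightarrow> complex^'n::finite \<Rightarrow> _)"
proof
  show "\<exists>K. \<forall>a b. norm (a *s b) \<le> norm a * norm (b :: complex^'n) * K"
    by (rule exI[of _ 1]) (simp add: norm_smult)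
qed (simp_all add: vec_eq_iff algebra_simps scaleR_conv_of_real[where 'a=complex])

lemmas tendsto_cinner [tendsto_intros] = bounded_bilinear.tendsto[OF bounded_bilinear_cinner]
lemmas tendsto_smult [tendsto_intros] = bounded_bilinear.tendsto[OF bounded_bilinear_smult]
lemmas continuous_on_cinner [continuous_intros] = bounded_bilinear.continuous_on[OF bounded_bilinear_cinner]
lemmas continuous_on_smult [continuous_intros] = bounded_bilinear.continuous_on[OF bounded_bilinear_smult]

lemma bounded_linear_mat_complex: "bounded_linear ((*v) (A :: complex^'n::finite^'m::finite))"
proof -
  have "linear ((*v) A)"
    by (rule linearI) (simp_all add: matrix_vector_mult_def vec_eq_iff sum.distrib algebra_simps
        sum_distrib_left scaleR_conv_of_real[where 'a=complex])
  then show ?thesis by (simp add: linear_conv_bounded_linear)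
qed

text \<open>Equality case of Cauchy-Schwarz in the closed unit ball:
  \<open>|x - y|^2 = |x|^2 + |y|^2 - 2\<close> cannot be positive.\<close>

lemma cinner_eq_1_imp_eq:
  assumes "norm x \<le> 1" "norm y \<le> 1" "cinner x y = 1"
  shows "x = y"
proof -
  have "inner x y = 1" using assms(3) Re_cinner[of x y] by simp
  then have "(norm (x - y))\<^sup>2 = (norm x)\<^sup>2 + (norm y)\<^sup>2 - 2"
    by (simp add: power2_norm_eq_inner inner_diff_left inner_diff_right inner_commute)
  moreover have "(norm x)\<^sup>2 \<le> 1" "(norm y)\<^sup>2 \<le> 1" using assms by (simp_all add: power_le_one)
  ultimately have "(norm (x - y))\<^sup>2 \<le> 0" by linarith
  then show ?thesis by simp
qed

lemma norm2_path:
  fixes \<zeta> v :: "'a::real_inner"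
  assumes "norm \<zeta> = 1" "inner v \<zeta> = 0"
  shows "1 - (norm (\<zeta> + (e *\<^sub>R v - (K * e\<^sup>2) *\<^sub>R \<zeta>)))\<^sup>2 = e\<^sup>2 * (2 * K - (norm v)\<^sup>2 - K\<^sup>2 * e\<^sup>2)"
proof -
  have "inner \<zeta> \<zeta> = 1" "inner \<zeta> v = 0" using assms by (simp_all add: norm_eq_1 inner_commute)
  then show ?thesis using assms(2)
    unfolding power2_norm_eq_inner
    by (simp add: inner_add_left inner_add_right inner_diff_left inner_diff_right)
       (simp add: algebra_simps power2_eq_square)
qed

text \<open>The value of \<open>K\<close> makes \<open>2 * K - |v|^2 = 2\<close>, and
  \<open>K * e \<le> 1\<close> costs at most 1 of it, so the factor of \<open>e^2\<close> in
  \<open>norm2_path\<close> is at least 1.\<close>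

lemma path_in_ball:
  fixes \<zeta> v :: "'a::real_inner"
  assumes "norm \<zeta> = 1" "inner v \<zeta> = 0" "K = ((norm v)\<^sup>2 + 2) / 2" "0 < e" "K * e \<le> 1"
  shows "e\<^sup>2 \<le> 1 - (norm (\<zeta> + (e *\<^sub>R v - (K * e\<^sup>2) *\<^sub>R \<zeta>)))\<^sup>2"
    and "\<zeta> + (e *\<^sub>R v - (K * e\<^sup>2) *\<^sub>R \<zeta>) \<in> ball 0 1"
proof -
  have "0 \<le> K" by (simp add: assms(3))
  then have "0 \<le> K * e" using assms(4) by simp
  then have "(K * e)\<^sup>2 \<le> 1" using assms(5) by (simp add: power_le_one)
  then have "K\<^sup>2 * e\<^sup>2 \<le> 1" by (simp add: power_mult_distrib)
  moreover have "2 * K - (norm v)\<^sup>2 = 2" by (simp add: assms(3) field_simps)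
  ultimately have "e\<^sup>2 * 1 \<le> e\<^sup>2 * (2 * K - (norm v)\<^sup>2 - K\<^sup>2 * e\<^sup>2)"
    by (intro mult_left_mono) auto
  then show *: "e\<^sup>2 \<le> 1 - (norm (\<zeta> + (e *\<^sub>R v - (K * e\<^sup>2) *\<^sub>R \<zeta>)))\<^sup>2"
    unfolding norm2_path[OF assms(1,2)] by simp
  have "0 < e\<^sup>2" using assms by simp
  then have "(norm (\<zeta> + (e *\<^sub>R v - (K * e\<^sup>2) *\<^sub>R \<zeta>)))\<^sup>2 < 1" using * by linarith
  then show "\<zeta> + (e *\<^sub>R v - (K * e\<^sup>2) *\<^sub>R \<zeta>) \<in> ball 0 1"
    by (simp add: power_less_one_iff abs_square_less_1)
qed

subsection \<open>Linear-fractional maps at the boundary\<close>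

text \<open>If the denominator vanishes at \<open>z0\<close>, boundedness forces the numerator to vanish there and \<open>A\<close> to
  annihilate the complex tangent space at \<open>z0\<close>, so that the map is constant.\<close>

lemma lin_frac_denominator_nonzero:
  fixes A :: "complex^'n::finite^'n"
  assumes den: "\<And>z. z \<in> ball 0 1 \<Longrightarrow> cinner z C + d \<noteq> 0"
    and \<phi>: "\<And>z. \<phi> z = (1 / (cinner z C + d)) *s (A *v z + B)"
    and self: "\<phi> ` ball 0 1 \<subseteq> ball 0 1"
    and sup: "(SUP z\<in>ball 0 1. norm (\<phi> z)) = 1"
    and z0: "z0 \<in> cball 0 1"
  shows "cinner z0 C + d \<noteq> 0"
proof
  assume z0C: "cinner z0 C + d = 0"
  have n0: "norm z0 = 1" using den[of z0] z0 z0C by fastforce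
  have d0: "d \<noteq> 0" using den[of 0] by simp
  have bd: "norm (A *v z + B) \<le> cmod (cinner z C + d)" if "z \<in> ball 0 1" for z
  proof -
    have "norm (\<phi> z) < 1" using self that by (metis image_subset_iff mem_ball_0)
    then have "norm (A *v z + B) / cmod (cinner z C + d) < 1"
      unfolding \<phi> norm_smult by (simp add: norm_divide)
    then show ?thesis using den[OF that] by (simp add: divide_less_eq)
  qed
  \<comment> \<open>The equation \<open>|x| = - x\<close> encodes \<open>x \<le> 0\<close>, which is
    \<open>bd\<close> extended to the boundary by continuity. At \<open>z0\<close> the denominator
    is 0, hence so is the numerator.\<close>
  have "norm (norm (A *v z0 + B) - cmod (cinner z0 C + d)) = - (norm (A *v z0 + B) - cmod (cinner z0 C + d))"
  proof -
    have c: "continuous_on (closure (ball 0 1)) (\<lambda>z. norm (A *v z + B) - cmod (cinner z C + d))"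
      by (intro continuous_intros linear_continuous_on bounded_linear_mat_complex)
    have "norm (A *v z0 + B) - cmod (cinner z0 C + d) \<le> 0"
      by (rule continuous_le_on_closure[OF c]) (use bd z0 in auto)
    then show ?thesis by simp
  qed
  then have Az0: "A *v z0 = - B" by (simp add: z0C eq_neg_iff_add_eq_0)
  \<comment> \<open>Otherwise the denominator would vanish inside the ball: \<open>u\<close> is
    scaled so that \<open>cinner u C = d\<close>, whence every point \<open>z0 - s (z0 + u)\<close>
    is a zero. The chosen \<open>s\<close> minimises the norm on this line; the squared norm is
    \<open>1 - s\<close>.\<close>
  have orthC: "cinner v C = 0" if v: "cinner v z0 = 0" for v
  proof (rule ccontr)
    assume c: "cinner v C \<noteq> 0"
    define u where "u = (d / cinner v C) *s v"
    define s where "s = 1 / (1 + (norm u)\<^sup>2)"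
    have s: "0 < s" "s * (1 + (norm u)\<^sup>2) = 1"
      by (simp_all add: s_def add_pos_nonneg) (smt (verit) zero_le_power2)
    have uz: "inner u z0 = 0" using v Re_cinner[of u z0] by (simp add: u_def cinner_smult_left)
    have "(norm (z0 - s *\<^sub>R z0 - s *\<^sub>R u))\<^sup>2 = (1 - s)\<^sup>2 + s\<^sup>2 * (norm u)\<^sup>2"
      using uz n0 unfolding power2_norm_eq_inner
      by (simp add: norm_eq_1 inner_diff_left inner_diff_right inner_commute algebra_simps power2_eq_square)
    also have "\<dots> = 1 - 2 * s + s * (s * (1 + (norm u)\<^sup>2))" by (simp add: algebra_simps power2_eq_square)
    also have "\<dots> < 1" using s by simp
    finally have "z0 - s *\<^sub>R z0 - s *\<^sub>R u \<in> ball 0 1"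
      by (simp add: abs_square_less_1)
    moreover have "cinner (z0 - s *\<^sub>R z0 - s *\<^sub>R u) C + d = 0"
      using z0C c by (simp add: cinner_diff_left cinner_scaleR_left u_def cinner_smult_left eq_neg_iff_add_eq_0[symmetric])
    ultimately show False using den by blast
  qed
  \<comment> \<open>On the parabola the denominator is exactly \<open>K e^2 d\<close>, so
    \<open>bd\<close> leaves no room for the first-order part \<open>e (A v)\<close> of the
    numerator.\<close>
  have orthA: "A *v v = 0" if v: "cinner v z0 = 0" for v
  proof -
    define K where "K = ((norm v)\<^sup>2 + 2) / 2"
    have K: "K > 0" by (simp add: K_def add_nonneg_pos)
    have iv: "inner v z0 = 0" using v Re_cinner[of v z0] by simp
    have "norm (A *v v) \<le> e * (K * cmod d + K * norm (A *v z0))" if e: "0 < e" "K * e \<le> 1" for e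
    proof -
      define z where "z = z0 + (e *\<^sub>R v - (K * e\<^sup>2) *\<^sub>R z0)"
      have zb: "z \<in> ball 0 1" unfolding z_def by (rule path_in_ball[OF n0 iv K_def e])
      have Az: "A *v z + B = e *\<^sub>R (A *v v) - (K * e\<^sup>2) *\<^sub>R (A *v z0)"
        using Az0 bounded_linear_mat_complex[of A]
        by (simp add: z_def linear_simps)
      have Cz: "cinner z C + d = of_real (K * e\<^sup>2) * d"
        using z0C orthC[OF v]
        by (simp add: z_def cinner_add_left cinner_diff_left cinner_scaleR_left eq_neg_iff_add_eq_0[symmetric])
      have "norm (e *\<^sub>R (A *v v)) \<le> norm (A *v z + B) + norm ((K * e\<^sup>2) *\<^sub>R (A *v z0))"
        unfolding Az using norm_triangle_sub[of "e *\<^sub>R (A *v v)" "(K * e\<^sup>2) *\<^sub>R (A *v z0)"] by linarith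
      also have "\<dots> \<le> K * e\<^sup>2 * cmod d + K * e\<^sup>2 * norm (A *v z0)"
        using bd[OF zb] K unfolding Cz by (simp add: norm_mult norm_power)
      finally have "e * norm (A *v v) \<le> e * (e * (K * cmod d + K * norm (A *v z0)))"
        using e by (simp add: algebra_simps power2_eq_square)
      then show ?thesis using e by simp
    qed
    then have ev: "eventually (\<lambda>e. norm (A *v v) \<le> e * (K * cmod d + K * norm (A *v z0))) (at_right 0)"
      unfolding eventually_at_right_field using K
      by (intro exI[of _ "1/K"]) (auto simp: field_simps)
    have "((\<lambda>e. e * (K * cmod d + K * norm (A *v z0))) \<longlongrightarrow> 0 * (K * cmod d + K * norm (A *v z0))) (at_right 0)"
      by (intro tendsto_intros)
    from tendsto_le[OF _ this tendsto_const ev] show ?thesis by simp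
  qed
  \<comment> \<open>For \<open>z = v + a z0\<close> numerator and denominator share the factor
    \<open>a - 1\<close>, so the quotient is constant. A constant in the open ball contradicts the
    supremum 1.\<close>
  have const: "\<phi> z = \<phi> 0" if zb: "z \<in> ball 0 1" for z
  proof -
    have *: "\<phi> z = (- 1 / d) *s (A *v z0)" if zb: "z \<in> ball 0 1" for z
    proof -
      define a where "a = cinner z z0"
      define v where "v = z - a *s z0"
      have z: "z = v + a *s z0" by (simp add: v_def)
      have v: "cinner v z0 = 0" by (simp add: v_def cinner_diff_left cinner_smult_left a_def cinner_self n0)
      have "A *v z = a *s (A *v z0)"
        unfolding z by (simp add: matrix_vector_right_distrib orthA[OF v] vec.scale)
      then have num: "A *v z + B = (a - 1) *s (A *v z0)" using Az0 by (simp add: vector_sub_rdistrib)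
      have de: "cinner z C + d = (a - 1) * (- d)"
        unfolding z using z0C orthC[OF v]
        by (simp add: cinner_add_left cinner_smult_left eq_neg_iff_add_eq_0[symmetric] algebra_simps)
      have "a - 1 \<noteq> 0" using den[OF zb] de by auto
      then have "1 / ((a - 1) * - d) * (a - 1) = - 1 / d" using d0 by (simp add: field_simps)
      then show ?thesis unfolding \<phi> num de vector_smult_assoc by simp
    qed
    show ?thesis using *[OF zb] *[of 0] by simp
  qed
  have "(SUP z\<in>ball 0 1. norm (\<phi> z)) = (SUP z\<in>ball (0::complex^'n) 1. norm (\<phi> 0))"
    by (intro SUP_cong refl arg_cong[where f = norm] const)
  then have "norm (\<phi> 0) = 1" using sup by simp
  moreover have "norm (\<phi> 0) < 1" using self by (metis image_subset_iff mem_ball_0 norm_zero zero_less_one)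
  ultimately show False by simp
qed

text \<open>Dividing numerator and denominator by the denominator \<open>q\<close> at \<zeta>
  normalises the map there: \<open>D\<close> is its complex derivative at \<zeta>, and
  \<open>c\<close> is what remains of the denominator. The map on the closed ball is thus determined
  by its value, \<open>D\<close> and \<open>c\<close> at one boundary point.\<close>

lemma lin_frac_closed_ball:
  fixes \<phi> :: "complex^'n::finite \<Rightarrow> complex^'n" and \<zeta> :: "complex^'n"
  assumes "lin_frac_selfmap \<phi>" "(SUP z\<in>ball 0 1. norm (\<phi> z)) = 1"
  shows "continuous_on (cball 0 1) \<phi>"
    and "\<And>z. z \<in> cball 0 1 \<Longrightarrow> norm (\<phi> z) \<le> 1"
    and "\<And>z. z \<in> ball 0 1 \<Longrightarrow> norm (\<phi> z) < 1"
    and "\<exists>\<zeta>. norm \<zeta> = 1 \<and> norm (\<phi> \<zeta>) = 1"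
    and "norm \<zeta> = 1 \<Longrightarrow> \<exists>D c. bounded_linear D \<and> (\<forall>a h. D (a *s h) = a *s D h) \<and>
      (\<forall>h. \<zeta> + h \<in> cball 0 1 \<longrightarrow> 1 + cinner h c \<noteq> 0 \<and> \<phi> (\<zeta> + h) = \<phi> \<zeta> + (1 / (1 + cinner h c)) *s D h)"
proof -
  obtain A :: "complex^'n^'n" and B C d where den: "\<And>z. z \<in> ball 0 1 \<Longrightarrow> cinner z C + d \<noteq> 0"
    and \<phi>: "\<And>z. \<phi> z = (1 / (cinner z C + d)) *s (A *v z + B)"
    and self: "\<phi> ` ball 0 1 \<subseteq> ball 0 1"
    using assms(1) unfolding lin_frac_selfmap_def by blast
  have den': "cinner z C + d \<noteq> 0" if "z \<in> cball 0 1" for z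
    by (rule lin_frac_denominator_nonzero[OF den \<phi> self assms(2) that])
  have "\<phi> = (\<lambda>z. (1 / (cinner z C + d)) *s (A *v z + B))" using \<phi> by blast
  moreover have "continuous_on (cball 0 1) (\<lambda>z. (1 / (cinner z C + d)) *s (A *v z + B))"
    using den' by (intro continuous_intros linear_continuous_on bounded_linear_mat_complex) auto
  ultimately show cont: "continuous_on (cball 0 1) \<phi>" by simp
  show lt: "norm (\<phi> z) < 1" if "z \<in> ball 0 1" for z using self that by (metis image_subset_iff mem_ball_0)
  have cont': "continuous_on (closure (ball 0 1)) (\<lambda>z. norm (\<phi> z))"
    using cont by (auto intro: continuous_intros)
  show le: "norm (\<phi> z) \<le> 1" if "z \<in> cball 0 1" for z
    by (rule continuous_le_on_closure[OF cont']) (use lt that in \<open>auto intro: less_imp_le\<close>)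
  have "\<exists>\<xi>\<in>cball 0 1. \<forall>y\<in>cball 0 1. norm (\<phi> y) \<le> norm (\<phi> \<xi>)"
    by (rule continuous_attains_sup) (use cont in \<open>auto intro: continuous_intros\<close>)
  then obtain \<xi> where \<xi>: "\<xi> \<in> cball 0 1" "\<And>y. y \<in> cball 0 1 \<Longrightarrow> norm (\<phi> y) \<le> norm (\<phi> \<xi>)" by blast
  have "(SUP z\<in>ball 0 1. norm (\<phi> z)) \<le> norm (\<phi> \<xi>)"
    by (rule cSUP_least) (use \<xi>(2) in auto)
  then have "norm (\<phi> \<xi>) = 1" using assms(2) le[OF \<xi>(1)] by simp
  moreover from this have "\<xi> \<notin> ball 0 1" using lt[of \<xi>] by auto
  ultimately show "\<exists>\<xi>. norm \<xi> = 1 \<and> norm (\<phi> \<xi>) = 1" using \<xi>(1) by (intro exI[of _ \<xi>]) auto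
  assume n: "norm \<zeta> = 1"
  define q where "q = cinner \<zeta> C + d"
  have q: "q \<noteq> 0" unfolding q_def using n by (intro den') simp
  define D where "D h = (1 / q) *s (A *v h - cinner h C *s \<phi> \<zeta>)" for h
  define c where "c = cnj (1 / q) *s C"
  have "bounded_linear D"
    unfolding D_def
    by (intro bounded_linear_compose[OF bounded_bilinear.bounded_linear_right[OF bounded_bilinear_smult]]
        bounded_linear_sub bounded_linear_mat_complex
        bounded_linear_compose[OF bounded_bilinear.bounded_linear_left[OF bounded_bilinear_smult]]
        bounded_bilinear.bounded_linear_left[OF bounded_bilinear_cinner])
  moreover have "D (a *s h) = a *s D h" for a h
    by (simp add: D_def vec.scale cinner_smult_left vec_eq_iff algebra_simps)
  moreover have "1 + cinner h c \<noteq> 0 \<and> \<phi> (\<zeta> + h) = \<phi> \<zeta> + (1 / (1 + cinner h c)) *s D h"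
    if h: "\<zeta> + h \<in> cball 0 1" for h
  proof -
    have e: "q * (1 + cinner h c) = cinner (\<zeta> + h) C + d"
      using q by (simp add: c_def cinner_smult_right q_def cinner_add_left field_simps)
    then have n0: "1 + cinner h c \<noteq> 0" using den'[OF h] by auto
    have num: "A *v \<zeta> + B = q *s \<phi> \<zeta>" using q by (simp add: \<phi> q_def vector_smult_assoc)
    have 1: "q *s \<phi> (\<zeta> + h) = (1 / (1 + cinner h c)) *s (q *s \<phi> \<zeta> + A *v h)"
      unfolding \<phi>[of "\<zeta> + h"] e[symmetric] num[symmetric] using q
      by (simp add: vector_smult_assoc matrix_vector_right_distrib add_ac)
    have 2: "cinner h C = q * cinner h c" using q by (simp add: c_def cinner_smult_right)
    have "q *s (\<phi> \<zeta> + (1 / (1 + cinner h c)) *s D h) = (1 / (1 + cinner h c)) *s (q *s \<phi> \<zeta> + A *v h)"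
    proof -
      \<comment> \<open>Each component of the vector identity is this scalar one, with
        \<open>t\<close> for \<open>cinner h c\<close> and \<open>x\<close>, \<open>y\<close> for
        the components of \<open>A *v h\<close> and \<open>\<phi> \<zeta>\<close>.\<close>
      have "q * (y + 1 / (1 + t) * (1 / q * (x - q * t * y))) = 1 / (1 + t) * (q * y + x)"
        if "1 + t \<noteq> 0" for t x y
      proof -
        have "1 / q * (x - q * t * y) = x / q - t * y" using q by (simp add: field_simps)
        then show ?thesis using that q by (simp add: divide_simps) (simp add: algebra_simps)
      qed
      from this[OF n0] show ?thesis
        unfolding D_def 2 vec_eq_iff vector_add_component vector_smult_component vector_minus_component by blast
    qed
    with 1 have "q *s \<phi> (\<zeta> + h) = q *s (\<phi> \<zeta> + (1 / (1 + cinner h c)) *s D h)" by simp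
    then show ?thesis using q n0 vector_mul_lcancel by blast
  qed
  ultimately show "\<exists>D c. bounded_linear D \<and> (\<forall>a h. D (a *s h) = a *s D h) \<and>
      (\<forall>h. \<zeta> + h \<in> cball 0 1 \<longrightarrow> 1 + cinner h c \<noteq> 0 \<and> \<phi> (\<zeta> + h) = \<phi> \<zeta> + (1 / (1 + cinner h c)) *s D h)"
    by blast
qed

lemma smult_commute: "a *s (b *s (x :: complex^'n)) = b *s (a *s x)"
  by (simp add: vector_smult_assoc mult.commute)

lemma complex_linear_eqI:
  fixes D D' :: "complex^'n::finite \<Rightarrow> complex^'m::finite"
  assumes "bounded_linear D" "\<And>a h. D (a *s h) = a *s D h"
    and "bounded_linear D'" "\<And>a h. D' (a *s h) = a *s D' h"
    and "norm \<zeta> = 1" "D \<zeta> = D' \<zeta>" "\<And>v. cinner v \<zeta> = 0 \<Longrightarrow> D v = D' v"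
  shows "D = D'"
proof
  fix x
  define v where "v = x - cinner x \<zeta> *s \<zeta>"
  have "cinner v \<zeta> = 0" by (simp add: v_def cinner_diff_left cinner_smult_left cinner_self assms(5))
  then have "D v = D' v" by (rule assms)
  then have "D (v + cinner x \<zeta> *s \<zeta>) = D' (v + cinner x \<zeta> *s \<zeta>)"
    by (simp add: linear_add[OF bounded_linear.linear[OF assms(1)]]
        linear_add[OF bounded_linear.linear[OF assms(3)]] assms(2,4,6))
  then show "D x = D' x" by (simp add: v_def)
qed

section \<open>Second-order expansion of a linear-fractional map along a parabola\<close>

context
  fixes \<phi> :: "complex^'n::finite \<Rightarrow> complex^'n" and \<zeta> :: "complex^'n" and D c v and K :: real and e :: "nat \<Rightarrow> real"
  fixes h z y
  assumes \<zeta>: "norm \<zeta> = 1"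
    and D: "bounded_linear D" and D_smult: "\<And>a h. D (a *s h) = a *s D h"
    and form: "\<forall>h. \<zeta> + h \<in> cball 0 1 \<longrightarrow> 1 + cinner h c \<noteq> 0 \<and> \<phi> (\<zeta> + h) = \<phi> \<zeta> + (1 / (1 + cinner h c)) *s D h"
    and v: "inner v \<zeta> = 0" and K: "K = ((norm v)\<^sup>2 + 2) / 2"
    and e: "\<And>n. 0 < e n" "\<And>n. K * e n \<le> 1" "e \<longlonglongrightarrow> 0"
    and h_def: "\<And>n. h n = e n *\<^sub>R v - (K * (e n)\<^sup>2) *\<^sub>R \<zeta>"
    and z_def: "\<And>n. z n = \<zeta> + h n"
    and y_def: "\<And>n. y n = (1 / (1 + cinner (h n) c)) *s D (v - (K * e n) *\<^sub>R \<zeta>)"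
begin

text \<open>The sequences enter through defining equations, so that the facts of this context apply
  to families indexed by \<open>v\<close> and to both maps, which share the path \<open>z\<close>
  and differ in \<open>y\<close>.\<close>

lemma z_ball: "z n \<in> ball 0 1" and z_norm: "(e n)\<^sup>2 \<le> 1 - (norm (z n))\<^sup>2"
  unfolding z_def h_def using path_in_ball[OF \<zeta> v K e(1,2)] by auto

lemma h_tendsto: "h \<longlonglongrightarrow> 0"
proof -
  have "(\<lambda>n. e n *\<^sub>R v - (K * (e n)\<^sup>2) *\<^sub>R \<zeta>) \<longlonglongrightarrow> 0 *\<^sub>R v - (K * 0\<^sup>2) *\<^sub>R \<zeta>"
    by (intro tendsto_intros e)
  then show ?thesis unfolding h_def[symmetric] by simp
qed

lemma denom_tendsto: "(\<lambda>n. 1 / (1 + cinner (h n) c)) \<longlonglongrightarrow> 1"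
proof -
  have "(\<lambda>n. 1 / (1 + cinner (h n) c)) \<longlonglongrightarrow> 1 / (1 + cinner 0 c)"
    by (intro tendsto_intros h_tendsto) simp
  then show ?thesis by simp
qed

lemma denom_nonzero: "1 + cinner (h n) c \<noteq> 0"
  using form[rule_format, of "h n"] z_ball[of n] by (auto simp: z_def)

text \<open>Identifies \<open>y\<close> as the difference quotient of \<phi> along the path, by real
  homogeneity of \<open>D\<close>.\<close>

lemma phi_expand: "\<phi> (z n) = \<phi> \<zeta> + e n *\<^sub>R y n"
proof -
  have "h n = e n *\<^sub>R (v - (K * e n) *\<^sub>R \<zeta>)" by (simp add: h_def algebra_simps power2_eq_square)
  then have "D (h n) = e n *\<^sub>R D (v - (K * e n) *\<^sub>R \<zeta>)"
    using D by (metis bounded_linear.linear linear_cmul)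
  moreover have "\<phi> (z n) = \<phi> \<zeta> + (1 / (1 + cinner (h n) c)) *s D (h n)"
    using form[rule_format, of "h n"] z_ball[of n] by (auto simp: z_def)
  ultimately show ?thesis by (simp add: y_def scaleR_eq_smult smult_commute)
qed

text \<open>Multiplying \<open>y n - D v\<close> by the denominator leaves \<open>e\<close> times a
  convergent expression. This second-order coefficient is where \<open>c\<close> first becomes
  visible in the limit.\<close>

lemma y_tendsto2: "(\<lambda>n. (1 / e n) *\<^sub>R (y n - D v)) \<longlonglongrightarrow> - (K *\<^sub>R D \<zeta>) - cinner v c *s D v"
proof -
  define x where "x n = v - (K * e n) *\<^sub>R \<zeta>" for n
  have x: "x \<longlonglongrightarrow> v"
  proof -
    have "(\<lambda>n. v - (K * e n) *\<^sub>R \<zeta>) \<longlonglongrightarrow> v - (K * 0) *\<^sub>R \<zeta>" by (intro tendsto_intros e)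
    then show ?thesis by (simp add: x_def[abs_def])
  qed
  have hx: "h n = e n *\<^sub>R x n" for n by (simp add: h_def x_def algebra_simps power2_eq_square)
  have eq: "(1 / e n) *\<^sub>R (y n - D v) = (1 / (1 + cinner (h n) c)) *s (- (K *\<^sub>R D \<zeta>) - cinner (x n) c *s D v)" for n
  proof -
    let ?q = "1 + cinner (h n) c"
    have Dx: "D (x n) = D v - (K * e n) *\<^sub>R D \<zeta>"
      using D by (simp add: x_def linear_simps)
    have "?q *s (y n - D v) = D (x n) - ?q *s D v"
      using denom_nonzero[of n]
      by (simp add: y_def x_def[symmetric] vector_ssub_ldistrib vector_smult_assoc)
    also have "\<dots> = e n *\<^sub>R (- (K *\<^sub>R D \<zeta>) - cinner (x n) c *s D v)"
      unfolding Dx hx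
      by (simp add: scaleR_eq_smult cinner_smult_left vec_eq_iff algebra_simps)
    finally have *: "?q *s (y n - D v) = e n *\<^sub>R (- (K *\<^sub>R D \<zeta>) - cinner (x n) c *s D v)" .
    have "y n - D v = (1 / ?q) *s (?q *s (y n - D v))"
      using denom_nonzero[of n] unfolding vector_smult_assoc by simp
    also have "\<dots> = e n *\<^sub>R ((1 / ?q) *s (- (K *\<^sub>R D \<zeta>) - cinner (x n) c *s D v))"
      unfolding * unfolding scaleR_eq_smult[of "e n"] by (rule smult_commute)
    finally show ?thesis using e(1)[of n] by simp
  qed
  have "(\<lambda>n. (1 / (1 + cinner (h n) c)) *s (- (K *\<^sub>R D \<zeta>) - cinner (x n) c *s D v))
      \<longlonglongrightarrow> 1 *s (- (K *\<^sub>R D \<zeta>) - cinner v c *s D v)"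
    by (intro tendsto_intros denom_tendsto x)
  then show ?thesis by (simp add: eq)
qed

lemma y_tendsto: "y \<longlonglongrightarrow> D v"
proof -
  have "(\<lambda>n. e n *\<^sub>R ((1 / e n) *\<^sub>R (y n - D v)) + D v) \<longlonglongrightarrow> 0 *\<^sub>R (- (K *\<^sub>R D \<zeta>) - cinner v c *s D v) + D v"
    by (intro tendsto_intros e y_tendsto2)
  moreover have "e n \<noteq> 0" for n using e(1)[of n] by simp
  ultimately show ?thesis by simp
qed

lemma norm2_phi:
  assumes "norm (\<phi> \<zeta>) = 1"
  shows "1 - (norm (\<phi> (z n)))\<^sup>2 = - 2 * e n * inner (y n) (\<phi> \<zeta>) - (e n)\<^sup>2 * (norm (y n))\<^sup>2"
  using assms unfolding phi_expand power2_norm_eq_inner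
  by (simp add: norm_eq_1 inner_add_left inner_add_right inner_commute algebra_simps power2_eq_square)

text \<open>The defect of the image is nonnegative and equals
  \<open>- 2 e (inner y (\<phi> \<zeta>)) + O(e^2)\<close>, so its first-order coefficient has a
  sign. Use for both \<open>v\<close> and \<open>- v\<close> gives equality.\<close>

lemma tangential_nonpos:
  assumes "norm (\<phi> \<zeta>) = 1" "\<And>z. z \<in> ball 0 1 \<Longrightarrow> norm (\<phi> z) < 1"
  shows "inner (D v) (\<phi> \<zeta>) \<le> 0"
proof -
  have "2 * inner (y n) (\<phi> \<zeta>) + e n * (norm (y n))\<^sup>2 \<le> 0" for n
  proof -
    have "(norm (\<phi> (z n)))\<^sup>2 \<le> 1" using assms(2)[OF z_ball[of n]] by (simp add: power_le_one less_imp_le)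
    then have "e n * (2 * inner (y n) (\<phi> \<zeta>) + e n * (norm (y n))\<^sup>2) \<le> 0"
      using norm2_phi[OF assms(1), of n] by (simp add: algebra_simps power2_eq_square)
    then show ?thesis using e(1)[of n] by (simp add: mult_le_0_iff)
  qed
  moreover have "(\<lambda>n. 2 * inner (y n) (\<phi> \<zeta>) + e n * (norm (y n))\<^sup>2) \<longlonglongrightarrow> 2 * inner (D v) (\<phi> \<zeta>) + 0 * (norm (D v))\<^sup>2"
    by (intro tendsto_intros y_tendsto e)
  ultimately have "2 * inner (D v) (\<phi> \<zeta>) + 0 * (norm (D v))\<^sup>2 \<le> 0"
    by (intro LIMSEQ_le_const2) auto
  then show ?thesis by simp
qed

text \<open>Once the first-order term is gone, the rest is of order \<open>e^2\<close>. Convergence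
  yields both the domination required by \<open>asymp_close\<close> and the possibility of trading
  the defect for \<open>e^2\<close> there.\<close>

lemma defect_tendsto:
  assumes "norm (\<phi> \<zeta>) = 1" "inner (D v) (\<phi> \<zeta>) = 0"
  shows "\<exists>L. (\<lambda>n. (1 - (norm (\<phi> (z n)))\<^sup>2) / (e n)\<^sup>2) \<longlonglongrightarrow> L"
proof -
  have "(1 - (norm (\<phi> (z n)))\<^sup>2) / (e n)\<^sup>2 = - 2 * inner ((1 / e n) *\<^sub>R (y n - D v)) (\<phi> \<zeta>) - (norm (y n))\<^sup>2" for n
    using e(1)[of n] assms(2) unfolding norm2_phi[OF assms(1)]
    by (simp add: inner_diff_left field_simps power2_eq_square)
  moreover have "(\<lambda>n. - 2 * inner ((1 / e n) *\<^sub>R (y n - D v)) (\<phi> \<zeta>) - (norm (y n))\<^sup>2)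
      \<longlonglongrightarrow> - 2 * inner (- (K *\<^sub>R D \<zeta>) - cinner v c *s D v) (\<phi> \<zeta>) - (norm (D v))\<^sup>2"
    by (intro tendsto_intros y_tendsto y_tendsto2)
  ultimately show ?thesis by auto
qed

end

text \<open>Without the last hypothesis the evaluation at \<open>z n\<close> of a function peaking at \<open>\<phi> (z n)\<close> could be
  negligible compared with the norm of the evaluation functional.\<close>

definition asymp_close :: "(complex^'n::finite \<Rightarrow> complex^'n) \<Rightarrow> (complex^'n \<Rightarrow> complex^'n) \<Rightarrow> bool" where
  "asymp_close \<phi> \<psi> \<longleftrightarrow> (\<forall>z. (\<forall>n::nat. z n \<in> ball 0 1) \<longrightarrow> (\<lambda>n. norm (\<phi> (z n))) \<longlonglongrightarrow> 1 \<longrightarrow>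
     (\<exists>M. \<forall>n. 1 - (norm (\<phi> (z n)))\<^sup>2 \<le> M * (1 - (norm (z n))\<^sup>2)) \<longrightarrow>
     (\<exists>r. strict_mono (r :: nat \<Rightarrow> nat) \<and>
        (\<lambda>n. cinner (\<phi> (z (r n)) - \<psi> (z (r n))) (\<phi> (z (r n))) / of_real (1 - (norm (\<phi> (z (r n))))\<^sup>2)) \<longlonglongrightarrow> 0))"

text \<open>The boundary data are compared in the order value, \<open>D\<close>, \<open>c\<close>,
  each comparison relying on the previous ones. That \<psi> also touches the sphere at \<zeta> is
  derived on the way, which is why the value is obtained from \<open>close(1)\<close> alone.\<close>

lemma lin_frac_eq_if_asymp_close:
  fixes \<phi> \<psi> :: "complex^'n::finite \<Rightarrow> complex^'n"
  assumes \<phi>: "lin_frac_selfmap \<phi>" "(SUP z\<in>ball 0 1. norm (\<phi> z)) = 1"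
    and \<psi>: "lin_frac_selfmap \<psi>" "(SUP z\<in>ball 0 1. norm (\<psi> z)) = 1"
    and close: "asymp_close \<phi> \<psi>" "asymp_close \<psi> \<phi>"
    and "w \<in> ball 0 1"
  shows "\<phi> w = \<psi> w"
proof -
  note \<phi>cb = lin_frac_closed_ball[OF \<phi>] and \<psi>cb = lin_frac_closed_ball[OF \<psi>]
  obtain \<zeta> where \<zeta>: "norm \<zeta> = 1" "norm (\<phi> \<zeta>) = 1" using \<phi>cb(4) by blast
  obtain D c where D: "bounded_linear D" "\<And>a h. D (a *s h) = a *s D h"
    and Df: "\<forall>h. \<zeta> + h \<in> cball 0 1 \<longrightarrow> 1 + cinner h c \<noteq> 0 \<and> \<phi> (\<zeta> + h) = \<phi> \<zeta> + (1 / (1 + cinner h c)) *s D h"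
    using \<phi>cb(5)[OF \<zeta>(1)] by blast
  obtain D' c' where D': "bounded_linear D'" "\<And>a h. D' (a *s h) = a *s D' h"
    and Df': "\<forall>h. \<zeta> + h \<in> cball 0 1 \<longrightarrow> 1 + cinner h c' \<noteq> 0 \<and> \<psi> (\<zeta> + h) = \<psi> \<zeta> + (1 / (1 + cinner h c')) *s D' h"
    using \<psi>cb(5)[OF \<zeta>(1)] by blast
  define K where "K v = ((norm v)\<^sup>2 + 2) / 2" for v :: "complex^'n"
  \<comment> \<open>The largest value, at \<open>n = 0\<close>, is exactly the bound
    \<open>1 / K v\<close> allowed by \<open>path_in_ball\<close>.\<close>
  define e where "e v n = 1 / (K v * real (Suc n))" for v n
  define h where "h v n = e v n *\<^sub>R v - (K v * (e v n)\<^sup>2) *\<^sub>R \<zeta>" for v n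
  define z where "z v n = \<zeta> + h v n" for v n
  define y where "y v n = (1 / (1 + cinner (h v n) c)) *s D (v - (K v * e v n) *\<^sub>R \<zeta>)" for v n
  define y' where "y' v n = (1 / (1 + cinner (h v n) c')) *s D' (v - (K v * e v n) *\<^sub>R \<zeta>)" for v n
  have K: "K v > 0" for v by (simp add: K_def add_nonneg_pos)
  have e: "e v n > 0" "K v * e v n \<le> 1" for v n
    using K[of v] by (simp_all add: e_def del: of_nat_Suc)
  have e0: "e v \<longlonglongrightarrow> 0" for v
  proof -
    have "(\<lambda>n. (1 / K v) * (1 / real (Suc n))) \<longlonglongrightarrow> (1 / K v) * 0"
      by (intro tendsto_intros LIMSEQ_Suc[OF lim_1_over_n])
    then show ?thesis by (simp add: e_def[abs_def])
  qed
  \<comment> \<open>Assumptions of the local context in their order; the underscore leaves the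
    tangency of \<open>v\<close> open.\<close>
  note ctx = \<zeta>(1) D Df _ K_def e e0 h_def z_def y_def
  note ctx' = \<zeta>(1) D' Df' _ K_def e e0 h_def z_def y'_def
  have tang: "inner (D v) (\<phi> \<zeta>) = 0" if "inner v \<zeta> = 0" for v
  proof -
    have "inner (D v) (\<phi> \<zeta>) \<le> 0" by (rule tangential_nonpos[OF ctx \<zeta>(2) \<phi>cb(3)]) (use that in auto)
    moreover have "inner (D (- v)) (\<phi> \<zeta>) \<le> 0" by (rule tangential_nonpos[OF ctx \<zeta>(2) \<phi>cb(3)]) (use that in auto)
    ultimately show ?thesis using D(1) by (simp add: linear_simps)
  qed
  have ztend: "z v \<longlonglongrightarrow> \<zeta>" if "inner v \<zeta> = 0" for v
  proof -
    have "(\<lambda>n. \<zeta> + h v n) \<longlonglongrightarrow> \<zeta> + 0" by (intro tendsto_intros h_tendsto[OF ctx] that)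
    then show ?thesis by (simp add: z_def[abs_def])
  qed
  have zb: "z v n \<in> ball 0 1" if "inner v \<zeta> = 0" for v n by (rule z_ball[OF ctx]) (rule that)
  have tend: "(\<lambda>n. f (z v n)) \<longlonglongrightarrow> f \<zeta>" if "inner v \<zeta> = 0" "continuous_on (cball 0 1) f"
    for v and f :: "complex^'n \<Rightarrow> complex^'n"
    using zb[OF that(1)] \<zeta>(1)
    by (intro continuous_on_tendsto_compose[OF that(2) ztend[OF that(1)]])
      (auto intro!: always_eventually intro: less_imp_le)
  have pt: "\<exists>M. \<forall>n. 1 - (norm (f (z v n)))\<^sup>2 \<le> M * (1 - (norm (z v n))\<^sup>2)"
    if v: "inner v \<zeta> = 0" and L: "(\<lambda>n. (1 - (norm (f (z v n)))\<^sup>2) / (e v n)\<^sup>2) \<longlonglongrightarrow> L"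
    for v L and f :: "complex^'n \<Rightarrow> complex^'n"
  proof -
    obtain M where M: "M > 0" "\<And>n. norm ((1 - (norm (f (z v n)))\<^sup>2) / (e v n)\<^sup>2) \<le> M"
      using convergent_imp_Bseq[OF convergentI[OF L]] unfolding Bseq_def by blast
    have "1 - (norm (f (z v n)))\<^sup>2 \<le> M * (1 - (norm (z v n))\<^sup>2)" for n
    proof -
      have "(1 - (norm (f (z v n)))\<^sup>2) / (e v n)\<^sup>2 \<le> M" using M(2)[of n] by (simp only: real_norm_def abs_le_iff)
      then have "1 - (norm (f (z v n)))\<^sup>2 \<le> M * (e v n)\<^sup>2" using e(1)[of v n] by (simp add: divide_le_eq)
      also have "\<dots> \<le> M * (1 - (norm (z v n))\<^sup>2)"
        by (rule mult_left_mono) (use z_norm[OF ctx, of v n] v M in auto)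
      finally show ?thesis .
    qed
    then show ?thesis by blast
  qed
  \<comment> \<open>The ratio of defect to \<open>e^2\<close> converges, so multiplying by it
    replaces the denominator in \<open>asymp_close\<close> by \<open>e^2\<close>. Refining a given
    subsequence \<open>s\<close> lets two applications share one subsequence.\<close>
  have use_close: "\<exists>r. strict_mono r \<and>
      (\<lambda>n. (1 / (e v (s (r n)))\<^sup>2) *\<^sub>R cinner (f (z v (s (r n))) - g (z v (s (r n)))) (f (z v (s (r n))))) \<longlonglongrightarrow> 0"
    if v: "inner v \<zeta> = 0" and s: "strict_mono s" and fg: "asymp_close f g" and f1: "norm (f \<zeta>) = 1"
      and cont: "continuous_on (cball 0 1) f" and lt: "\<And>z. z \<in> ball 0 1 \<Longrightarrow> norm (f z) < 1"
      and L: "(\<lambda>n. (1 - (norm (f (z v n)))\<^sup>2) / (e v n)\<^sup>2) \<longlonglongrightarrow> L"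
    for v L and s :: "nat \<Rightarrow> nat" and f g :: "complex^'n \<Rightarrow> complex^'n"
  proof -
    have "(\<lambda>n. norm (f (z v n))) \<longlonglongrightarrow> norm (f \<zeta>)" by (intro tendsto_norm tend v cont)
    then have 1: "(\<lambda>n. norm (f (z v (s n)))) \<longlonglongrightarrow> 1"
      using LIMSEQ_subseq_LIMSEQ[OF _ s] f1 by (fastforce simp: o_def)
    have 2: "\<exists>M. \<forall>n. 1 - (norm (f (z v (s n))))\<^sup>2 \<le> M * (1 - (norm (z v (s n)))\<^sup>2)"
      using pt[OF v L] by blast
    have 3: "\<forall>n. z v (s n) \<in> ball 0 1" using zb[OF v] by blast
    obtain r where r: "strict_mono r" and lim: "(\<lambda>n. cinner (f (z v (s (r n))) - g (z v (s (r n)))) (f (z v (s (r n)))) /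
        of_real (1 - (norm (f (z v (s (r n)))))\<^sup>2)) \<longlonglongrightarrow> 0"
      using fg[unfolded asymp_close_def, rule_format, of "\<lambda>n. z v (s n)"] 1 2 3 by auto
    have "(\<lambda>n. (1 - (norm (f (z v (s (r n)))))\<^sup>2) / (e v (s (r n)))\<^sup>2) \<longlonglongrightarrow> L"
      using LIMSEQ_subseq_LIMSEQ[OF L strict_mono_o[OF s r]] by (simp add: o_def)
    from tendsto_mult[OF tendsto_of_real[OF this] lim]
    have "(\<lambda>n. complex_of_real ((1 - (norm (f (z v (s (r n)))))\<^sup>2) / (e v (s (r n)))\<^sup>2) *
        (cinner (f (z v (s (r n))) - g (z v (s (r n)))) (f (z v (s (r n)))) /
        of_real (1 - (norm (f (z v (s (r n)))))\<^sup>2))) \<longlonglongrightarrow> 0" by simp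
    moreover have "complex_of_real ((1 - (norm (f (z v n)))\<^sup>2) / (e v n)\<^sup>2) *
        (cinner (f (z v n) - g (z v n)) (f (z v n)) / of_real (1 - (norm (f (z v n)))\<^sup>2))
      = (1 / (e v n)\<^sup>2) *\<^sub>R cinner (f (z v n) - g (z v n)) (f (z v n))" for n
    proof -
      have "(norm (f (z v n)))\<^sup>2 < 1" using lt[OF zb[OF v], of n] by (simp add: abs_square_less_1)
      then have "complex_of_real (1 - (norm (f (z v n)))\<^sup>2) \<noteq> 0"
        by (metis diff_gt_0_iff_gt less_irrefl of_real_eq_0_iff)
      then show ?thesis by (simp add: scaleR_conv_of_real del: of_real_diff of_real_power)
    qed
    ultimately show ?thesis using r by auto
  qed
  have L: "\<exists>L. (\<lambda>n. (1 - (norm (\<phi> (z v n)))\<^sup>2) / (e v n)\<^sup>2) \<longlonglongrightarrow> L" if v: "inner v \<zeta> = 0" for v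
    by (rule defect_tendsto[OF ctx \<zeta>(2)]) (use v tang in auto)
  \<comment> \<open>For \<open>v = 0\<close> the approach is radial. Multiplying back by
    \<open>e^2\<close> keeps only that the inner product itself tends to 0, and the equality case of
    Cauchy-Schwarz finishes.\<close>
  have eq\<zeta>: "\<psi> \<zeta> = \<phi> \<zeta>"
  proof -
    obtain L0 where L0: "(\<lambda>n. (1 - (norm (\<phi> (z 0 n)))\<^sup>2) / (e 0 n)\<^sup>2) \<longlonglongrightarrow> L0" using L[of 0] by auto
    obtain r where r: "strict_mono r"
      "(\<lambda>n. (1 / (e 0 (r n))\<^sup>2) *\<^sub>R cinner (\<phi> (z 0 (r n)) - \<psi> (z 0 (r n))) (\<phi> (z 0 (r n)))) \<longlonglongrightarrow> 0"
      using use_close[OF _ _ close(1) \<zeta>(2) \<phi>cb(1,3) L0, of id] by (auto simp: strict_mono_id)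
    have er: "(\<lambda>n. e 0 (r n)) \<longlonglongrightarrow> 0" using LIMSEQ_subseq_LIMSEQ[OF e0 r(1)] by (simp add: o_def)
    from tendsto_scaleR[OF tendsto_power[OF er, of 2] r(2)]
    have 0: "(\<lambda>n. cinner (\<phi> (z 0 (r n)) - \<psi> (z 0 (r n))) (\<phi> (z 0 (r n)))) \<longlonglongrightarrow> 0"
      using e(1)[of 0] by (simp add: less_imp_neq[symmetric])
    have "(\<lambda>n. cinner (\<phi> (z 0 n) - \<psi> (z 0 n)) (\<phi> (z 0 n))) \<longlonglongrightarrow> cinner (\<phi> \<zeta> - \<psi> \<zeta>) (\<phi> \<zeta>)"
      by (intro tendsto_intros tend \<phi>cb(1) \<psi>cb(1)) auto
    from LIMSEQ_unique[OF 0 LIMSEQ_subseq_LIMSEQ[OF this r(1), unfolded o_def]]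
    have "cinner (\<psi> \<zeta>) (\<phi> \<zeta>) = 1" using \<zeta>(2) by (simp add: cinner_diff_left cinner_self)
    then show ?thesis using cinner_eq_1_imp_eq[of "\<psi> \<zeta>" "\<phi> \<zeta>"] \<zeta> \<psi>cb(2)[of \<zeta>] by simp
  qed
  have tang': "inner (D' v) (\<psi> \<zeta>) = 0" if "inner v \<zeta> = 0" for v
  proof -
    have \<zeta>2: "norm (\<psi> \<zeta>) = 1" using eq\<zeta> \<zeta>(2) by simp
    have "inner (D' v) (\<psi> \<zeta>) \<le> 0" by (rule tangential_nonpos[OF ctx' \<zeta>2 \<psi>cb(3)]) (use that in auto)
    moreover have "inner (D' (- v)) (\<psi> \<zeta>) \<le> 0" by (rule tangential_nonpos[OF ctx' \<zeta>2 \<psi>cb(3)]) (use that in auto)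
    ultimately show ?thesis using D'(1) by (simp add: linear_simps)
  qed
  have L': "\<exists>L. (\<lambda>n. (1 - (norm (\<psi> (z v n)))\<^sup>2) / (e v n)\<^sup>2) \<longlonglongrightarrow> L" if v: "inner v \<zeta> = 0" for v
    by (rule defect_tendsto[OF ctx']) (use v tang' eq\<zeta> \<zeta> in auto)
  have diff: "\<phi> (z v n) - \<psi> (z v n) = e v n *\<^sub>R (y v n - y' v n)" if v: "inner v \<zeta> = 0" for v n
    using phi_expand[OF ctx, of v n] phi_expand[OF ctx', of v n] v eq\<zeta> by (simp add: scaleR_diff_right)
  \<comment> \<open>The two inner products add up to \<open>e^2 |y - y'|^2\<close>, so
    \<open>y - y'\<close> tends to 0 along a common subsequence, while its limit is
    \<open>D v - D' v\<close>.\<close>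
  have DD: "D v = D' v" if v: "inner v \<zeta> = 0" for v
  proof -
    obtain L0 where L0: "(\<lambda>n. (1 - (norm (\<phi> (z v n)))\<^sup>2) / (e v n)\<^sup>2) \<longlonglongrightarrow> L0" using L[OF v] by auto
    obtain L1 where L1: "(\<lambda>n. (1 - (norm (\<psi> (z v n)))\<^sup>2) / (e v n)\<^sup>2) \<longlonglongrightarrow> L1" using L'[OF v] by auto
    obtain s where s: "strict_mono s"
      "(\<lambda>n. (1 / (e v (s n))\<^sup>2) *\<^sub>R cinner (\<phi> (z v (s n)) - \<psi> (z v (s n))) (\<phi> (z v (s n)))) \<longlonglongrightarrow> 0"
      using use_close[OF v _ close(1) \<zeta>(2) \<phi>cb(1,3) L0, of id] by (auto simp: strict_mono_id)
    obtain r where r: "strict_mono r"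
      "(\<lambda>n. (1 / (e v (s (r n)))\<^sup>2) *\<^sub>R cinner (\<psi> (z v (s (r n))) - \<phi> (z v (s (r n)))) (\<psi> (z v (s (r n))))) \<longlonglongrightarrow> 0"
      using use_close[OF v s(1) close(2) _ \<psi>cb(1,3) L1] \<zeta>(2) eq\<zeta> by auto
    have sum: "(1 / (e v n)\<^sup>2) *\<^sub>R cinner (\<phi> (z v n) - \<psi> (z v n)) (\<phi> (z v n)) +
        (1 / (e v n)\<^sup>2) *\<^sub>R cinner (\<psi> (z v n) - \<phi> (z v n)) (\<psi> (z v n)) = of_real ((norm (y v n - y' v n))\<^sup>2)" for n
    proof -
      have "cinner (\<phi> (z v n) - \<psi> (z v n)) (\<phi> (z v n)) + cinner (\<psi> (z v n) - \<phi> (z v n)) (\<psi> (z v n))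
        = cinner (\<phi> (z v n) - \<psi> (z v n)) (\<phi> (z v n) - \<psi> (z v n))"
        by (simp add: cinner_diff_left cinner_diff_right)
      also have "\<dots> = (e v n)\<^sup>2 *\<^sub>R of_real ((norm (y v n - y' v n))\<^sup>2)"
        unfolding diff[OF v] by (simp add: cinner_self power_mult_distrib scaleR_conv_of_real[where 'a=complex])
      finally show ?thesis using e(1)[of v n] by (simp add: scaleR_add_right[symmetric] del: scaleR_add_right)
    qed
    have "(\<lambda>n. complex_of_real ((norm (y v (s (r n)) - y' v (s (r n))))\<^sup>2)) \<longlonglongrightarrow> 0 + 0"
      unfolding sum[symmetric]
      by (intro tendsto_add r(2) LIMSEQ_subseq_LIMSEQ[OF s(2) r(1), unfolded o_def])
    moreover have "(\<lambda>n. complex_of_real ((norm (y v n - y' v n))\<^sup>2)) \<longlonglongrightarrow> of_real ((norm (D v - D' v))\<^sup>2)"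
      by (intro tendsto_intros y_tendsto[OF ctx] y_tendsto[OF ctx'] v)
    ultimately have "complex_of_real ((norm (D v - D' v))\<^sup>2) = 0 + 0"
      using LIMSEQ_subseq_LIMSEQ[OF _ strict_mono_o[OF s(1) r(1)]] LIMSEQ_unique by (fastforce simp: o_def)
    then show ?thesis by simp
  qed
  \<comment> \<open>The vector \<open>\<i> *s \<zeta>\<close> is real tangential; complex linearity
    then carries the agreement of \<open>D\<close> and \<open>D'\<close> over to \<zeta>
    itself.\<close>
  have i\<zeta>: "inner (\<i> *s \<zeta>) \<zeta> = 0"
    using Re_cinner[of "\<i> *s \<zeta>" \<zeta>] by (simp add: cinner_smult_left cinner_self)
  have orth: "inner v \<zeta> = 0" if "cinner v \<zeta> = 0" for v using that Re_cinner[of v \<zeta>] by simp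
  have "D \<zeta> = D' \<zeta>" using DD[OF i\<zeta>] by (simp add: D D')
  then have D_eq: "D = D'" using DD orth by (intro complex_linear_eqI[OF D D' \<zeta>(1)]) auto
  \<comment> \<open>With \<open>D = D'\<close> the second-order coefficients of the two maps differ
    exactly by \<open>cinner v (c' - c) *s D v\<close>.\<close>
  have key: "cinner v (c' - c) * cinner (D v) (\<phi> \<zeta>) = 0" if v: "inner v \<zeta> = 0" for v
  proof -
    obtain L0 where L0: "(\<lambda>n. (1 - (norm (\<phi> (z v n)))\<^sup>2) / (e v n)\<^sup>2) \<longlonglongrightarrow> L0" using L[OF v] by auto
    obtain s where s: "strict_mono s"
      "(\<lambda>n. (1 / (e v (s n))\<^sup>2) *\<^sub>R cinner (\<phi> (z v (s n)) - \<psi> (z v (s n))) (\<phi> (z v (s n)))) \<longlonglongrightarrow> 0"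
      using use_close[OF v _ close(1) \<zeta>(2) \<phi>cb(1,3) L0, of id] by (auto simp: strict_mono_id)
    have "(1 / (e v n)\<^sup>2) *\<^sub>R cinner (\<phi> (z v n) - \<psi> (z v n)) (\<phi> (z v n)) =
      cinner ((1 / e v n) *\<^sub>R (y v n - D v) - (1 / e v n) *\<^sub>R (y' v n - D' v)) (\<phi> (z v n))" for n
      using e(1)[of v n] unfolding diff[OF v] D_eq
      by (simp add: cinner_scaleR_left scaleR_diff_right[symmetric] scaleR_conv_of_real[where 'a=complex] power2_eq_square)
    moreover have "(\<lambda>n. cinner ((1 / e v n) *\<^sub>R (y v n - D v) - (1 / e v n) *\<^sub>R (y' v n - D' v)) (\<phi> (z v n)))
      \<longlonglongrightarrow> cinner ((- (K v *\<^sub>R D \<zeta>) - cinner v c *s D v) - (- (K v *\<^sub>R D' \<zeta>) - cinner v c' *s D' v)) (\<phi> \<zeta>)"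
      by (intro tendsto_intros y_tendsto2[OF ctx] y_tendsto2[OF ctx'] v tend \<phi>cb)
    ultimately have "(\<lambda>n. (1 / (e v n)\<^sup>2) *\<^sub>R cinner (\<phi> (z v n) - \<psi> (z v n)) (\<phi> (z v n)))
      \<longlonglongrightarrow> cinner ((- (K v *\<^sub>R D \<zeta>) - cinner v c *s D v) - (- (K v *\<^sub>R D' \<zeta>) - cinner v c' *s D' v)) (\<phi> \<zeta>)"
      by simp
    from LIMSEQ_unique[OF s(2) LIMSEQ_subseq_LIMSEQ[OF this s(1), unfolded o_def]]
    show ?thesis unfolding D_eq
      by (auto simp: cinner_diff_left cinner_diff_right cinner_smult_left algebra_simps)
  qed
  \<comment> \<open>Otherwise \<open>\<phi> 0 - \<phi> \<zeta>\<close> would be orthogonal to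
    \<open>\<phi> \<zeta>\<close>, which would put the interior value \<open>\<phi> 0\<close> on the
    sphere.\<close>
  have D\<zeta>: "cinner (D \<zeta>) (\<phi> \<zeta>) \<noteq> 0"
  proof
    assume 0: "cinner (D \<zeta>) (\<phi> \<zeta>) = 0"
    have "\<phi> 0 = \<phi> \<zeta> + (1 / (1 + cinner (- \<zeta>) c)) *s D (- \<zeta>)" using Df[rule_format, of "- \<zeta>"] by simp
    moreover have "D (- \<zeta>) = - D \<zeta>" using D(1) by (simp add: linear_simps)
    ultimately have "cinner (\<phi> 0) (\<phi> \<zeta>) = 1"
      using 0 \<zeta>(2) by (simp add: cinner_add_left cinner_diff_left cinner_smult_left cinner_minus_left cinner_self)
    then have "\<phi> 0 = \<phi> \<zeta>" using cinner_eq_1_imp_eq[of "\<phi> 0" "\<phi> \<zeta>"] \<phi>cb(2)[of 0] \<zeta>(2) by simp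
    then show False using \<phi>cb(3)[of 0] \<zeta>(2) by simp
  qed
  have t\<zeta>: "cinner \<zeta> (c' - c) = 0" using key[OF i\<zeta>] D\<zeta> by (simp add: D cinner_smult_left)
  \<comment> \<open>If the first factor in \<open>key\<close> is nonzero at \<open>v\<close>, the
    second vanishes there. Adding \<open>\<i> *s \<zeta>\<close> to \<open>v\<close> keeps the first
    factor and makes the second nonzero.\<close>
  have tv: "cinner v (c' - c) = 0" if v: "cinner v \<zeta> = 0" for v
  proof (rule ccontr)
    assume t: "cinner v (c' - c) \<noteq> 0"
    then have "cinner (D v) (\<phi> \<zeta>) = 0" using key[OF orth[OF v]] by simp
    moreover have "D (v + \<i> *s \<zeta>) = D v + \<i> *s D \<zeta>" using D by (simp add: linear_simps)
    moreover have "inner (v + \<i> *s \<zeta>) \<zeta> = 0" using orth[OF v] i\<zeta> by (simp add: inner_add_left)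
    ultimately show False
      using key[of "v + \<i> *s \<zeta>"] t t\<zeta> D\<zeta> by (simp add: cinner_add_left cinner_smult_left)
  qed
  have "cinner x (c' - c) = 0" for x
  proof -
    define u where "u = x - cinner x \<zeta> *s \<zeta>"
    have "cinner u \<zeta> = 0" by (simp add: u_def cinner_diff_left cinner_smult_left cinner_self \<zeta>(1))
    from tv[OF this] show ?thesis using t\<zeta> by (simp add: u_def cinner_diff_left cinner_smult_left)
  qed
  from this[of "c' - c"] have "c' = c" by (simp add: cinner_self)
  moreover have "\<zeta> + (w - \<zeta>) \<in> cball 0 1" using assms(7) by simp
  ultimately show ?thesis using Df[rule_format, of "w - \<zeta>"] Df'[rule_format, of "w - \<zeta>"] eq\<zeta> D_eq by simp
qed

subsection \<open>Isometry invariance of Lebesgue measure\<close>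

lemma nn_integral_lborel_affine:
  fixes f :: "'a::euclidean_space \<Rightarrow> ennreal"
  assumes [measurable]: "f \<in> borel_measurable borel" and "c \<noteq> 0"
  shows "(\<integral>\<^sup>+x. f x \<partial>lborel) = ennreal (\<bar>c\<bar> ^ DIM('a)) * (\<integral>\<^sup>+x. f (t + c *\<^sub>R x) \<partial>lborel)"
  by (subst lborel_affine[OF assms(2), of t])
     (simp add: nn_integral_density nn_integral_distr nn_integral_cmult)

lemma nn_integral_lborel_shift:
  fixes f :: "'a::euclidean_space \<Rightarrow> ennreal"
  assumes [measurable]: "f \<in> borel_measurable borel"
  shows "(\<integral>\<^sup>+x. f (t + x) \<partial>lborel) = (\<integral>\<^sup>+x. f x \<partial>lborel)"
  using nn_integral_lborel_affine[of f 1 t] by simp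

text \<open>Uniqueness of Haar measure: integrate \<open>1\<^sub>A(f y) 1\<^sub>B(x - f y)\<close> over \<open>(x, y)\<close> in both orders,
  where \<open>B\<close> is the unit ball.\<close>

lemma lborel_distr_isometry:
  fixes f :: "'a::euclidean_space \<Rightarrow> 'a"
  assumes f: "orthogonal_transformation f"
  shows "distr lborel borel f = lborel"
proof (rule measure_eqI)
  fix A :: "'a set" assume "A \<in> sets (distr lborel borel f)"
  then have A[measurable]: "A \<in> sets borel" by simp
  have lin: "linear f" using f by (rule orthogonal_transformation_linear)
  have fm[measurable]: "f \<in> borel_measurable borel"
    using lin by (intro borel_measurable_continuous_onI linear_continuous_on) (simp add: linear_conv_bounded_linear)
  define B :: "'a set" where "B = ball 0 1"
  have [measurable]: "B \<in> sets borel" by (simp add: B_def)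
  define g :: "'a \<Rightarrow> 'a \<Rightarrow> ennreal" where "g x y = indicator A (f y) * indicator B (x - f y)" for x y
  have [measurable]: "(\<lambda>(x, y). g x y) \<in> borel_measurable (lborel \<Otimes>\<^sub>M lborel)"
    unfolding g_def split_beta' by measurable
  have emb: "(\<integral>\<^sup>+x. indicator B (x - f y) \<partial>lborel) = emeasure lborel B" for y
    using nn_integral_lborel_shift[of "indicator B" "- f y"] by simp
  have "(\<integral>\<^sup>+y. \<integral>\<^sup>+x. g x y \<partial>lborel \<partial>lborel) = (\<integral>\<^sup>+y. indicator A (f y) * emeasure lborel B \<partial>lborel)"
    unfolding g_def by (simp add: nn_integral_cmult emb)
  also have "\<dots> = emeasure (distr lborel borel f) A * emeasure lborel B"
    by (simp add: nn_integral_multc nn_integral_distr flip: nn_integral_indicator)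
  finally have 1: "(\<integral>\<^sup>+y. \<integral>\<^sup>+x. g x y \<partial>lborel \<partial>lborel) = emeasure (distr lborel borel f) A * emeasure lborel B" .
  have "(\<integral>\<^sup>+x. \<integral>\<^sup>+y. g x y \<partial>lborel \<partial>lborel) = (\<integral>\<^sup>+x. \<integral>\<^sup>+y. indicator A (x + f y) * indicator B (f y) \<partial>lborel \<partial>lborel)"
  proof (rule nn_integral_cong)
    fix x :: 'a
    \<comment> \<open>Shifting \<open>y\<close> by a preimage of \<open>x\<close> turns
      \<open>x - f y\<close> into \<open>- f y\<close>, and the ball is symmetric.\<close>
    obtain u where u: "f u = x" using orthogonal_transformation_surj[OF f] by (metis surjD)
    have "(\<integral>\<^sup>+y. g x y \<partial>lborel) = (\<integral>\<^sup>+y. g x (u + y) \<partial>lborel)"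
      by (rule nn_integral_lborel_shift[symmetric]) (simp add: g_def)
    also have "\<dots> = (\<integral>\<^sup>+y. indicator A (x + f y) * indicator B (f y) \<partial>lborel)"
      by (rule nn_integral_cong) (simp add: g_def linear_add[OF lin] u B_def indicator_def)
    finally show "(\<integral>\<^sup>+y. g x y \<partial>lborel) = (\<integral>\<^sup>+y. indicator A (x + f y) * indicator B (f y) \<partial>lborel)" .
  qed
  also have "\<dots> = (\<integral>\<^sup>+y. \<integral>\<^sup>+x. indicator A (x + f y) * indicator B (f y) \<partial>lborel \<partial>lborel)"
    by (rule lborel_pair.Fubini'[symmetric]) measurable
  also have "\<dots> = (\<integral>\<^sup>+y. emeasure lborel A * indicator B y \<partial>lborel)"
  proof (rule nn_integral_cong)
    fix y :: 'a
    have "(\<integral>\<^sup>+x. indicator A (x + f y) \<partial>lborel) = emeasure lborel A"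
      using nn_integral_lborel_shift[of "indicator A" "f y"] by (simp add: add.commute)
    moreover have "indicator B (f y) = (indicator B y :: ennreal)"
      using f by (simp add: B_def indicator_def orthogonal_transformation)
    ultimately show "(\<integral>\<^sup>+x. indicator A (x + f y) * indicator B (f y) \<partial>lborel) = emeasure lborel A * indicator B y"
      by (simp add: nn_integral_multc)
  qed
  also have "\<dots> = emeasure lborel A * emeasure lborel B" by (simp add: nn_integral_cmult)
  also have "(\<integral>\<^sup>+x. \<integral>\<^sup>+y. g x y \<partial>lborel \<partial>lborel) = (\<integral>\<^sup>+y. \<integral>\<^sup>+x. g x y \<partial>lborel \<partial>lborel)"
    by (rule lborel_pair.Fubini'[symmetric]) measurable
  finally have "emeasure (distr lborel borel f) A * emeasure lborel B = emeasure lborel A * emeasure lborel B"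
    unfolding 1 .
  moreover have "emeasure lborel B \<noteq> 0"
    unfolding B_def using open_not_negligible[of "ball (0::'a) 1"]
    by (metis ball_eq_empty negligible_iff_null_sets null_sets_completionI null_setsI open_ball
        not_one_le_zero borel_open sets_lborel)
  moreover have "emeasure lborel B \<noteq> \<infinity>"
    unfolding B_def using emeasure_lborel_ball_finite[of "0::'a" 1] by simp
  ultimately show "emeasure (distr lborel borel f) A = emeasure lborel A"
    by (simp add: mult.commute[of _ "emeasure lborel B"] ennreal_mult_cancel_left)
qed simp

lemma nn_integral_lborel_isometry:
  fixes f :: "'a::euclidean_space \<Rightarrow> 'a"
  assumes "orthogonal_transformation f" and [measurable]: "g \<in> borel_measurable borel"
  shows "(\<integral>\<^sup>+x. g (f x) \<partial>lborel) = (\<integral>\<^sup>+x. g x \<partial>lborel)"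
proof -
  have [measurable]: "f \<in> borel_measurable borel"
    using orthogonal_transformation_linear[OF assms(1)]
    by (intro borel_measurable_continuous_onI linear_continuous_on) (simp add: linear_conv_bounded_linear)
  have "(\<integral>\<^sup>+x. g (f x) \<partial>lborel) = (\<integral>\<^sup>+x. g x \<partial>distr lborel borel f)"
    by (simp add: nn_integral_distr)
  then show ?thesis by (simp add: lborel_distr_isometry[OF assms(1)])
qed

section \<open>Unitary changes of coordinates\<close>

lemma orthogonal_transformation_unimodular:
  assumes "cmod c = 1"
  shows "orthogonal_transformation ((*s) c :: complex^'n::finite \<Rightarrow> _)"
  unfolding orthogonal_transformation
  by (auto simp: norm_smult assms intro!: bounded_linear.linear
      bounded_bilinear.bounded_linear_right[OF bounded_bilinear_smult])

text \<open>A complex Householder reflection along \<open>p - q\<close> exchanges vectors of equal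
  norm only if their Hermitian product is real; the unimodular \<open>c\<close> arranges this. It
  reduces volume estimates in an arbitrary direction to coordinate boxes.\<close>

lemma unitary_to_axis:
  fixes w :: "complex^'n::finite" and k :: 'n
  obtains U where "orthogonal_transformation U" "\<And>x y. cinner (U x) (U y) = cinner x y"
    "U w = of_real (norm w) *s axis k 1"
proof (cases "w = 0")
  case True
  then show ?thesis using that[of "\<lambda>x. x"] by simp
next
  case False
  define b where "b = w $ k"
  define c where "c = (if b = 0 then 1 else cnj b / of_real (cmod b))"
  have c: "cmod c = 1" by (simp add: c_def norm_divide)
  have cb: "c * b = of_real (cmod b)"
    by (auto simp: c_def complex_norm_square[symmetric] mult.commute[of "cnj b"] power2_eq_square)
  \<comment> \<open>rotate \<open>w\<close> so that its inner product with the axis is real, then reflect\<close>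
  define p where "p = c *s w"
  define q where "q = of_real (norm w) *s axis k (1::complex)"
  have nq: "norm q = norm w" by (simp add: q_def norm_smult)
  have np: "norm p = norm w" by (simp add: p_def norm_smult c)
  have cax: "cinner x (axis k 1) = x $ k" for x :: "complex^'n"
    by (simp add: cinner_def axis_def if_distrib cong: if_cong)
  have pq: "cinner p q = of_real (norm w * cmod b)"
    by (simp add: q_def cinner_smult_right cax p_def b_def[symmetric] cb)
  have qp: "cinner q p = cinner p q" using cinner_commute[of q p] pq by simp
  define u where "u = p - q"
  define U where "U x = c *s x - (2 * cinner (c *s x) u / of_real ((norm u)\<^sup>2)) *s u" for x
  have uu: "cinner u u = of_real ((norm u)\<^sup>2)" by (rule cinner_self)
  have "c * cnj c = 1" using complex_norm_square[of c] c by simp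
  then have cc: "cinner (c *s x) (c *s y) = cinner x y" for x y :: "complex^'n"
    by (simp add: cinner_smult_left cinner_smult_right mult.assoc[symmetric] mult.commute)
  have pres: "cinner (U x) (U y) = cinner x y" for x y
  proof (cases "u = 0")
    case True
    then show ?thesis using cc by (simp add: U_def)
  next
    case False
    define s where "s = complex_of_real ((norm u)\<^sup>2)"
    have s: "s \<noteq> 0" "cnj s = s" using False by (simp_all add: s_def)
    have ux: "cinner u (c *s y) = cnj (cinner (c *s y) u)" by (rule cinner_commute)
    have "cinner (U x) (U y) = cinner (c *s x) (c *s y)"
      unfolding U_def s_def[symmetric]
      using s uu[folded s_def] ux
      by (simp add: cinner_diff_left cinner_diff_right cinner_smult_left[where x=u] cinner_smult_right[where z=u])
    also have "\<dots> = cinner x y" by (rule cc)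
    finally show ?thesis .
  qed
  have "bounded_linear U"
    unfolding U_def
    by (intro bounded_linear_sub bounded_bilinear.bounded_linear_right[OF bounded_bilinear_smult]
       bounded_linear_compose[OF bounded_bilinear.bounded_linear_left[OF bounded_bilinear_smult]]
       bounded_linear_divide[THEN bounded_linear_compose] bounded_linear_const_mult
       bounded_linear_compose[OF bounded_bilinear.bounded_linear_left[OF bounded_bilinear_cinner]])
  moreover have "norm (U x) = norm x" for x
  proof -
    have "complex_of_real ((norm (U x))\<^sup>2) = of_real ((norm x)\<^sup>2)" using pres[of x x] by (simp only: cinner_self)
    then have "(norm (U x))\<^sup>2 = (norm x)\<^sup>2" by (simp only: of_real_eq_iff)
    then show ?thesis by simp
  qed
  ultimately have "orthogonal_transformation U"
    unfolding orthogonal_transformation by (simp add: bounded_linear.linear)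
  moreover have "U w = q"
  proof (cases "u = 0")
    case True
    then show ?thesis by (simp add: U_def u_def p_def)
  next
    case False
    have "complex_of_real ((norm u)\<^sup>2) = 2 * cinner p u"
      unfolding uu[symmetric] unfolding u_def
      using cinner_self[of p] cinner_self[of q]
      by (simp add: cinner_diff_left cinner_diff_right qp np nq)
    then have "2 * cinner p u / of_real ((norm u)\<^sup>2) = 1" using False by (metis divide_self norm_eq_zero of_real_eq_0_iff zero_eq_power2)
    then show ?thesis by (simp add: U_def p_def[symmetric]) (simp add: u_def)
  qed
  ultimately show ?thesis using that[of U] pres by (simp add: q_def)
qed

text \<open>A one-sided substitute for integration in polar coordinates: average the integral over all
  dilations by factors in \<open>(1, 2)\<close> and substitute along rays.\<close>

lemma nn_integral_ball_le_polar:
  fixes F :: "'a::euclidean_space \<Rightarrow> ennreal"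
  assumes [measurable]: "F \<in> borel_measurable borel"
  shows "(\<integral>\<^sup>+y. F y * indicator (ball 0 1) y \<partial>lborel) \<le> ennreal (2 * 2 ^ DIM('a)) *
    (\<integral>\<^sup>+t. (\<integral>\<^sup>+x. F (t *\<^sub>R (x /\<^sub>R norm x)) * indicator (ball 0 1) x \<partial>lborel) * indicator {0<..<1} t \<partial>lborel)"
proof -
  let ?n = "DIM('a)"
  have ball_eq: "ball (0::'a) 1 = {x. norm x < 1}" by auto
  have [measurable]: "{x::'a. norm x < 1} \<in> sets borel" by measurable
  define G where "G y = F y * indicator {y. norm y < 1} y" for y
  have [measurable]: "G \<in> borel_measurable borel" unfolding G_def by measurable
  \<comment> \<open>Substitution \<open>t = s |x|\<close> on the ray through \<open>x\<close>: the
    condition \<open>s < 2\<close> bounds the factor \<open>1 / |x|\<close> by \<open>2 / t\<close>,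
    and \<open>1 < s\<close> becomes \<open>|x| < t\<close>.\<close>
  have ray: "(\<integral>\<^sup>+s. G (s *\<^sub>R x) * indicator {1<..<2} s \<partial>lborel) \<le>
      (\<integral>\<^sup>+t. ennreal (2 / t) * indicator {0<..<1} t * (F (t *\<^sub>R (x /\<^sub>R norm x)) * indicator {x. norm x < t} x) \<partial>lborel)"
    if x: "x \<noteq> 0" for x
  proof -
    have "(\<integral>\<^sup>+s. G (s *\<^sub>R x) * indicator {1<..<2} s \<partial>lborel)
      = ennreal \<bar>1 / norm x\<bar> * (\<integral>\<^sup>+t. G ((0 + (1 / norm x) * t) *\<^sub>R x) * indicator {1<..<2} (0 + (1 / norm x) * t) \<partial>lborel)"
      using x by (intro nn_integral_real_affine) auto
    also have "\<dots> = (\<integral>\<^sup>+t. ennreal (1 / norm x) * (G (t *\<^sub>R (x /\<^sub>R norm x)) * indicator {norm x<..<2 * norm x} t) \<partial>lborel)"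
    proof -
      have "(0 + (1 / norm x) * t) *\<^sub>R x = t *\<^sub>R (x /\<^sub>R norm x)" for t
        by (simp add: divide_inverse mult.commute)
      moreover have "indicator {1<..<2} (0 + (1 / norm x) * t) = (indicator {norm x<..<2 * norm x} t :: ennreal)" for t
        using x by (auto simp: indicator_def field_simps)
      ultimately show ?thesis by (simp only: abs_of_nonneg[OF divide_nonneg_nonneg] zero_le_one norm_ge_zero)
        (rule nn_integral_cmult[symmetric], measurable)
    qed
    also have "\<dots> \<le> (\<integral>\<^sup>+t. ennreal (2 / t) * indicator {0<..<1} t * (F (t *\<^sub>R (x /\<^sub>R norm x)) * indicator {x. norm x < t} x) \<partial>lborel)"
    proof (rule nn_integral_mono)
      fix t :: real
      show "ennreal (1 / norm x) * (G (t *\<^sub>R (x /\<^sub>R norm x)) * indicator {norm x<..<2 * norm x} t)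
        \<le> ennreal (2 / t) * indicator {0<..<1} t * (F (t *\<^sub>R (x /\<^sub>R norm x)) * indicator {x. norm x < t} x)"
      proof (cases "norm x < t \<and> t < 2 * norm x \<and> t < 1")
        case True
        then have t: "0 < t" using norm_ge_zero[of x] by linarith
        have "1 / norm x \<le> 2 / t" using True t x by (simp add: field_simps)
        then have "ennreal (1 / norm x) \<le> ennreal (2 / t)" by (rule ennreal_leI)
        then show ?thesis using True t x by (simp add: G_def indicator_def mult_right_mono)
      next
        case False
        have "norm (t *\<^sub>R (x /\<^sub>R norm x)) = \<bar>t\<bar>" using x by (simp add: abs_mult)
        then show ?thesis using False by (auto simp: G_def indicator_def)
      qed
    qed
    finally show ?thesis .
  qed
  have scale: "(\<integral>\<^sup>+x. F (t *\<^sub>R (x /\<^sub>R norm x)) * indicator {x. norm x < t} x \<partial>lborel)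
      = ennreal (t ^ ?n) * (\<integral>\<^sup>+x. F (t *\<^sub>R (x /\<^sub>R norm x)) * indicator {x. norm x < 1} x \<partial>lborel)" if t: "0 < t" for t :: real
  proof -
    have "(\<integral>\<^sup>+x. F (t *\<^sub>R (x /\<^sub>R norm x)) * indicator {x. norm x < t} x \<partial>lborel)
      = ennreal (\<bar>t\<bar> ^ ?n) * (\<integral>\<^sup>+x. F (t *\<^sub>R ((0 + t *\<^sub>R x) /\<^sub>R norm (0 + t *\<^sub>R x))) * indicator {x. norm x < t} (0 + t *\<^sub>R x) \<partial>lborel)"
      using t by (intro nn_integral_lborel_affine) auto
    also have "\<dots> = ennreal (t ^ ?n) * (\<integral>\<^sup>+x. F (t *\<^sub>R (x /\<^sub>R norm x)) * indicator {x. norm x < 1} x \<partial>lborel)"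
      using t by (auto intro!: arg_cong2[where f="(*)"] nn_integral_cong arg_cong[where f=F] simp: indicator_def)
    finally show ?thesis .
  qed
  \<comment> \<open>The interval of dilations has length 1, so averaging is free; undoing a dilation
    by \<open>s < 2\<close> costs at most \<open>2 ^ DIM('a)\<close>.\<close>
  have "(\<integral>\<^sup>+y. G y \<partial>lborel) = (\<integral>\<^sup>+s. (\<integral>\<^sup>+y. G y \<partial>lborel) * indicator {1<..<2::real} s \<partial>lborel)"
    by (simp add: nn_integral_cmult)
  also have "\<dots> \<le> (\<integral>\<^sup>+s. (ennreal (2 ^ ?n) * (\<integral>\<^sup>+x. G (s *\<^sub>R x) \<partial>lborel)) * indicator {1<..<2::real} s \<partial>lborel)"
  proof (rule nn_integral_mono)
    fix s :: real
    show "(\<integral>\<^sup>+y. G y \<partial>lborel) * indicator {1<..<2} s \<le> ennreal (2 ^ ?n) * (\<integral>\<^sup>+x. G (s *\<^sub>R x) \<partial>lborel) * indicator {1<..<2} s"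
    proof (cases "1 < s \<and> s < 2")
      case True
      have "(\<integral>\<^sup>+y. G y \<partial>lborel) = ennreal (\<bar>s\<bar> ^ ?n) * (\<integral>\<^sup>+x. G (0 + s *\<^sub>R x) \<partial>lborel)"
        using True by (intro nn_integral_lborel_affine) auto
      also have "\<dots> \<le> ennreal (2 ^ ?n) * (\<integral>\<^sup>+x. G (s *\<^sub>R x) \<partial>lborel)"
        using True by (auto intro!: mult_right_mono ennreal_leI power_mono)
      finally show ?thesis using True by simp
    qed simp
  qed
  also have "\<dots> = (\<integral>\<^sup>+s. ennreal (2 ^ ?n) * (\<integral>\<^sup>+x. G (s *\<^sub>R x) * indicator {1<..<2::real} s \<partial>lborel) \<partial>lborel)"
    by (intro nn_integral_cong) (simp add: nn_integral_multc mult.assoc)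
  also have "\<dots> = ennreal (2 ^ ?n) * (\<integral>\<^sup>+s. (\<integral>\<^sup>+x. G (s *\<^sub>R x) * indicator {1<..<2::real} s \<partial>lborel) \<partial>lborel)"
    by (rule nn_integral_cmult) measurable
  finally have 1: "(\<integral>\<^sup>+y. G y \<partial>lborel) \<le> \<dots>" .
  have "(\<integral>\<^sup>+s. (\<integral>\<^sup>+x. G (s *\<^sub>R x) * indicator {1<..<2::real} s \<partial>lborel) \<partial>lborel)
      = (\<integral>\<^sup>+x. (\<integral>\<^sup>+s. G (s *\<^sub>R x) * indicator {1<..<2::real} s \<partial>lborel) \<partial>lborel)"
    by (rule lborel_pair.Fubini') measurable
  also have "\<dots> \<le> (\<integral>\<^sup>+x. (\<integral>\<^sup>+t. ennreal (2 / t) * indicator {0<..<1} t * (F (t *\<^sub>R (x /\<^sub>R norm x)) * indicator {x. norm x < t} x) \<partial>lborel) \<partial>lborel)"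
    by (rule nn_integral_mono_AE, rule AE_mp[OF AE_lborel_singleton[of "0::'a"]], rule AE_I2) (use ray in blast)
  also have "\<dots> = (\<integral>\<^sup>+t. (\<integral>\<^sup>+x. ennreal (2 / t) * indicator {0<..<1} t * (F (t *\<^sub>R (x /\<^sub>R norm x)) * indicator {x. norm x < t} x) \<partial>lborel) \<partial>lborel)"
    by (rule lborel_pair.Fubini') (simp add: indicator_def[of "{x. norm x < _}"], measurable)
  also have "\<dots> \<le> (\<integral>\<^sup>+t. 2 * ((\<integral>\<^sup>+x. F (t *\<^sub>R (x /\<^sub>R norm x)) * indicator {x. norm x < 1} x \<partial>lborel) * indicator {0<..<1} t) \<partial>lborel)"
  proof (rule nn_integral_mono)
    fix t :: real
    show "(\<integral>\<^sup>+x. ennreal (2 / t) * indicator {0<..<1} t * (F (t *\<^sub>R (x /\<^sub>R norm x)) * indicator {x. norm x < t} x) \<partial>lborel)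
      \<le> 2 * ((\<integral>\<^sup>+x. F (t *\<^sub>R (x /\<^sub>R norm x)) * indicator {x. norm x < 1} x \<partial>lborel) * indicator {0<..<1} t)"
    proof (cases "0 < t \<and> t < 1")
      case True
      then have t: "0 < t" "t < 1" by auto
      \<comment> \<open>The Jacobian \<open>t ^ ?n\<close> of the dilation absorbs the singular
        factor, because the dimension is at least 1.\<close>
      have "2 / t * t ^ ?n \<le> 2"
      proof -
        have "t ^ ?n \<le> t ^ 1" using t by (intro power_decreasing) auto
        then show ?thesis using t by (simp add: field_simps)
      qed
      then have "ennreal (2 / t * t ^ ?n) \<le> ennreal 2" by (rule ennreal_leI)
      moreover have "ennreal (2 / t * t ^ ?n) = ennreal (2 / t) * ennreal (t ^ ?n)"
        by (rule ennreal_mult) (use t in auto)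
      ultimately have "ennreal (2 / t) * ennreal (t ^ ?n) \<le> 2" by simp
      moreover have "(\<integral>\<^sup>+x. ennreal (2 / t) * indicator {0<..<1} t * (F (t *\<^sub>R (x /\<^sub>R norm x)) * indicator {x. norm x < t} x) \<partial>lborel)
        = (ennreal (2 / t) * ennreal (t ^ ?n)) * (\<integral>\<^sup>+x. F (t *\<^sub>R (x /\<^sub>R norm x)) * indicator {x. norm x < 1} x \<partial>lborel)"
        using t by (subst nn_integral_cmult) (simp_all only: scale[OF t(1)] mult.assoc, simp_all)
      ultimately show ?thesis using t by (simp add: mult_right_mono)
    qed auto
  qed
  also have "\<dots> = 2 * (\<integral>\<^sup>+t. ((\<integral>\<^sup>+x. F (t *\<^sub>R (x /\<^sub>R norm x)) * indicator {x. norm x < 1} x \<partial>lborel) * indicator {0<..<1} t) \<partial>lborel)"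
    by (rule nn_integral_cmult) measurable
  finally have 2: "(\<integral>\<^sup>+s. (\<integral>\<^sup>+x. G (s *\<^sub>R x) * indicator {1<..<2::real} s \<partial>lborel) \<partial>lborel) \<le> \<dots>" .
  have "ennreal (2 ^ ?n * 2) = ennreal (2 ^ ?n) * ennreal 2" by (rule ennreal_mult) auto
  then have "ennreal (2 * 2 ^ ?n) = ennreal (2 ^ ?n) * 2" by (metis ennreal_numeral mult.commute)
  then show ?thesis
    unfolding ball_eq G_def[symmetric] using order_trans[OF 1 mult_left_mono[OF 2]] by (simp add: mult.assoc)
qed

lemma nn_integral_sigma_sphere:
  fixes F :: "complex^'n::finite \<Rightarrow> ennreal"
  assumes [measurable]: "F \<in> borel_measurable borel"
  shows "(\<integral>\<^sup>+x. F x \<partial>sigma_sphere) = (\<integral>\<^sup>+x. F (x /\<^sub>R norm x) * indicator (ball 0 1) x \<partial>lborel) / emeasure lborel (ball (0::complex^'n) 1)"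
  unfolding sigma_sphere_def nu_ball_def
  by (subst nn_integral_distr) (auto simp: nn_integral_uniform_measure)

subsection \<open>Point evaluations\<close>

lemma emeasure_complex_box:
  fixes s t :: "'n::finite \<Rightarrow> real"
  assumes "\<And>j. 0 \<le> s j" "\<And>j. 0 \<le> t j"
  shows "emeasure lborel {x :: complex^'n. \<forall>j. \<bar>Re (x $ j)\<bar> < s j \<and> \<bar>Im (x $ j)\<bar> < t j} = ennreal (\<Prod>j\<in>UNIV. 4 * s j * t j)"
proof -
  define a :: "complex^'n" where "a = (\<chi> j. Complex (s j) (t j))"
  have Bas: "(Basis :: (complex^'n) set) = (\<lambda>(i, u). axis i u) ` (UNIV \<times> Basis)"
    by (auto simp: Basis_vec_def)
  have inj: "inj_on (\<lambda>(i, u). axis i u :: complex^'n) (UNIV \<times> Basis)"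
    by (auto simp: inj_on_def axis_eq_axis)
  have ab: "a \<bullet> axis i 1 = s i" "a \<bullet> axis i \<i> = t i" for i
    by (simp_all add: inner_axis a_def inner_complex_def)
  have "{x :: complex^'n. \<forall>j. \<bar>Re (x $ j)\<bar> < s j \<and> \<bar>Im (x $ j)\<bar> < t j} = box (- a) a"
    unfolding box_def Bas
    by (auto simp: ab Basis_complex_def inner_axis inner_complex_def abs_less_iff a_def; metis minus_less_iff)
  moreover have "emeasure lborel (box (- a) a) = ennreal (\<Prod>b\<in>Basis. (a - (- a)) \<bullet> b)"
    by (intro emeasure_lborel_box) (use assms in \<open>auto simp: Bas Basis_complex_def ab\<close>)
  moreover have "(\<Prod>b\<in>Basis. (a - (- a)) \<bullet> b) = (\<Prod>j\<in>UNIV. 4 * s j * t j)"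
  proof -
    have "(\<Prod>b\<in>Basis. (a - (- a)) \<bullet> b) = (\<Prod>p\<in>UNIV \<times> Basis. (a - (- a)) \<bullet> (case p of (i, u) \<Rightarrow> axis i u))"
      unfolding Bas by (subst prod.reindex[OF inj]) (simp add: o_def)
    also have "\<dots> = (\<Prod>j\<in>UNIV. \<Prod>u\<in>Basis. (a - (- a)) \<bullet> axis j u)"
      by (subst prod.cartesian_product) (auto intro: prod.cong)
    also have "\<dots> = (\<Prod>j\<in>UNIV. 4 * s j * t j)"
      unfolding inner_diff_left inner_minus_left by (intro prod.cong refl) (simp add: Basis_complex_def ab)
    finally show ?thesis .
  qed
  ultimately show ?thesis by simp
qed

section \<open>Sub-mean-value inequalities for holomorphic functions\<close>

lemma holo_ball_continuous: "holo_ball f \<Longrightarrow> continuous_on (ball 0 1) f"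
  unfolding holo_ball_def
  by (meson continuous_at_imp_continuous_on has_derivative_continuous)

lemma holo_ball_diff:
  fixes f g :: "complex^'n::finite \<Rightarrow> complex"
  assumes "holo_ball f" "holo_ball g"
  shows "holo_ball (\<lambda>z. f z - g z)"
  unfolding holo_ball_def
proof
  fix z :: "complex^'n" assume z: "z \<in> ball 0 1"
  obtain L where L: "(f has_derivative L) (at z)" "\<And>c v. L (c *s v) = c * L v"
    using assms(1) z unfolding holo_ball_def by blast
  obtain M where M: "(g has_derivative M) (at z)" "\<And>c v. M (c *s v) = c * M v"
    using assms(2) z unfolding holo_ball_def by blast
  show "\<exists>L. ((\<lambda>z. f z - g z) has_derivative L) (at z) \<and> (\<forall>c v. L (c *s v) = c * L v)"
    by (rule exI[of _ "\<lambda>h. L h - M h"])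
       (auto intro!: has_derivative_diff L(1) M(1) simp: L(2) M(2) right_diff_distrib)
qed

lemma holo_ball_line:
  assumes h: "holo_ball h" and z: "z + \<xi> *s v \<in> ball 0 1"
  shows "(\<lambda>\<xi>. h (z + \<xi> *s v)) field_differentiable (at \<xi>)"
proof -
  obtain L where L: "(h has_derivative L) (at (z + \<xi> *s v))" "\<And>c v. L (c *s v) = c * L v"
    using assms unfolding holo_ball_def by blast
  have "((\<lambda>\<xi>. z + \<xi> *s v) has_derivative (\<lambda>x. x *s v)) (at \<xi>)"
    by (auto intro!: derivative_eq_intros bounded_linear_imp_has_derivative
        bounded_bilinear.bounded_linear_left[OF bounded_bilinear_smult])
  from has_derivative_compose[OF this L(1)]
  have "((\<lambda>\<xi>. h (z + \<xi> *s v)) has_derivative (\<lambda>x. L v * x)) (at \<xi>)" by (simp add: L(2) mult.commute)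
  then show ?thesis unfolding field_differentiable_def has_field_derivative_def by blast
qed

text \<open>The Cauchy formula is applied to the square of \<open>h\<close> on a complex line,
  because the modulus of the square is the quantity wanted.\<close>

lemma circle_mean_le:
  fixes h :: "complex^'n::finite \<Rightarrow> complex"
  assumes h: "holo_ball h" and zv: "\<And>\<xi>. cmod \<xi> \<le> 1 \<Longrightarrow> z + \<xi> *s v \<in> ball 0 1"
  shows "ennreal ((cmod (h z))\<^sup>2) \<le>
    (\<integral>\<^sup>+t. ennreal ((cmod (h (z + exp (2 * of_real pi * \<i> * of_real t) *s v)))\<^sup>2) * indicator {0..1} t \<partial>lborel)"
proof -
  define k where "k \<xi> = (h (z + \<xi> *s v))\<^sup>2" for \<xi>
  define E where "E t = exp (2 * of_real pi * \<i> * of_real t)" for t :: real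
  have E: "cmod (E t) = 1" for t by (simp add: E_def)
  have fd: "k field_differentiable (at \<xi>)" if "cmod \<xi> \<le> 1" for \<xi>
    unfolding k_def using holo_ball_line[OF h zv[OF that]]
    by (auto intro!: derivative_intros)
  have cont: "continuous_on (cball 0 1) k"
    by (rule continuous_at_imp_continuous_on) (auto intro!: field_differentiable_imp_continuous_at fd)
  have "k holomorphic_on ball 0 1"
    unfolding holomorphic_on_def by (auto intro!: field_differentiable_at_within fd)
  from Cauchy_integral_circlepath[OF cont this, of 0]
  have "((\<lambda>u. k u / u) has_contour_integral (2 * of_real pi * \<i> * k 0)) (circlepath 0 1)" by simp
  then have "((\<lambda>t. k (E t) / E t * (2 * of_real pi * \<i> * E t)) has_integral (2 * of_real pi * \<i> * k 0)) {0..1}"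
    unfolding has_contour_integral_def
    by (rule has_integral_eq[rotated])
       (simp add: vector_derivative_circlepath01, simp add: circlepath E_def)
  then have "((\<lambda>t. 1 / (2 * of_real pi * \<i>) * (k (E t) / E t * (2 * of_real pi * \<i> * E t))) has_integral 1 / (2 * of_real pi * \<i>) * (2 * of_real pi * \<i> * k 0)) {0..1}"
    by (rule has_integral_mult_right)
  then have int: "((\<lambda>t. k (E t)) has_integral k 0) {0..1}"
    by (simp add: E_def)
  have contE: "continuous_on {0..1} (\<lambda>t. norm (k (E t)))"
    by (intro continuous_on_norm continuous_on_compose2[OF cont]) (auto simp: E_def intro!: continuous_intros)
  then have int2: "(\<lambda>t. norm (k (E t))) integrable_on {0..1}" by (rule integrable_continuous_interval)
  have "norm (k 0) \<le> integral {0..1} (\<lambda>t. norm (k (E t)))"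
    using integral_norm_bound_integral[OF has_integral_integrable[OF int] int2] integral_unique[OF int] by simp
  then have "ennreal (norm (k 0)) \<le> ennreal (integral {0..1} (\<lambda>t. norm (k (E t))))" by (rule ennreal_leI)
  also have "\<dots> = (\<integral>\<^sup>+t. ennreal (norm (k (E t))) * indicator {0..1} t \<partial>lborel)"
    by (rule nn_integral_has_integral_lebesgue'[symmetric]) (auto intro: integrable_integral int2)
  finally show ?thesis by (simp add: k_def E_def norm_power)
qed

text \<open>\<open>holo_ball\<close> says nothing about values off the ball, so the function is cut
  off before measurability is claimed.\<close>

lemma borel_measurable_holo_ball:
  fixes h :: "complex^'n::finite \<Rightarrow> complex"
  assumes "holo_ball h"
  shows "(\<lambda>x. ennreal ((cmod (h x))\<^sup>2) * indicator (ball 0 1) x) \<in> borel_measurable borel"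
proof -
  have "(\<lambda>x. indicator (ball 0 1) x *\<^sub>R (cmod (h x))\<^sup>2) \<in> borel_measurable borel"
    by (intro borel_measurable_continuous_on_indicator continuous_intros holo_ball_continuous assms) auto
  then have "(\<lambda>x. ennreal (indicator (ball 0 1) x *\<^sub>R (cmod (h x))\<^sup>2)) \<in> borel_measurable borel" by measurable
  also have "(\<lambda>x. ennreal (indicator (ball 0 1) x *\<^sub>R (cmod (h x))\<^sup>2)) = (\<lambda>x. ennreal ((cmod (h x))\<^sup>2) * indicator (ball 0 1) x)"
    by (auto simp: indicator_def fun_eq_iff)
  finally show ?thesis .
qed

text \<open>The circle inequality is integrated over all \<open>v\<close> in \<open>S\<close>. After
  exchanging the integrals, rotation invariance of Lebesgue measure makes the inner integral
  independent of the angle.\<close>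

lemma balanced_mean_le:
  fixes h :: "complex^'n::finite \<Rightarrow> complex"
  assumes h: "holo_ball h" and [measurable]: "S \<in> sets borel"
    and bal: "\<And>c v. cmod c \<le> 1 \<Longrightarrow> v \<in> S \<Longrightarrow> c *s v \<in> S" and zS: "\<And>v. v \<in> S \<Longrightarrow> z + v \<in> ball 0 1"
  shows "ennreal ((cmod (h z))\<^sup>2) * emeasure lborel S
    \<le> (\<integral>\<^sup>+v. ennreal ((cmod (h (z + v)))\<^sup>2) * indicator S v \<partial>lborel)"
proof -
  define G where "G x = ennreal ((cmod (h x))\<^sup>2) * indicator (ball 0 1) x" for x
  have [measurable]: "G \<in> borel_measurable borel" unfolding G_def by (rule borel_measurable_holo_ball[OF h])
  define E where "E t = exp (2 * of_real pi * \<i> * of_real t)" for t :: real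
  have E: "cmod (E t) = 1" for t by (simp add: E_def)
  have [measurable]: "(\<lambda>p. E (fst p) *s snd p) \<in> borel_measurable (borel \<Otimes>\<^sub>M (borel :: (complex^'n) measure))"
    unfolding borel_prod E_def
    by (intro borel_measurable_continuous_onI continuous_intros)
  have [measurable]: "(\<lambda>p. E (snd p) *s fst p) \<in> borel_measurable ((borel :: (complex^'n) measure) \<Otimes>\<^sub>M borel)"
    unfolding borel_prod E_def
    by (intro borel_measurable_continuous_onI continuous_intros)
  have [measurable]: "(\<lambda>v. E t *s v) \<in> borel_measurable (borel :: (complex^'n) measure)" for t
    by (intro borel_measurable_continuous_onI continuous_intros)
  have "ennreal ((cmod (h z))\<^sup>2) * emeasure lborel S = (\<integral>\<^sup>+v. ennreal ((cmod (h z))\<^sup>2) * indicator S v \<partial>lborel)"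
    by (simp add: nn_integral_cmult)
  also have "\<dots> \<le> (\<integral>\<^sup>+v. \<integral>\<^sup>+t. G (z + E t *s v) * indicator S (E t *s v) * indicator {0..1} t \<partial>lborel \<partial>lborel)"
  proof (rule nn_integral_mono)
    fix v
    show "ennreal ((cmod (h z))\<^sup>2) * indicator S v
      \<le> (\<integral>\<^sup>+t. G (z + E t *s v) * indicator S (E t *s v) * indicator {0..1} t \<partial>lborel)"
    proof (cases "v \<in> S")
      case True
      have "ennreal ((cmod (h z))\<^sup>2) \<le> (\<integral>\<^sup>+t. ennreal ((cmod (h (z + E t *s v)))\<^sup>2) * indicator {0..1} t \<partial>lborel)"
        unfolding E_def by (rule circle_mean_le[OF h]) (use True bal zS in blast)
      also have "\<dots> = (\<integral>\<^sup>+t. G (z + E t *s v) * indicator S (E t *s v) * indicator {0..1} t \<partial>lborel)"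
      proof (rule nn_integral_cong)
        fix t
        have "E t *s v \<in> S" "z + E t *s v \<in> ball 0 1" using bal zS True E[of t] by auto
        then show "ennreal ((cmod (h (z + E t *s v)))\<^sup>2) * indicator {0..1} t =
            G (z + E t *s v) * indicator S (E t *s v) * indicator {0..1} t"
          by (simp add: G_def)
      qed
      finally show ?thesis using True by simp
    qed simp
  qed
  also have "\<dots> = (\<integral>\<^sup>+t. \<integral>\<^sup>+v. G (z + E t *s v) * indicator S (E t *s v) * indicator {0..1} t \<partial>lborel \<partial>lborel)"
    by (rule lborel_pair.Fubini') measurable
  also have "\<dots> = (\<integral>\<^sup>+t. (\<integral>\<^sup>+v. G (z + v) * indicator S v \<partial>lborel) * indicator {0..1::real} t \<partial>lborel)"
  proof (rule nn_integral_cong)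
    fix t :: real
    have "(\<integral>\<^sup>+v. G (z + E t *s v) * indicator S (E t *s v) \<partial>lborel) = (\<integral>\<^sup>+v. G (z + v) * indicator S v \<partial>lborel)"
      by (rule nn_integral_lborel_isometry[OF orthogonal_transformation_unimodular[OF E]]) measurable
    then show "(\<integral>\<^sup>+v. G (z + E t *s v) * indicator S (E t *s v) * indicator {0..1} t \<partial>lborel)
      = (\<integral>\<^sup>+v. G (z + v) * indicator S v \<partial>lborel) * indicator {0..1} t"
      by (simp add: nn_integral_multc)
  qed
  also have "\<dots> = (\<integral>\<^sup>+v. G (z + v) * indicator S v \<partial>lborel)"
    by (simp add: nn_integral_cmult)
  also have "\<dots> = (\<integral>\<^sup>+v. ennreal ((cmod (h (z + v)))\<^sup>2) * indicator S v \<partial>lborel)"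
    by (rule nn_integral_cong) (use zS in \<open>auto simp: G_def indicator_def\<close>)
  finally show ?thesis .
qed

section \<open>Nonisotropic regions and their volume\<close>

lemma norm2_projection:
  assumes "norm e = 1"
  shows "(norm x)\<^sup>2 = (cmod (cinner x e))\<^sup>2 + (norm (x - cinner x e *s e))\<^sup>2"
proof -
  have "complex_of_real ((norm (x - cinner x e *s e))\<^sup>2) = of_real ((norm x)\<^sup>2) - of_real ((cmod (cinner x e))\<^sup>2)"
    unfolding complex_norm_square[of "cinner x e"] cinner_self[symmetric]
    using cinner_self[of e] assms cinner_commute[of e x]
    by (simp add: cinner_diff_left cinner_diff_right cinner_smult_left cinner_smult_right algebra_simps)
  then have "complex_of_real ((norm (x - cinner x e *s e))\<^sup>2) = of_real ((norm x)\<^sup>2 - (cmod (cinner x e))\<^sup>2)" by simp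
  then show ?thesis by (simp only: of_real_eq_iff)
qed

lemma cinner_axis: "cinner x (axis k 1) = x $ k"
  by (simp add: cinner_def axis_def if_distrib cong: if_cong)

lemma norm2_vec_remove: "(norm (x :: complex^'n::finite))\<^sup>2 = (cmod (x $ k))\<^sup>2 + (\<Sum>j\<in>UNIV - {k}. (cmod (x $ j))\<^sup>2)"
proof -
  have "(norm x)\<^sup>2 = (\<Sum>j\<in>UNIV. (cmod (x $ j))\<^sup>2)" by (simp add: norm_vec_def L2_set_def sum_nonneg)
  then show ?thesis by (simp add: sum.remove[of UNIV k])
qed

text \<open>For a unit vector \<open>e\<close>, the shape of a Koranyi region, centred at 0 so that
  it is balanced: size \<open>d\<close> in the complex direction \<open>e\<close>, size
  \<open>sqrt d\<close> orthogonally to it, volume of order \<open>d ^ (N + 1)\<close>.\<close>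

definition koranyi :: "complex^'n::finite \<Rightarrow> real \<Rightarrow> (complex^'n) set" where
  "koranyi e d = {v. cmod (cinner v e) < d / 4 \<and> (norm (v - cinner v e *s e))\<^sup>2 < d / 4}"

lemma open_koranyi: "open (koranyi e d)"
  unfolding koranyi_def
  by (intro open_Collect_conj open_Collect_less continuous_intros)

lemma koranyi_balanced:
  assumes "cmod c \<le> 1" "v \<in> koranyi e d"
  shows "c *s v \<in> koranyi e d"
proof -
  have v: "cmod (cinner v e) < d / 4" "(norm (v - cinner v e *s e))\<^sup>2 < d / 4" using assms(2) by (auto simp: koranyi_def)
  have "cmod (cinner (c *s v) e) \<le> cmod (cinner v e)"
    using assms(1) by (simp add: cinner_smult_left norm_mult mult_left_le_one_le)
  moreover have "c *s v - cinner (c *s v) e *s e = c *s (v - cinner v e *s e)"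
    by (simp add: cinner_smult_left vec_eq_iff algebra_simps)
  moreover have "(norm (c *s (v - cinner v e *s e)))\<^sup>2 \<le> (norm (v - cinner v e *s e))\<^sup>2"
    unfolding norm_smult using assms(1) by (intro power_mono) (auto simp: mult_left_le_one_le)
  ultimately show ?thesis using v by (simp only: koranyi_def mem_Collect_eq) linarith
qed

text \<open>By Pythagoras along \<open>e\<close>, the normal part has modulus between
  \<open>1 - 5 d / 4\<close> and \<open>1 - 3 d / 4\<close>, and the tangential part adds less than
  \<open>d / 4\<close> to the squared norm. The upper bound is trivial once \<open>4 * d\<close>
  reaches 1.\<close>

lemma koranyi_shell:
  assumes e: "norm e = 1" and z: "z = of_real (1 - d) *s e" and d: "0 < d" "d \<le> 1" and v: "v \<in> koranyi e d"
  shows "d / 2 \<le> 1 - (norm (z + v))\<^sup>2" "1 - (norm (z + v))\<^sup>2 \<le> 4 * d"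
proof -
  have v: "cmod (cinner v e) < d / 4" "(norm (v - cinner v e *s e))\<^sup>2 < d / 4" using v by (auto simp: koranyi_def)
  have ze: "cinner (z + v) e = of_real (1 - d) + cinner v e"
    unfolding z cinner_add_left cinner_smult_left cinner_self e by simp
  have "z + v - cinner (z + v) e *s e = v - cinner v e *s e"
    unfolding ze by (simp add: z vec_eq_iff algebra_simps)
  then have n: "(norm (z + v))\<^sup>2 = (cmod (of_real (1 - d) + cinner v e))\<^sup>2 + (norm (v - cinner v e *s e))\<^sup>2"
    using norm2_projection[OF e, of "z + v"] unfolding ze by metis
  have "cmod (of_real (1 - d) + cinner v e) \<le> (1 - d) + d / 4"
    using norm_triangle_ineq[of "complex_of_real (1 - d)" "cinner v e"] v d
    by (simp only: norm_of_real abs_of_nonneg)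
  then have "(cmod (of_real (1 - d) + cinner v e))\<^sup>2 \<le> ((1 - d) + d / 4)\<^sup>2" by (rule power_mono) simp
  also have "\<dots> = 1 - 3 / 2 * d + 9 / 16 * (d * d)" by (simp add: power2_eq_square field_simps)
  also have "\<dots> \<le> 1 - 3 / 2 * d + 9 / 16 * d"
    using mult_left_le[of d d] d by linarith
  finally show "d / 2 \<le> 1 - (norm (z + v))\<^sup>2" using v d n by simp
  show "1 - (norm (z + v))\<^sup>2 \<le> 4 * d"
  proof (cases "4 * d \<ge> 1")
    case False
    have "(1 - d) - d / 4 \<le> cmod (of_real (1 - d) + cinner v e)"
      using norm_diff_ineq[of "complex_of_real (1 - d)" "cinner v e"] v d
      by (simp only: norm_of_real abs_of_nonneg)
    then have "((1 - d) - d / 4)\<^sup>2 \<le> (cmod (of_real (1 - d) + cinner v e))\<^sup>2"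
      using False by (intro power_mono) auto
    moreover have "((1 - d) - d / 4)\<^sup>2 = 1 - 5 / 2 * d + 25 / 16 * (d * d)" by (simp add: power2_eq_square field_simps)
    moreover have "0 \<le> d * d" by simp
    moreover have "0 \<le> (norm (v - cinner v e *s e))\<^sup>2" by simp
    ultimately show ?thesis using n d by linarith
  next
    case True
    have "0 \<le> (norm (z + v))\<^sup>2" by simp
    then show ?thesis using True by linarith
  qed
qed

lemma emeasure_koranyi_ge:
  fixes e :: "complex^'n::finite"
  assumes e: "norm e = 1" and d: "0 < d"
  shows "ennreal (1 / 16 * (1 / (4 * real CARD('n) ^ 2)) ^ (CARD('n) - 1) * d ^ (CARD('n) + 1)) \<le> emeasure lborel (koranyi e d)"
proof -
  define N where "N = real CARD('n)"
  have N: "N \<ge> 1" unfolding N_def by (simp add: Suc_le_eq)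
  fix k :: 'n
  obtain U where U: "orthogonal_transformation U" "\<And>x y. cinner (U x) (U y) = cinner x y"
    "U e = of_real (norm e) *s axis k 1"
    using unitary_to_axis by blast
  \<comment> \<open>Half-widths of a box inside the rotated region: real and imaginary part below
    \<open>d / 8\<close> give modulus below \<open>d / 4\<close>, and fewer than \<open>N\<close>
    tangential coordinates of squared modulus at most \<open>d / (8 N^2)\<close> add up to less than
    \<open>d / 4\<close>.\<close>
  define s where "s j = (if j = k then d / 8 else sqrt d / (4 * N))" for j
  define X :: "(complex^'n) set" where "X = {x. \<forall>j. \<bar>Re (x $ j)\<bar> < s j \<and> \<bar>Im (x $ j)\<bar> < s j}"
  have Xopen: "open X"
  proof -
    have "X = (\<Inter>j\<in>UNIV. {x. \<bar>Re (x $ j)\<bar> < s j \<and> \<bar>Im (x $ j)\<bar> < s j})" by (auto simp: X_def)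
    then show ?thesis
      by (simp only:) (intro open_INT ballI open_Collect_conj open_Collect_less continuous_intros finite)
  qed
  have s0: "0 \<le> s j" for j using d N by (simp add: s_def)
  have "X \<subseteq> {x. cmod (x $ k) < d / 4 \<and> (\<Sum>j\<in>UNIV - {k}. (cmod (x $ j))\<^sup>2) < d / 4}"
  proof safe
    fix x assume x: "x \<in> X"
    have "\<bar>Re (x $ k)\<bar> < d / 8" "\<bar>Im (x $ k)\<bar> < d / 8" using x by (auto simp: X_def s_def split: if_splits)
    then show "cmod (x $ k) < d / 4" using cmod_le[of "x $ k"] by linarith
    have "(cmod (x $ j))\<^sup>2 \<le> d / (8 * N\<^sup>2)" if "j \<noteq> k" for j
    proof -
      have "\<bar>Re (x $ j)\<bar> < s j" "\<bar>Im (x $ j)\<bar> < s j" using x unfolding X_def by blast+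
      then have "(Re (x $ j))\<^sup>2 \<le> (s j)\<^sup>2" "(Im (x $ j))\<^sup>2 \<le> (s j)\<^sup>2"
        by (metis abs_ge_zero less_imp_le power2_abs power_mono)+
      then have "(cmod (x $ j))\<^sup>2 \<le> 2 * (s j)\<^sup>2" by (simp add: cmod_power2)
      also have "\<dots> = d / (8 * N\<^sup>2)" using that d by (simp add: s_def power_divide power_mult_distrib)
      finally show ?thesis .
    qed
    then have "(\<Sum>j\<in>UNIV - {k}. (cmod (x $ j))\<^sup>2) \<le> (\<Sum>j\<in>UNIV - {k}. d / (8 * N\<^sup>2))" by (intro sum_mono) auto
    also have "\<dots> = real (card (UNIV - {k})) * (d / (8 * N\<^sup>2))" by simp
    also have "\<dots> \<le> N * (d / (8 * N\<^sup>2))"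
      using d N by (intro mult_right_mono) (auto simp: N_def intro!: card_mono)
    also have "\<dots> = d / (8 * N)" using N by (simp add: power2_eq_square)
    also have "\<dots> \<le> d / 8" using N d by (simp add: divide_le_eq)
    also have "\<dots> < d / 4" using d by simp
    finally show "(\<Sum>j\<in>UNIV - {k}. (cmod (x $ j))\<^sup>2) < d / 4" .
  qed
  moreover have "v \<in> koranyi e d" if "cmod (U v $ k) < d / 4" "(\<Sum>j\<in>UNIV - {k}. (cmod (U v $ j))\<^sup>2) < d / 4" for v
  proof -
    have 1: "cinner v e = U v $ k" using U(2)[of v e] U(3) e by (simp add: cinner_axis)
    have "norm (U v) = norm v" using U(1) by (simp add: orthogonal_transformation)
    then have "(norm (v - cinner v e *s e))\<^sup>2 = (\<Sum>j\<in>UNIV - {k}. (cmod (U v $ j))\<^sup>2)"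
      using norm2_projection[OF e, of v] norm2_vec_remove[of "U v" k] by (simp add: 1)
    then show ?thesis using that 1 by (simp add: koranyi_def)
  qed
  ultimately have sub: "U v \<in> X \<Longrightarrow> v \<in> koranyi e d" for v by blast
  have "emeasure lborel X = (\<integral>\<^sup>+x. indicator X x \<partial>lborel)" using Xopen by simp
  also have "\<dots> = (\<integral>\<^sup>+x. indicator X (U x) \<partial>lborel)"
    by (rule nn_integral_lborel_isometry[OF U(1), symmetric]) (use Xopen in simp)
  also have "\<dots> \<le> (\<integral>\<^sup>+x. indicator (koranyi e d) x \<partial>lborel)"
    by (rule nn_integral_mono) (use sub in \<open>auto simp: indicator_def\<close>)
  also have "\<dots> = emeasure lborel (koranyi e d)" by (simp add: open_koranyi)
  finally have "emeasure lborel X \<le> emeasure lborel (koranyi e d)" .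
  moreover have "emeasure lborel X = ennreal (\<Prod>j\<in>UNIV. 4 * s j * s j)"
    unfolding X_def by (rule emeasure_complex_box) (rule s0)+
  moreover have "(\<Prod>j\<in>UNIV. 4 * s j * s j) = 1 / 16 * (1 / (4 * N ^ 2)) ^ (CARD('n) - 1) * d ^ (CARD('n) + 1)"
  proof -
    have "(\<Prod>j\<in>UNIV. 4 * s j * s j) = (4 * s k * s k) * (\<Prod>j\<in>UNIV - {k}. 4 * s j * s j)"
      by (simp add: prod.remove[of UNIV k])
    also have "(\<Prod>j\<in>UNIV - {k}. 4 * s j * s j) = (\<Prod>j\<in>UNIV - {k}. 1 / (4 * N\<^sup>2) * d)"
      using d N by (intro prod.cong refl) (simp add: s_def power2_eq_square field_simps)
    also have "\<dots> = (1 / (4 * N\<^sup>2) * d) ^ (CARD('n) - 1)" by (simp add: card_Diff_singleton)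
    also have "(4 * s k * s k) * \<dots> = 1 / 16 * (1 / (4 * N ^ 2)) ^ (CARD('n) - 1) * (d ^ 2 * d ^ (CARD('n) - 1))"
      by (simp add: s_def power2_eq_square power_mult_distrib power_divide)
    also have "d ^ 2 * d ^ (CARD('n) - 1) = d ^ (CARD('n) + 1)"
      unfolding power_add[symmetric] by (rule arg_cong[where f = "power d"]) (simp add: Suc_le_eq)
    finally show ?thesis .
  qed
  ultimately show ?thesis by (simp add: N_def)
qed

text \<open>The integral is kept on the shell where \<open>1 - |x|^2\<close> is comparable to
  \<open>1 - |z|\<close>. For the Hardy space the thickness of the shell supplies a factor
  \<open>1 - |z|\<close>; for the Bergman space the weight is comparable to
  \<open>(1 - |z|) powr \<alpha>\<close> there.\<close>

lemma point_eval_shell: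
  "\<exists>c>0. \<forall>(h :: complex^'n::finite \<Rightarrow> complex) z. holo_ball h \<longrightarrow> z \<in> ball 0 1 \<longrightarrow>
     ennreal ((cmod (h z))\<^sup>2 * (c * (1 - norm z) ^ (CARD('n) + 1))) \<le>
     (\<integral>\<^sup>+x. (ennreal ((cmod (h x))\<^sup>2) * indicator (ball 0 1) x) *
        indicator {x. (1 - norm z) / 2 \<le> 1 - (norm x)\<^sup>2 \<and> 1 - (norm x)\<^sup>2 \<le> 4 * (1 - norm z)} x \<partial>lborel)"
proof -
  define c where "c = 1 / 16 * (1 / (4 * real CARD('n) ^ 2)) ^ (CARD('n) - 1)"
  have c: "c > 0" by (simp add: c_def)
  show ?thesis
  proof (intro exI[of _ c] conjI c allI impI)
    fix h :: "complex^'n \<Rightarrow> complex" and z :: "complex^'n"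
    assume h: "holo_ball h" and zb: "z \<in> ball 0 1"
    define d where "d = 1 - norm z"
    have d: "0 < d" "d \<le> 1" using zb by (auto simp: d_def)
    \<comment> \<open>At the centre any unit vector serves, since then
      \<open>1 - d = 0\<close>.\<close>
    define e where "e = (if z = 0 then axis undefined 1 else (1 / of_real (norm z)) *s z)"
    have e: "norm e = 1" by (simp add: e_def norm_smult norm_divide)
    have z: "z = of_real (1 - d) *s e" by (simp add: e_def d_def vector_smult_assoc)
    let ?S = "koranyi e d"
    define W where "W = {x :: complex^'n. d / 2 \<le> 1 - (norm x)\<^sup>2 \<and> 1 - (norm x)\<^sup>2 \<le> 4 * d}"
    define G where "G x = ennreal ((cmod (h x))\<^sup>2) * indicator (ball 0 1) x" for x
    have [measurable]: "W \<in> sets borel" unfolding W_def by measurable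
    have [measurable]: "?S \<in> sets borel" by (rule borel_open[OF open_koranyi])
    have [measurable]: "G \<in> borel_measurable borel" unfolding G_def by (rule borel_measurable_holo_ball[OF h])
    have shell: "z + v \<in> W" "z + v \<in> ball 0 1" if "v \<in> ?S" for v
    proof -
      show "z + v \<in> W" using koranyi_shell[OF e z d that] by (simp add: W_def)
      then have "(norm (z + v))\<^sup>2 < 1" using d by (simp add: W_def)
      then show "z + v \<in> ball 0 1" by (simp add: abs_square_less_1)
    qed
    have "ennreal ((cmod (h z))\<^sup>2 * (c * d ^ (CARD('n) + 1))) = ennreal ((cmod (h z))\<^sup>2) * ennreal (c * d ^ (CARD('n) + 1))"
      by (rule ennreal_mult) (use c d in auto)
    also have "\<dots> \<le> ennreal ((cmod (h z))\<^sup>2) * emeasure lborel ?S"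
      unfolding c_def by (rule mult_left_mono[OF emeasure_koranyi_ge[OF e d(1)]]) simp
    also have "\<dots> \<le> (\<integral>\<^sup>+v. ennreal ((cmod (h (z + v)))\<^sup>2) * indicator ?S v \<partial>lborel)"
      by (rule balanced_mean_le[OF h]) (use koranyi_balanced shell in auto)
    also have "\<dots> \<le> (\<integral>\<^sup>+v. G (z + v) * indicator W (z + v) \<partial>lborel)"
      by (rule nn_integral_mono) (use shell in \<open>auto simp: G_def indicator_def\<close>)
    also have "\<dots> = (\<integral>\<^sup>+x. G x * indicator W x \<partial>lborel)"
      by (rule nn_integral_lborel_shift) measurable
    finally show "ennreal ((cmod (h z))\<^sup>2 * (c * (1 - norm z) ^ (CARD('n) + 1))) \<le>
     (\<integral>\<^sup>+x. (ennreal ((cmod (h x))\<^sup>2) * indicator (ball 0 1) x) *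
        indicator {x. (1 - norm z) / 2 \<le> 1 - (norm x)\<^sup>2 \<and> 1 - (norm x)\<^sup>2 \<le> 4 * (1 - norm z)} x \<partial>lborel)"
      by (simp only: G_def W_def d_def)
  qed
qed

lemma emeasure_unit_ball:
  obtains V where "V > 0" "emeasure lborel (ball (0::'a::euclidean_space) 1) = ennreal V"
proof
  show "measure lborel (ball (0::'a) 1) > 0" by (simp add: content_ball_pos)
  show "emeasure lborel (ball (0::'a) 1) = ennreal (measure lborel (ball (0::'a) 1))"
    using emeasure_lborel_ball_finite[of "0::'a" 1] by (intro emeasure_eq_ennreal_measure) simp
qed

lemma ennreal_le_divideI:
  assumes "ennreal (a * b) \<le> ennreal k * Q" "0 \<le> a" "0 < b" "0 \<le> k"
  shows "ennreal a \<le> ennreal (k / b) * Q"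
proof -
  have "ennreal a = ennreal (1 / b * (a * b))" using assms by simp
  also have "\<dots> = ennreal (1 / b) * ennreal (a * b)" by (rule ennreal_mult) (use assms in auto)
  also have "\<dots> \<le> ennreal (1 / b) * (ennreal k * Q)" by (rule mult_left_mono[OF assms(1)]) simp
  also have "\<dots> = ennreal (1 / b * k) * Q"
    by (subst ennreal_mult) (use assms in \<open>auto simp: mult.assoc\<close>)
  finally show ?thesis by simp
qed

lemma ennreal_times_divide_cancel: "0 < V \<Longrightarrow> ennreal V * (X / ennreal V) = X"
  by (simp add: ennreal_times_divide mult.commute[of "ennreal V"] ennreal_mult_divide_eq)

text \<open>The volume factor \<open>d ^ (N + 1)\<close> loses one power of \<open>d\<close> to the
  radial thickness \<open>4 * d\<close> of the shell, leaving the exponent \<open>N\<close>.\<close>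

lemma hardy_point_eval:
  "\<exists>C\<ge>0. \<forall>(h :: complex^'n::finite \<Rightarrow> complex) z. holo_ball h \<longrightarrow> z \<in> ball 0 1 \<longrightarrow>
     ennreal ((cmod (h z))\<^sup>2 * (1 - norm z) powr real CARD('n)) \<le> ennreal C * hardy_norm2 h"
proof -
  obtain c where c: "c > 0" and pe: "\<And>(h :: complex^'n \<Rightarrow> complex) z. holo_ball h \<Longrightarrow> z \<in> ball 0 1 \<Longrightarrow>
     ennreal ((cmod (h z))\<^sup>2 * (c * (1 - norm z) ^ (CARD('n) + 1))) \<le>
     (\<integral>\<^sup>+x. (ennreal ((cmod (h x))\<^sup>2) * indicator (ball 0 1) x) *
        indicator {x. (1 - norm z) / 2 \<le> 1 - (norm x)\<^sup>2 \<and> 1 - (norm x)\<^sup>2 \<le> 4 * (1 - norm z)} x \<partial>lborel)"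
    using point_eval_shell[where 'n='n] by auto
  obtain V where V: "V > 0" "emeasure lborel (ball (0::complex^'n) 1) = ennreal V" by (rule emeasure_unit_ball)
  define P where "P = 2 * 2 ^ DIM(complex^'n) * (1::real)"
  have P: "P > 0" by (simp add: P_def)
  show ?thesis
  proof (intro exI[of _ "4 * P * V / c"] conjI allI impI)
    show "0 \<le> 4 * P * V / c" using P V c by simp
    fix h :: "complex^'n \<Rightarrow> complex" and z :: "complex^'n"
    assume h: "holo_ball h" and zb: "z \<in> ball 0 1"
    define d where "d = 1 - norm z"
    have d: "0 < d" "d \<le> 1" using zb by (auto simp: d_def)
    define W where "W = {x :: complex^'n. d / 2 \<le> 1 - (norm x)\<^sup>2 \<and> 1 - (norm x)\<^sup>2 \<le> 4 * d}"
    define G where "G x = ennreal ((cmod (h x))\<^sup>2) * indicator (ball 0 1) x" for x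
    have [measurable]: "W \<in> sets borel" unfolding W_def by measurable
    have [measurable]: "G \<in> borel_measurable borel" unfolding G_def by (rule borel_measurable_holo_ball[OF h])
    define Q where "Q = hardy_norm2 h"
    \<comment> \<open>Each sphere of radius \<open>t\<close> contributes at most the Hardy norm, and
      spheres with \<open>t < 1 - 4 * d\<close> miss the shell because
      \<open>t^2 \<le> t\<close>.\<close>
    have inner: "(\<integral>\<^sup>+x. (G (t *\<^sub>R (x /\<^sub>R norm x)) * indicator W (t *\<^sub>R (x /\<^sub>R norm x))) * indicator (ball 0 1) x \<partial>lborel)
        \<le> ennreal V * Q * indicator {1 - 4 * d..1} t" if t: "0 < t" "t < 1" for t :: real
    proof (cases "1 - 4 * d \<le> t")
      case True
      have "(\<integral>\<^sup>+x. (G (t *\<^sub>R (x /\<^sub>R norm x)) * indicator W (t *\<^sub>R (x /\<^sub>R norm x))) * indicator (ball 0 1) x \<partial>lborel)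
        \<le> (\<integral>\<^sup>+x. G (t *\<^sub>R (x /\<^sub>R norm x)) * indicator (ball 0 1) x \<partial>lborel)"
        by (rule nn_integral_mono) (auto simp: indicator_def)
      also have "\<dots> = ennreal V * (\<integral>\<^sup>+\<zeta>. G (t *\<^sub>R \<zeta>) \<partial>sigma_sphere)"
        using V by (subst nn_integral_sigma_sphere) (auto simp: ennreal_times_divide_cancel)
      also have "\<dots> \<le> ennreal V * (\<integral>\<^sup>+\<zeta>. ennreal ((cmod (h (t *\<^sub>R \<zeta>)))\<^sup>2) \<partial>sigma_sphere)"
        by (intro mult_left_mono nn_integral_mono) (auto simp: G_def indicator_def)
      also have "\<dots> \<le> ennreal V * Q"
        unfolding Q_def hardy_norm2_def by (intro mult_left_mono SUP_upper) (use t in auto)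
      finally show ?thesis using True t by simp
    next
      case False
      have "(\<integral>\<^sup>+x. (G (t *\<^sub>R (x /\<^sub>R norm x)) * indicator W (t *\<^sub>R (x /\<^sub>R norm x))) * indicator (ball 0 1) x \<partial>lborel)
        \<le> (\<integral>\<^sup>+x. 0 \<partial>(lborel :: (complex^'n) measure))"
      proof (rule nn_integral_mono_AE, rule AE_mp[OF AE_lborel_singleton[of 0]], rule AE_I2, rule impI)
        fix x :: "complex^'n" assume x: "x \<noteq> 0"
        have "norm (t *\<^sub>R (x /\<^sub>R norm x)) = t" using x t by (simp add: abs_mult)
        moreover have "t\<^sup>2 \<le> t" using t by (simp add: power2_eq_square mult_left_le)
        ultimately have "t *\<^sub>R (x /\<^sub>R norm x) \<notin> W" using False by (simp only: W_def mem_Collect_eq) linarith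
        then show "(G (t *\<^sub>R (x /\<^sub>R norm x)) * indicator W (t *\<^sub>R (x /\<^sub>R norm x))) * indicator (ball 0 1) x \<le> 0" by simp
      qed
      then show ?thesis by simp
    qed
    have "ennreal ((cmod (h z))\<^sup>2 * (c * d ^ (CARD('n) + 1))) \<le> (\<integral>\<^sup>+x. G x * indicator W x \<partial>lborel)"
      using pe[OF h zb] unfolding G_def W_def d_def .
    also have "\<dots> = (\<integral>\<^sup>+x. (G x * indicator W x) * indicator (ball 0 1) x \<partial>lborel)"
      by (rule nn_integral_cong) (auto simp: G_def indicator_def)
    also have "\<dots> \<le> ennreal P * (\<integral>\<^sup>+t. (\<integral>\<^sup>+x. (G (t *\<^sub>R (x /\<^sub>R norm x)) * indicator W (t *\<^sub>R (x /\<^sub>R norm x))) *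
        indicator (ball 0 1) x \<partial>lborel) * indicator {0<..<1} t \<partial>lborel)"
      unfolding P_def mult_1_right by (rule nn_integral_ball_le_polar) measurable
    also have "\<dots> \<le> ennreal P * (\<integral>\<^sup>+t. ennreal V * Q * indicator {1 - 4 * d..1} t \<partial>lborel)"
    proof (intro mult_left_mono nn_integral_mono)
      fix t :: real
      show "(\<integral>\<^sup>+x. (G (t *\<^sub>R (x /\<^sub>R norm x)) * indicator W (t *\<^sub>R (x /\<^sub>R norm x))) *
        indicator (ball 0 1) x \<partial>lborel) * indicator {0<..<1} t \<le> ennreal V * Q * indicator {1 - 4 * d..1} t"
        using inner[of t] by (cases "0 < t \<and> t < 1") auto
    qed simp
    also have "\<dots> = ennreal P * (ennreal V * Q * ennreal (4 * d))"
      using d by (simp add: nn_integral_cmult)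
    also have "\<dots> = ennreal (P * V * (4 * d)) * Q"
      using P V d by (simp add: ennreal_mult' ennreal_mult mult_ac)
    finally have "ennreal (((cmod (h z))\<^sup>2 * d ^ CARD('n)) * (c * d)) \<le> ennreal (P * V * (4 * d)) * Q"
      by (simp add: mult_ac)
    then have "ennreal ((cmod (h z))\<^sup>2 * d ^ CARD('n)) \<le> ennreal (P * V * (4 * d) / (c * d)) * Q"
      by (rule ennreal_le_divideI) (use d c P V in auto)
    moreover have "P * V * (4 * d) / (c * d) = 4 * P * V / c" using d by simp
    moreover have "d powr real CARD('n) = d ^ CARD('n)" using d by (simp add: powr_realpow)
    ultimately show "ennreal ((cmod (h z))\<^sup>2 * (1 - norm z) powr real CARD('n)) \<le> ennreal (4 * P * V / c) * hardy_norm2 h"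
      unfolding d_def[symmetric] Q_def by simp
  qed
qed

lemma bergman_const_pos: "\<alpha> > -1 \<Longrightarrow> bergman_const \<alpha> n > 0"
  unfolding bergman_const_def by (intro divide_pos_pos mult_pos_pos Gamma_real_pos) auto

text \<open>The ratio \<open>t / d\<close> lies between 1/2 and 4, and a power is monotone in one
  direction or the other according to the sign of \<alpha>; the minimum covers both.\<close>

lemma powr_ge_of_comparable:
  fixes d t \<alpha> :: real
  assumes "0 < d" "d / 2 \<le> t" "t \<le> 4 * d"
  shows "min ((1/2) powr \<alpha>) (4 powr \<alpha>) * d powr \<alpha> \<le> t powr \<alpha>"
proof (cases "\<alpha> \<ge> 0")
  case True
  have "min ((1/2) powr \<alpha>) (4 powr \<alpha>) * d powr \<alpha> \<le> (1/2) powr \<alpha> * d powr \<alpha>" by (intro mult_right_mono) auto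
  also have "\<dots> = (1/2 * d) powr \<alpha>" using assms by (subst powr_mult) auto
  also have "\<dots> \<le> t powr \<alpha>" using assms True by (intro powr_mono2) auto
  finally show ?thesis .
next
  case False
  have "min ((1/2) powr \<alpha>) (4 powr \<alpha>) * d powr \<alpha> \<le> 4 powr \<alpha> * d powr \<alpha>" by (intro mult_right_mono) auto
  also have "\<dots> = (4 * d) powr \<alpha>" using assms by (subst powr_mult) auto
  also have "\<dots> \<le> t powr \<alpha>" using assms False by (intro powr_mono2') auto
  finally show ?thesis .
qed

text \<open>On the shell the weight is at least a constant times \<open>d powr \<alpha>\<close>,
  which raises the volume exponent \<open>N + 1\<close> to \<open>N + 1 + \<alpha>\<close>.\<close>

lemma bergman_point_eval:
  assumes \<alpha>: "\<alpha> > -1"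
  shows "\<exists>C\<ge>0. \<forall>(h :: complex^'n::finite \<Rightarrow> complex) z. holo_ball h \<longrightarrow> z \<in> ball 0 1 \<longrightarrow>
     ennreal ((cmod (h z))\<^sup>2 * (1 - norm z) powr (real CARD('n) + 1 + \<alpha>)) \<le> ennreal C * bergman_norm2 \<alpha> h"
proof -
  obtain c where c: "c > 0" and pe: "\<And>(h :: complex^'n \<Rightarrow> complex) z. holo_ball h \<Longrightarrow> z \<in> ball 0 1 \<Longrightarrow>
     ennreal ((cmod (h z))\<^sup>2 * (c * (1 - norm z) ^ (CARD('n) + 1))) \<le>
     (\<integral>\<^sup>+x. (ennreal ((cmod (h x))\<^sup>2) * indicator (ball 0 1) x) *
        indicator {x. (1 - norm z) / 2 \<le> 1 - (norm x)\<^sup>2 \<and> 1 - (norm x)\<^sup>2 \<le> 4 * (1 - norm z)} x \<partial>lborel)"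
    using point_eval_shell[where 'n='n] by auto
  obtain V where V: "V > 0" "emeasure lborel (ball (0::complex^'n) 1) = ennreal V" by (rule emeasure_unit_ball)
  define b where "b = bergman_const \<alpha> CARD('n)"
  have b: "b > 0" unfolding b_def by (rule bergman_const_pos[OF \<alpha>])
  define a where "a = min ((1/2) powr \<alpha>) (4 powr \<alpha>)"
  have a: "a > 0" by (simp add: a_def)
  show ?thesis
  proof (intro exI[of _ "V / (b * a * c)"] conjI allI impI)
    show "0 \<le> V / (b * a * c)" using a b V c by simp
    fix h :: "complex^'n \<Rightarrow> complex" and z :: "complex^'n"
    assume h: "holo_ball h" and zb: "z \<in> ball 0 1"
    define d where "d = 1 - norm z"
    have d: "0 < d" "d \<le> 1" using zb by (auto simp: d_def)
    define W where "W = {x :: complex^'n. d / 2 \<le> 1 - (norm x)\<^sup>2 \<and> 1 - (norm x)\<^sup>2 \<le> 4 * d}"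
    define G where "G x = ennreal ((cmod (h x))\<^sup>2) * indicator (ball 0 1) x" for x
    have [measurable]: "W \<in> sets borel" unfolding W_def by measurable
    have [measurable]: "G \<in> borel_measurable borel" unfolding G_def by (rule borel_measurable_holo_ball[OF h])
    define Q where "Q = bergman_norm2 \<alpha> h"
    define R where "R x = G x * ennreal (b * (1 - (norm x)\<^sup>2) powr \<alpha>)" for x
    have [measurable]: "R \<in> borel_measurable borel" unfolding R_def by measurable
    have "(\<integral>\<^sup>+x. R x \<partial>lborel) = (\<integral>\<^sup>+x. R x * indicator (ball 0 1) x \<partial>lborel)"
      by (rule nn_integral_cong) (auto simp: R_def G_def indicator_def)
    also have "\<dots> = ennreal V * (\<integral>\<^sup>+x. R x \<partial>nu_ball)"
      unfolding nu_ball_def using V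
      by (subst nn_integral_uniform_measure) (auto simp: ennreal_times_divide_cancel)
    also have "\<dots> \<le> ennreal V * Q"
      unfolding Q_def bergman_norm2_def b_def[symmetric]
    proof (intro mult_left_mono nn_integral_mono)
      fix x :: "complex^'n"
      show "R x \<le> ennreal ((cmod (h x))\<^sup>2 * b * (1 - (norm x)\<^sup>2) powr \<alpha>)"
        using b by (auto simp: R_def G_def indicator_def ennreal_mult[symmetric] mult.assoc)
    qed simp
    finally have RQ: "(\<integral>\<^sup>+x. R x \<partial>lborel) \<le> ennreal V * Q" .
    have "ennreal ((cmod (h z))\<^sup>2 * (c * d ^ (CARD('n) + 1))) * ennreal (b * a * d powr \<alpha>)
      \<le> (\<integral>\<^sup>+x. G x * indicator W x \<partial>lborel) * ennreal (b * a * d powr \<alpha>)"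
      using pe[OF h zb] unfolding G_def W_def d_def by (rule mult_right_mono) simp
    also have "\<dots> = (\<integral>\<^sup>+x. G x * indicator W x * ennreal (b * a * d powr \<alpha>) \<partial>lborel)"
      by (rule nn_integral_multc[symmetric]) measurable
    also have "\<dots> \<le> (\<integral>\<^sup>+x. R x \<partial>lborel)"
    proof (rule nn_integral_mono)
      fix x :: "complex^'n"
      show "G x * indicator W x * ennreal (b * a * d powr \<alpha>) \<le> R x"
      proof (cases "x \<in> W")
        case True
        have "a * d powr \<alpha> \<le> (1 - (norm x)\<^sup>2) powr \<alpha>"
          unfolding a_def by (rule powr_ge_of_comparable) (use True d in \<open>auto simp: W_def\<close>)
        then have "b * a * d powr \<alpha> \<le> b * (1 - (norm x)\<^sup>2) powr \<alpha>" using b by (simp add: mult.assoc)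
        then show ?thesis using True by (simp add: R_def) (intro mult_left_mono ennreal_leI, auto)
      qed simp
    qed
    also note RQ
    finally have "ennreal ((cmod (h z))\<^sup>2 * (c * d ^ (CARD('n) + 1)) * (b * a * d powr \<alpha>)) \<le> ennreal V * Q"
      using a b c d by (subst ennreal_mult) auto
    moreover have "d ^ (CARD('n) + 1) * d powr \<alpha> = d powr (real CARD('n) + 1 + \<alpha>)"
      using d by (simp add: powr_add powr_realpow)
    moreover have "(cmod (h z))\<^sup>2 * (c * d ^ (CARD('n) + 1)) * (b * a * d powr \<alpha>) =
        (cmod (h z))\<^sup>2 * (d ^ (CARD('n) + 1) * d powr \<alpha>) * (b * a * c)" by (simp only: mult_ac)
    ultimately have "ennreal ((cmod (h z))\<^sup>2 * d powr (real CARD('n) + 1 + \<alpha>) * (b * a * c)) \<le> ennreal V * Q"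
      by (simp only:)
    then have "ennreal ((cmod (h z))\<^sup>2 * d powr (real CARD('n) + 1 + \<alpha>)) \<le> ennreal (V / (b * a * c)) * Q"
      by (rule ennreal_le_divideI) (use a b c V in auto)
    then show "ennreal ((cmod (h z))\<^sup>2 * (1 - norm z) powr (real CARD('n) + 1 + \<alpha>)) \<le> ennreal (V / (b * a * c)) * bergman_norm2 \<alpha> h"
      unfolding d_def Q_def .
  qed
qed

subsection \<open>Test functions\<close>

text \<open>Where \<open>F\<close> is of size \<open>2 ^ k * \<delta>\<close>, the integrand times
  the measure bound is \<open>(2 * a) ^ N / (2 ^ k * \<delta>) ^ q\<close>; these terms decay
  geometrically with ratio at most 1/2, whence the factor 2.\<close>

lemma nn_integral_inverse_power_dyadic:
  fixes F :: "'a \<Rightarrow> real"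
  assumes [measurable]: "F \<in> borel_measurable M" "B \<in> sets M"
    and F: "\<And>x. x \<in> B \<Longrightarrow> \<delta> \<le> F x" and \<delta>: "\<delta> > 0" and a: "a \<ge> 0" and p: "p = N + q" "q \<ge> 1"
    and tail: "\<And>u. \<delta> \<le> u \<Longrightarrow> emeasure M {x \<in> space M. x \<in> B \<and> F x \<le> u} \<le> ennreal ((a * u) ^ N)"
  shows "(\<integral>\<^sup>+x. ennreal (1 / F x ^ p) * indicator B x \<partial>M) \<le> ennreal (2 * (2 * a) ^ N / \<delta> ^ q)"
proof -
  \<comment> \<open>Full sublevel sets replace dyadic shells: \<open>tail\<close> applies to them
    directly, and the overcounting is harmless for an upper bound.\<close>
  define T where "T k = {x \<in> space M. x \<in> B \<and> F x \<le> 2 ^ Suc k * \<delta>}" for k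
  have [measurable]: "T k \<in> sets M" for k unfolding T_def by measurable
  have pt: "ennreal (1 / F x ^ p) * indicator B x \<le> (\<Sum>k. ennreal (1 / (2 ^ k * \<delta>) ^ p) * indicator (T k) x)"
    if x: "x \<in> space M" for x
  proof (cases "x \<in> B")
    case True
    obtain k0 where "F x / \<delta> < 2 ^ k0" using real_arch_pow[of 2 "F x / \<delta>"] by auto
    then have "F x < 2 ^ k0 * \<delta>" using \<delta> by (simp add: divide_less_eq)
    then have ex: "\<exists>k. F x < 2 ^ k * \<delta>" by blast
    define n where "n = (LEAST k. F x < 2 ^ k * \<delta>)"
    have n: "F x < 2 ^ n * \<delta>" unfolding n_def by (rule LeastI_ex[OF ex])
    have "n \<noteq> 0" using n F[OF True] by (metis less_le_not_le mult_1 power_0)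
    then obtain k where k: "n = Suc k" by (metis not0_implies_Suc)
    have "\<not> F x < 2 ^ k * \<delta>" using not_less_Least[of k "\<lambda>k. F x < 2 ^ k * \<delta>"] k unfolding n_def by auto
    then have kF: "2 ^ k * \<delta> \<le> F x" by simp
    have "1 / F x ^ p \<le> 1 / (2 ^ k * \<delta>) ^ p"
      using kF \<delta> by (intro divide_left_mono power_mono mult_pos_pos zero_less_power) (auto intro: less_le_trans[OF _ F[OF True]])
    moreover have "x \<in> T k" using x True n by (simp add: T_def k)
    ultimately have "ennreal (1 / F x ^ p) * indicator B x \<le> ennreal (1 / (2 ^ k * \<delta>) ^ p) * indicator (T k) x"
      using True by (simp add: ennreal_leI)
    also have "\<dots> \<le> (\<Sum>j. ennreal (1 / (2 ^ j * \<delta>) ^ p) * indicator (T j) x)"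
    proof -
      have "f k \<le> (\<Sum>j. f j)" for f :: "nat \<Rightarrow> ennreal" using sum_le_suminf[of f "{k}"] by simp
      then show ?thesis .
    qed
    finally show ?thesis .
  qed simp
  have term_le: "ennreal (1 / (2 ^ k * \<delta>) ^ p) * emeasure M (T k) \<le> ennreal ((2 * a) ^ N / \<delta> ^ q * (1/2) ^ k)" for k
  proof -
    have "emeasure M (T k) \<le> ennreal ((a * (2 ^ Suc k * \<delta>)) ^ N)"
      unfolding T_def by (rule tail) (use \<delta> mult_right_mono[of 1 "2 ^ Suc k" \<delta>] one_le_power[of "2::real" "Suc k"] in auto)
    then have "ennreal (1 / (2 ^ k * \<delta>) ^ p) * emeasure M (T k) \<le> ennreal (1 / (2 ^ k * \<delta>) ^ p) * ennreal ((a * (2 ^ Suc k * \<delta>)) ^ N)"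
      by (rule mult_left_mono) simp
    also have "\<dots> = ennreal (1 / (2 ^ k * \<delta>) ^ p * (a * (2 ^ Suc k * \<delta>)) ^ N)"
      by (rule ennreal_mult[symmetric]) (use \<delta> a in auto)
    also have "\<dots> \<le> ennreal ((2 * a) ^ N / \<delta> ^ q * (1/2) ^ k)"
    proof (rule ennreal_leI)
      define y where "y = 2 ^ k * \<delta>"
      have y: "y > 0" using \<delta> by (simp add: y_def)
      have "1 / y ^ p * (a * (2 ^ Suc k * \<delta>)) ^ N = 1 / y ^ p * ((2 * a) * y) ^ N" by (simp add: y_def mult_ac)
      also have "\<dots> = (2 * a) ^ N / y ^ q" using y by (simp add: p(1) power_add power_mult_distrib)
      also have "\<dots> = (2 * a) ^ N / \<delta> ^ q * (1 / 2 ^ q) ^ k"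
        by (simp add: y_def power_mult_distrib power_divide power_mult[symmetric] mult.commute)
      also have "\<dots> \<le> (2 * a) ^ N / \<delta> ^ q * (1/2) ^ k"
      proof (intro mult_left_mono power_mono)
        have "(2::real) ^ 1 \<le> 2 ^ q" by (rule power_increasing) (use p in auto)
        then show "1 / 2 ^ q \<le> (1/2 :: real)" by (simp add: field_simps)
      qed (use \<delta> a in auto)
      finally show "1 / (2 ^ k * \<delta>) ^ p * (a * (2 ^ Suc k * \<delta>)) ^ N \<le> (2 * a) ^ N / \<delta> ^ q * (1/2) ^ k" by (simp only: y_def)
    qed
    finally show ?thesis .
  qed
  have "(\<integral>\<^sup>+x. ennreal (1 / F x ^ p) * indicator B x \<partial>M) \<le> (\<integral>\<^sup>+x. (\<Sum>k. ennreal (1 / (2 ^ k * \<delta>) ^ p) * indicator (T k) x) \<partial>M)"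
    by (rule nn_integral_mono) (rule pt)
  also have "\<dots> = (\<Sum>k. ennreal (1 / (2 ^ k * \<delta>) ^ p) * emeasure M (T k))"
    by (subst nn_integral_suminf) (auto simp: nn_integral_cmult)
  also have "\<dots> \<le> (\<Sum>k. ennreal ((2 * a) ^ N / \<delta> ^ q * (1/2) ^ k))"
    by (intro suminf_le summableI term_le)
  also have "\<dots> = ennreal ((2 * a) ^ N / \<delta> ^ q * 2)"
  proof (rule suminf_ennreal_eq)
    show "(\<lambda>k. (2 * a) ^ N / \<delta> ^ q * (1/2) ^ k) sums ((2 * a) ^ N / \<delta> ^ q * 2)"
      by (rule sums_mult) (use geometric_sums[of "1/2::real"] in simp)
  qed (use \<delta> a in auto)
  finally show ?thesis by (simp add: mult.commute)
qed

lemma one_minus_cinner_ge: "norm z \<le> 1 \<Longrightarrow> 1 - norm w \<le> cmod (1 - cinner z w)"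
proof -
  assume "norm z \<le> 1"
  then have "cmod (cinner z w) \<le> norm w"
    using norm_cinner_le[of z w] by (smt (verit) mult_left_le_one_le norm_ge_zero)
  then show ?thesis using norm_triangle_ineq2[of 1 "cinner z w"] by simp
qed

text \<open>Only the direction of \<open>x\<close> is constrained, so the real part of coordinate
  \<open>k\<close> is merely bounded by 1. Multiplying the constraint by \<open>|x|\<close> controls
  its imaginary part and, via Pythagoras, the other coordinates. The product
  \<open>t j * t' j\<close> is \<open>2 * u\<close> for every \<open>j\<close>, so the box has
  volume \<open>(8 * u) ^ N\<close>.\<close>

lemma cone_subset_box:
  fixes x :: "complex^'n::finite"
  assumes s: "0 \<le> s" "s < 1" and u: "1 - s \<le> u" and x: "norm x < 1"
    and F: "cmod (1 - of_real s * (x /\<^sub>R norm x) $ k) \<le> u"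
    and t: "\<And>j. t j = (if j = k then 1 else sqrt (2 * u))" and t': "\<And>j. t' j = (if j = k then 2 * u else sqrt (2 * u))"
  shows "\<bar>Re (x $ j)\<bar> < t j \<and> \<bar>Im (x $ j)\<bar> < t' j"
proof -
  have u0: "u > 0" using s u by linarith
  have comp: "cmod (x $ i) \<le> norm x" for i by (rule Finite_Cartesian_Product.norm_nth_le)
  have rei: "\<bar>Re (x $ i)\<bar> \<le> cmod (x $ i)" "\<bar>Im (x $ i)\<bar> \<le> cmod (x $ i)" for i
    by (rule abs_Re_le_cmod, rule abs_Im_le_cmod)
  show ?thesis
  proof (cases "x = 0")
    case True
    then show ?thesis using u0 by (auto simp: t t')
  next
    case False
    then have n0: "norm x > 0" by simp
    have mul: "cmod (of_real (norm x) - of_real s * x $ k) \<le> u * norm x"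
    proof -
      have "of_real (norm x) - of_real s * x $ k = of_real (norm x) * (1 - of_real s * (x /\<^sub>R norm x) $ k)"
        using n0 by (simp add: scaleR_conv_of_real[where 'a=complex] field_simps)
      then show ?thesis using F n0 by (simp add: norm_mult mult.commute)
    qed
    show ?thesis
    proof (cases "j = k")
      case True
      have "s * \<bar>Im (x $ k)\<bar> \<le> u * norm x"
      proof -
        have "\<bar>Im (of_real (norm x) - of_real s * x $ k)\<bar> \<le> u * norm x" using mul abs_Im_le_cmod order_trans by blast
        then show ?thesis using s by (simp add: abs_mult)
      qed
      moreover have "u * norm x < u" using u0 x by simp
      ultimately have 1: "s * \<bar>Im (x $ k)\<bar> < u" by simp
      have "\<bar>Im (x $ k)\<bar> < 2 * u"
      proof (cases "s \<ge> 1/2")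
        case True
        have "1/2 * \<bar>Im (x $ k)\<bar> \<le> s * \<bar>Im (x $ k)\<bar>" using True by (intro mult_right_mono) auto
        then show ?thesis using 1 by linarith
      next
        \<comment> \<open>Here \<open>u > 1/2\<close>, so the claimed bound exceeds 1.\<close>
        case False
        then show ?thesis using u rei(2)[of k] comp[of k] x by linarith
      qed
      moreover have "\<bar>Re (x $ k)\<bar> < 1" using rei(1)[of k] comp[of k] x by linarith
      ultimately show ?thesis using True by (simp add: t t')
    next
      case jk: False
      have "(cmod (x $ j))\<^sup>2 < 2 * u"
      proof (cases "u \<le> 1")
        case True
        have "norm x - u * norm x \<le> s * cmod (x $ k)"
          using mul norm_triangle_ineq2[of "complex_of_real (norm x)" "of_real s * x $ k"] s by (simp add: norm_mult)
        also have "\<dots> \<le> cmod (x $ k)" using s by (simp add: mult_left_le_one_le)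
        finally have "((1 - u) * norm x)\<^sup>2 \<le> (cmod (x $ k))\<^sup>2"
          using True u0 by (intro power_mono) (auto simp: algebra_simps mult_left_le_one_le)
        then have 1: "(1 - 2 * u) * (norm x)\<^sup>2 \<le> (cmod (x $ k))\<^sup>2"
          using zero_le_power2[of "u * norm x"] by (simp add: power2_eq_square algebra_simps)
        have "(cmod (x $ j))\<^sup>2 \<le> (\<Sum>i\<in>UNIV - {k}. (cmod (x $ i))\<^sup>2)"
          using jk by (intro member_le_sum) auto
        also have "\<dots> = (norm x)\<^sup>2 - (cmod (x $ k))\<^sup>2" by (simp add: norm2_vec_remove[of x k])
        also have "\<dots> \<le> 2 * u * (norm x)\<^sup>2" using 1 by (simp add: algebra_simps)
        also have "\<dots> < 2 * u * 1" using u0 x by (intro mult_strict_left_mono) (auto simp: power_less_one_iff abs_square_less_1)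
        finally show ?thesis by simp
      next
        case False
        have "(cmod (x $ j))\<^sup>2 < 1" using comp[of j] x by (simp add: abs_square_less_1)
        then show ?thesis using False by simp
      qed
      then have "cmod (x $ j) < sqrt (2 * u)" by (rule real_less_rsqrt)
      then show ?thesis using jk rei[of j] by (simp add: t t')
    qed
  qed
qed

text \<open>A Forelli-Rudin estimate, written as an integral over the ball of a function of
  direction. It is the dyadic lemma with \<delta> equal to \<open>1 - |w|\<close> and
  \<open>a = 8\<close>, after rotating \<open>w\<close> to a coordinate axis.\<close>

lemma sphere_kernel_bound:
  fixes w :: "complex^'n::finite"
  assumes w: "norm w < 1" and q: "q \<ge> 1"
  shows "(\<integral>\<^sup>+x. ennreal (1 / cmod (1 - cinner (x /\<^sub>R norm x) w) ^ (CARD('n) + q)) * indicator (ball 0 1) x \<partial>lborel)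
    \<le> ennreal (2 * 16 ^ CARD('n) / (1 - norm w) ^ q)"
proof -
  fix k :: 'n
  obtain U where U: "orthogonal_transformation U" "\<And>x y. cinner (U x) (U y) = cinner x y"
    "U w = of_real (norm w) *s axis k 1"
    using unitary_to_axis by blast
  have nU: "norm (U x) = norm x" for x using U(1) by (simp add: orthogonal_transformation)
  define s where "s = norm w"
  have s: "0 \<le> s" "s < 1" using w by (auto simp: s_def)
  define F where "F x = cmod (1 - of_real s * (x /\<^sub>R norm x) $ k)" for x :: "complex^'n"
  have Fc: "F x = cmod (1 - cinner (x /\<^sub>R norm x) (of_real s *s axis k 1))" for x
    by (simp add: F_def cinner_smult_right cinner_axis)
  have FU: "cmod (1 - cinner (x /\<^sub>R norm x) w) = F (U x)" for x
    using U(2)[of "x /\<^sub>R norm x" w] U(3) orthogonal_transformation_scaleR[OF U(1)] unfolding Fc by (simp add: nU s_def)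
  have [measurable]: "(\<lambda>x. cinner x (of_real s *s axis k 1 :: complex^'n)) \<in> borel_measurable borel"
    by (intro borel_measurable_continuous_onI continuous_intros)
  have [measurable]: "F \<in> borel_measurable borel" unfolding Fc by measurable
  have [measurable]: "ball (0::complex^'n) 1 \<in> sets borel" by simp
  have "(\<integral>\<^sup>+x. ennreal (1 / cmod (1 - cinner (x /\<^sub>R norm x) w) ^ (CARD('n) + q)) * indicator (ball 0 1) x \<partial>lborel)
    = (\<integral>\<^sup>+x. ennreal (1 / F (U x) ^ (CARD('n) + q)) * indicator (ball 0 1) (U x) \<partial>lborel)"
    by (rule nn_integral_cong) (simp only: FU, simp add: nU indicator_def)
  also have "\<dots> = (\<integral>\<^sup>+x. ennreal (1 / F x ^ (CARD('n) + q)) * indicator (ball 0 1) x \<partial>lborel)"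
    by (rule nn_integral_lborel_isometry[OF U(1)]) measurable
  also have "\<dots> \<le> ennreal (2 * (2 * 8) ^ CARD('n) / (1 - s) ^ q)"
  proof (rule nn_integral_inverse_power_dyadic)
    fix x :: "complex^'n"
    have "norm (x /\<^sub>R norm x) \<le> 1" by (cases "x = 0") auto
    from one_minus_cinner_ge[OF this, of "of_real s *s axis k 1"]
    show "1 - s \<le> F x" using s unfolding Fc by (simp add: norm_smult)
  next
    fix u assume u: "1 - s \<le> u"
    have u0: "u > 0" using s u by linarith
    define t where "t j = (if j = k then 1 else sqrt (2 * u))" for j
    define t' where "t' j = (if j = k then 2 * u else sqrt (2 * u))" for j
    let ?X = "{x :: complex^'n. \<forall>j. \<bar>Re (x $ j)\<bar> < t j \<and> \<bar>Im (x $ j)\<bar> < t' j}"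
    have "open ?X"
    proof -
      have "?X = (\<Inter>j\<in>UNIV. {x. \<bar>Re (x $ j)\<bar> < t j \<and> \<bar>Im (x $ j)\<bar> < t' j})" by auto
      then show ?thesis
        by (simp only:) (intro open_INT ballI open_Collect_conj open_Collect_less continuous_intros finite)
    qed
    then have "emeasure lborel {x \<in> space lborel. x \<in> ball 0 1 \<and> F x \<le> u} \<le> emeasure lborel ?X"
      using cone_subset_box[OF s u _ _ t_def t'_def] by (intro emeasure_mono) (auto simp: F_def)
    also have "\<dots> = ennreal (\<Prod>j\<in>UNIV. 4 * t j * t' j)"
      by (rule emeasure_complex_box) (use u0 in \<open>auto simp: t_def t'_def\<close>)
    also have "(\<Prod>j\<in>UNIV. 4 * t j * t' j) = (\<Prod>j\<in>(UNIV :: 'n set). 8 * u)"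
      using u0 by (intro prod.cong refl) (simp add: t_def t'_def)
    finally show "emeasure lborel {x \<in> space lborel. x \<in> ball 0 1 \<and> F x \<le> u} \<le> ennreal ((8 * u) ^ CARD('n))" by simp
  qed (use s q in auto)
  finally show ?thesis by (simp add: s_def)
qed

text \<open>The reproducing kernels are powers \<open>(1 - \<langle>z, w\<rangle>)\<^sup>-\<^sup>g\<close>; an integer exponent \<open>m > g/2\<close> serves as well
  and avoids complex powers with real exponent.\<close>

definition kernel_test :: "nat \<Rightarrow> real \<Rightarrow> complex^'n::finite \<Rightarrow> complex^'n \<Rightarrow> complex" where
  "kernel_test m g w z = of_real ((1 - (norm w)\<^sup>2) powr (real m - g / 2)) / (1 - cinner z w) ^ m"

lemma one_minus_cinner_nonzero: "norm z < 1 \<Longrightarrow> norm w < 1 \<Longrightarrow> 1 - cinner z w \<noteq> 0"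
  using one_minus_cinner_ge[of z w] by auto

lemma holo_ball_kernel_test:
  fixes w :: "complex^'n::finite"
  assumes "norm w < 1"
  shows "holo_ball (kernel_test m g w)"
  unfolding holo_ball_def
proof
  fix z :: "complex^'n" assume "z \<in> ball 0 1"
  then have nz: "1 - cinner z w \<noteq> 0" using one_minus_cinner_nonzero[of z w] assms by simp
  define c where "c = complex_of_real ((1 - (norm w)\<^sup>2) powr (real m - g / 2))"
  have "(\<lambda>u. c / u ^ m) field_differentiable (at (1 - cinner z w))"
    using nz by (intro derivative_intros) auto
  then obtain D where D: "((\<lambda>u. c / u ^ m) has_field_derivative D) (at (1 - cinner z w))"
    unfolding field_differentiable_def by blast
  have "((\<lambda>z. 1 - cinner z w) has_derivative (\<lambda>h. 0 - cinner h w)) (at z)"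
    by (intro has_derivative_diff has_derivative_const bounded_linear_imp_has_derivative
        bounded_bilinear.bounded_linear_left[OF bounded_bilinear_cinner])
  from has_derivative_compose[OF this D[unfolded has_field_derivative_def]]
  have "(kernel_test m g w has_derivative (\<lambda>h. D * (0 - cinner h w))) (at z)"
    by (simp add: kernel_test_def[abs_def] c_def)
  then show "\<exists>L. (kernel_test m g w has_derivative L) (at z) \<and> (\<forall>c v. L (c *s v) = c * L v)"
    by (intro exI[of _ "\<lambda>h. D * (0 - cinner h w)"]) (simp add: cinner_smult_left)
qed

lemma cmod_kernel_test:
  "(cmod (kernel_test m g w z))\<^sup>2 = (1 - (norm w)\<^sup>2) powr (2 * real m - g) * (1 / cmod (1 - cinner z w) ^ (2 * m))"
proof -
  have "((1 - (norm w)\<^sup>2) powr (real m - g / 2))\<^sup>2 = (1 - (norm w)\<^sup>2) powr (2 * real m - g)"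
    unfolding power2_eq_square powr_add[symmetric] by (rule arg_cong[where f = "(powr) _"]) simp
  then show ?thesis
    by (simp add: kernel_test_def norm_divide norm_power power_divide power_mult[symmetric] mult.commute)
qed

lemma cinner_measurable: "(\<lambda>x. cinner x (w :: complex^'n::finite)) \<in> borel_measurable borel"
  by (intro borel_measurable_continuous_onI continuous_intros)

lemma one_minus_norm2_le:
  assumes "norm w < 1" shows "1 - (norm w)\<^sup>2 \<le> 2 * (1 - norm w)" "0 < 1 - (norm w)\<^sup>2"
proof -
  have e: "1 - (norm w)\<^sup>2 = (1 + norm w) * (1 - norm w)" by (simp add: power2_eq_square algebra_simps)
  show "1 - (norm w)\<^sup>2 \<le> 2 * (1 - norm w)" unfolding e using assms by (intro mult_right_mono) auto
  show "0 < 1 - (norm w)\<^sup>2" unfolding e using assms by (intro mult_pos_pos) (auto intro: add_pos_nonneg)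
qed

text \<open>The dilation by \<open>r\<close> is moved from \<zeta> to \<open>w\<close>. The kernel
  bound \<open>(1 - r |w|) ^ (- q)\<close> is then compensated by the normalising factor
  \<open>(1 - |w|^2) ^ q\<close>, uniformly in \<open>r\<close>.\<close>

lemma hardy_kernel_test_bound:
  assumes m: "2 * m = CARD('n) + q" "q \<ge> 1"
  shows "\<exists>M. \<forall>w :: complex^'n::finite. norm w < 1 \<longrightarrow> hardy_norm2 (kernel_test m (real CARD('n)) w) \<le> ennreal M"
proof -
  obtain V where V: "V > 0" "emeasure lborel (ball (0::complex^'n) 1) = ennreal V" by (rule emeasure_unit_ball)
  show ?thesis
  proof (intro exI[of _ "2 ^ q * (2 * 16 ^ CARD('n)) / V"] allI impI)
    fix w :: "complex^'n" assume w: "norm w < 1"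
    define c where "c = (1 - (norm w)\<^sup>2) ^ q"
    have c0: "0 \<le> c" using one_minus_norm2_le(2)[OF w] by (simp add: c_def)
    have cp: "(1 - (norm w)\<^sup>2) powr (2 * real m - real CARD('n)) = c"
    proof -
      have "2 * real m - real CARD('n) = real q" using arg_cong[OF m(1), of real] by simp
      then show ?thesis using one_minus_norm2_le(2)[OF w] by (simp add: c_def powr_realpow)
    qed
    note [measurable] = cinner_measurable
    have [measurable]: "ball (0::complex^'n) 1 \<in> sets borel" by simp
    have "(\<integral>\<^sup>+\<zeta>. ennreal ((cmod (kernel_test m (real CARD('n)) w (r *\<^sub>R \<zeta>)))\<^sup>2) \<partial>sigma_sphere) \<le> ennreal (2 ^ q * (2 * 16 ^ CARD('n)) / V)"
      if r: "0 < r" "r < 1" for r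
    proof -
      have rw: "norm (r *\<^sub>R w) < 1" using w r mult_left_le_one_le[of "norm w" r] by simp
      have cr: "c / (1 - norm (r *\<^sub>R w)) ^ q \<le> 2 ^ q"
      proof -
        have "norm (r *\<^sub>R w) \<le> norm w" using r by (simp add: mult_left_le_one_le)
        then have "1 - (norm w)\<^sup>2 \<le> 2 * (1 - norm (r *\<^sub>R w))"
          by (intro order_trans[OF one_minus_norm2_le(1)[OF w]] mult_left_mono diff_left_mono) simp_all
        then have "c \<le> (2 * (1 - norm (r *\<^sub>R w))) ^ q"
          unfolding c_def by (rule power_mono) (use one_minus_norm2_le(2)[OF w] in simp)
        then have "c \<le> 2 ^ q * (1 - norm (r *\<^sub>R w)) ^ q" unfolding power_mult_distrib .
        then show ?thesis using rw by (metis diff_gt_0_iff_gt pos_divide_le_eq zero_less_power)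
      qed
      have "(\<integral>\<^sup>+\<zeta>. ennreal ((cmod (kernel_test m (real CARD('n)) w (r *\<^sub>R \<zeta>)))\<^sup>2) \<partial>sigma_sphere)
        = (\<integral>\<^sup>+\<zeta>. ennreal c * ennreal (1 / cmod (1 - cinner \<zeta> (r *\<^sub>R w)) ^ (CARD('n) + q)) \<partial>sigma_sphere)"
        unfolding cmod_kernel_test cp m(1)
        by (intro nn_integral_cong) (simp add: ennreal_mult[OF c0, symmetric] cinner_scaleR_left cinner_scaleR_right)
      also have "\<dots> = (\<integral>\<^sup>+x. ennreal c * ennreal (1 / cmod (1 - cinner (x /\<^sub>R norm x) (r *\<^sub>R w)) ^ (CARD('n) + q)) *
           indicator (ball 0 1) x \<partial>lborel) / ennreal V"
        by (subst nn_integral_sigma_sphere) (simp_all add: V)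
      also have "\<dots> = ennreal c * (\<integral>\<^sup>+x. ennreal (1 / cmod (1 - cinner (x /\<^sub>R norm x) (r *\<^sub>R w)) ^ (CARD('n) + q)) *
           indicator (ball 0 1) x \<partial>lborel) / ennreal V"
        unfolding mult.assoc by (subst nn_integral_cmult) auto
      also have "\<dots> \<le> ennreal c * ennreal (2 * 16 ^ CARD('n) / (1 - norm (r *\<^sub>R w)) ^ q) / ennreal V"
        by (intro divide_right_mono_ennreal mult_left_mono sphere_kernel_bound rw m(2)) simp
      also have "\<dots> = ennreal (c * (2 * 16 ^ CARD('n) / (1 - norm (r *\<^sub>R w)) ^ q) / V)"
        using c0 rw V by (simp add: ennreal_mult[symmetric] divide_ennreal)
      also have "\<dots> = ennreal (c / (1 - norm (r *\<^sub>R w)) ^ q * (2 * 16 ^ CARD('n)) / V)" by (simp add: mult_ac)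
      also have "\<dots> \<le> ennreal (2 ^ q * (2 * 16 ^ CARD('n)) / V)"
        using V(1) by (intro ennreal_leI divide_right_mono mult_right_mono cr) auto
      finally show ?thesis .
    qed
    then show "hardy_norm2 (kernel_test m (real CARD('n)) w) \<le> ennreal (2 ^ q * (2 * 16 ^ CARD('n)) / V)"
      unfolding hardy_norm2_def by (intro SUP_least) auto
  qed
qed

text \<open>The integral is split at \<open>t = s\<close>, with \<open>1 - t * s\<close> replaced by
  \<open>1 - t\<close> below and by \<open>1 - s\<close> above. The hypothesis
  \<open>\<alpha> > -1\<close> gives integrability at 1, and \<open>q > \<alpha> + 1\<close> makes
  the lower part grow like the stated power.\<close>

lemma radial_integral_bound:
  fixes \<alpha> s :: real
  assumes \<alpha>: "\<alpha> > -1" "real q > \<alpha> + 1" and s: "0 \<le> s" "s < 1"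
  shows "(\<integral>\<^sup>+t. ennreal ((1 - t) powr \<alpha> / (1 - t * s) ^ q) * indicator {0<..<1} t \<partial>lborel)
    \<le> ennreal ((1 / (\<alpha> + 1) + 1 / (real q - \<alpha> - 1)) * (1 - s) powr (\<alpha> + 1 - real q))"
proof -
  have sq: "(1 - s) powr (- real q) * (1 - s) powr (\<alpha> + 1) = (1 - s) powr (\<alpha> + 1 - real q)"
    using s by (simp add: powr_add[symmetric])
  have I1: "(\<integral>\<^sup>+t. ennreal ((1 - t) powr (\<alpha> - real q)) * indicator {0..s} t \<partial>lborel) \<le> ennreal (1 / (real q - \<alpha> - 1) * (1 - s) powr (\<alpha> + 1 - real q))"
  proof -
    let ?F = "\<lambda>t. (1 - t) powr (\<alpha> + 1 - real q) / (real q - \<alpha> - 1)"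
    have "(\<integral>\<^sup>+t. ennreal ((1 - t) powr (\<alpha> - real q)) * indicator {0..s} t \<partial>lborel) = ennreal (?F s - ?F 0)"
    proof (rule nn_integral_FTC_Icc)
      fix t assume "t \<in> {0..s}"
      then have t: "0 \<le> t" "t \<le> s" by auto
      have d: "((\<lambda>t. 1 - t) has_real_derivative - 1) (at t)" by (auto intro!: derivative_eq_intros)
      have "(?F has_real_derivative (\<alpha> + 1 - real q) * (1 - t) powr (\<alpha> + 1 - real q - 1) * (- 1) / (real q - \<alpha> - 1)) (at t)"
        using DERIV_cdivide[OF DERIV_fun_powr[OF d, of "\<alpha> + 1 - real q"], of "real q - \<alpha> - 1"] t s by simp
      moreover have "(\<alpha> + 1 - real q) * (1 - t) powr (\<alpha> + 1 - real q - 1) * (- 1) / (real q - \<alpha> - 1) = (1 - t) powr (\<alpha> - real q)"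
      proof -
        have "\<alpha> + 1 - real q - 1 = \<alpha> - real q" by simp
        then show ?thesis using \<alpha> by (simp add: field_simps)
      qed
      ultimately show "(?F has_real_derivative (1 - t) powr (\<alpha> - real q)) (at t)" by simp
    qed (use s in auto)
    also have "\<dots> \<le> ennreal (1 / (real q - \<alpha> - 1) * (1 - s) powr (\<alpha> + 1 - real q))"
      using \<alpha> by (intro ennreal_leI) simp
    finally show ?thesis .
  qed
  have I2: "(\<integral>\<^sup>+t. ennreal ((1 - t) powr \<alpha>) * indicator {s..1} t \<partial>lborel) = ennreal ((1 - s) powr (\<alpha> + 1) / (\<alpha> + 1))"
  proof -
    have "(\<integral>\<^sup>+t. ennreal ((1 - t) powr \<alpha>) * indicator {s..1} t \<partial>lborel)
      = ennreal \<bar>-1\<bar> * (\<integral>\<^sup>+u. ennreal ((1 - (1 + (-1) * u)) powr \<alpha>) * indicator {s..1} (1 + (-1) * u) \<partial>lborel)"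
      by (rule nn_integral_real_affine) auto
    also have "\<dots> = (\<integral>\<^sup>+u. ennreal (u powr \<alpha>) * indicator {0..1 - s} u \<partial>lborel)"
      by (auto intro!: nn_integral_cong simp: indicator_def)
    also have "\<dots> = ennreal ((1 - s) powr (\<alpha> + 1) / (\<alpha> + 1))"
      by (rule nn_integral_has_integral_lebesgue') (use has_integral_powr_from_0[OF \<alpha>(1), of "1 - s"] s in auto)
    finally show ?thesis .
  qed
  have "(\<integral>\<^sup>+t. ennreal ((1 - t) powr \<alpha> / (1 - t * s) ^ q) * indicator {0<..<1} t \<partial>lborel)
    \<le> (\<integral>\<^sup>+t. ennreal ((1 - t) powr (\<alpha> - real q)) * indicator {0..s} t +
        ennreal ((1 - s) powr (- real q)) * (ennreal ((1 - t) powr \<alpha>) * indicator {s..1} t) \<partial>lborel)"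
  proof (rule nn_integral_mono)
    fix t :: real
    show "ennreal ((1 - t) powr \<alpha> / (1 - t * s) ^ q) * indicator {0<..<1} t
      \<le> ennreal ((1 - t) powr (\<alpha> - real q)) * indicator {0..s} t +
        ennreal ((1 - s) powr (- real q)) * (ennreal ((1 - t) powr \<alpha>) * indicator {s..1} t)"
    proof (cases "0 < t \<and> t < 1")
      case True
      then have t: "0 < t" "t < 1" by auto
      show ?thesis
      proof (cases "t \<le> s")
        case True
        have "1 - t \<le> 1 - t * s" using t s by (simp add: mult_left_le)
        then have "(1 - t) powr \<alpha> / (1 - t * s) ^ q \<le> (1 - t) powr \<alpha> / (1 - t) ^ q"
          using t less_le_trans[of 0 "1 - t" "1 - t * s"]
          by (intro divide_left_mono power_mono mult_pos_pos zero_less_power) auto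
        also have "\<dots> = (1 - t) powr (\<alpha> - real q)" using t by (simp add: powr_diff powr_realpow)
        finally show ?thesis using True t by (intro order_trans[OF _ add_increasing2]) (auto intro: ennreal_leI)
      next
        case False
        have "1 - s \<le> 1 - t * s" using t s by (simp add: mult_left_le_one_le)
        then have "(1 - t) powr \<alpha> / (1 - t * s) ^ q \<le> (1 - t) powr \<alpha> / (1 - s) ^ q"
          using s less_le_trans[of 0 "1 - s" "1 - t * s"]
          by (intro divide_left_mono power_mono mult_pos_pos zero_less_power) auto
        also have "\<dots> = (1 - s) powr (- real q) * (1 - t) powr \<alpha>" using s by (simp add: powr_minus powr_realpow divide_inverse)
        finally show ?thesis using False t by (auto simp: ennreal_mult[symmetric] intro: ennreal_leI)
      qed
    qed auto
  qed
  also have "\<dots> = (\<integral>\<^sup>+t. ennreal ((1 - t) powr (\<alpha> - real q)) * indicator {0..s} t \<partial>lborel) +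
      ennreal ((1 - s) powr (- real q)) * (\<integral>\<^sup>+t. ennreal ((1 - t) powr \<alpha>) * indicator {s..1} t \<partial>lborel)"
    by (subst nn_integral_add) (auto simp: nn_integral_cmult)
  also have "\<dots> \<le> ennreal (1 / (real q - \<alpha> - 1) * (1 - s) powr (\<alpha> + 1 - real q)) +
      ennreal ((1 - s) powr (- real q)) * ennreal ((1 - s) powr (\<alpha> + 1) / (\<alpha> + 1))"
    unfolding I2 by (intro add_mono I1 order_refl)
  also have "\<dots> = ennreal ((1 / (\<alpha> + 1) + 1 / (real q - \<alpha> - 1)) * (1 - s) powr (\<alpha> + 1 - real q))"
  proof -
    have "(1 - s) powr (- real q) * ((1 - s) powr (\<alpha> + 1) / (\<alpha> + 1)) = 1 / (\<alpha> + 1) * (1 - s) powr (\<alpha> + 1 - real q)"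
      unfolding sq[symmetric] by simp
    then have "ennreal ((1 - s) powr (- real q)) * ennreal ((1 - s) powr (\<alpha> + 1) / (\<alpha> + 1)) =
        ennreal (1 / (\<alpha> + 1) * (1 - s) powr (\<alpha> + 1 - real q))"
      using \<alpha> by (subst ennreal_mult[symmetric]) auto
    then show ?thesis using \<alpha> unfolding distrib_right by (subst ennreal_plus) (auto simp: add.commute)
  qed
  finally show ?thesis .
qed

lemma one_minus_square_powr_le:
  fixes t \<alpha> :: real
  assumes "0 \<le> t" "t < 1"
  shows "(1 - t\<^sup>2) powr \<alpha> \<le> max 1 (2 powr \<alpha>) * (1 - t) powr \<alpha>"
proof -
  have "1 - t\<^sup>2 = (1 + t) * (1 - t)" by (simp add: power2_eq_square algebra_simps)
  then have "(1 - t\<^sup>2) powr \<alpha> = (1 + t) powr \<alpha> * (1 - t) powr \<alpha>" using assms by (simp add: powr_mult)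
  moreover have "(1 + t) powr \<alpha> \<le> max 1 (2 powr \<alpha>)"
  proof (cases "\<alpha> \<ge> 0")
    case True
    then have "(1 + t) powr \<alpha> \<le> 2 powr \<alpha>" using assms by (intro powr_mono2) auto
    then show ?thesis by simp
  next
    case False
    then have "(1 + t) powr \<alpha> \<le> 1 powr \<alpha>" using assms by (intro powr_mono2') auto
    then show ?thesis by simp
  qed
  ultimately show ?thesis by (simp add: mult_right_mono)
qed

text \<open>On the sphere of radius \<open>t\<close> the Hardy-type estimate is used at the point
  \<open>t w\<close>; the radial integral then costs
  \<open>(1 - |w|) powr (\<alpha> + 1 - q)\<close>, the inverse order of the normalising
  factor.\<close>

lemma bergman_kernel_test_bound:
  assumes \<alpha>: "\<alpha> > -1" and m: "2 * m = CARD('n) + q" "real q > \<alpha> + 1"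
  shows "\<exists>M. \<forall>w :: complex^'n::finite. norm w < 1 \<longrightarrow>
    bergman_norm2 \<alpha> (kernel_test m (real CARD('n) + 1 + \<alpha>) w) \<le> ennreal M"
proof -
  obtain V where V: "V > 0" "emeasure lborel (ball (0::complex^'n) 1) = ennreal V" by (rule emeasure_unit_ball)
  define b where "b = bergman_const \<alpha> CARD('n)"
  have b: "b > 0" unfolding b_def by (rule bergman_const_pos[OF \<alpha>])
  have q1: "q \<ge> 1" using m(2) \<alpha> by (cases q) auto
  define P where "P = 2 * 2 ^ DIM(complex^'n) * (1::real)"
  have P: "P > 0" by (simp add: P_def)
  define a where "a = max 1 (2 powr \<alpha>)"
  have a: "a > 0" by (simp add: a_def)
  define K where "K = 1 / (\<alpha> + 1) + 1 / (real q - \<alpha> - 1)"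
  have "1 / (\<alpha> + 1) > 0" "1 / (real q - \<alpha> - 1) > 0" using \<alpha> m(2) by auto
  then have K: "K > 0" unfolding K_def by (rule add_pos_pos)
  define Y where "Y = b * a * (2 * 16 ^ CARD('n))"
  have Y: "Y > 0" using a b by (simp add: Y_def)
  show ?thesis
  proof (intro exI[of _ "P * (Y * K) * 2 powr (real q - \<alpha> - 1) / V"] allI impI)
    fix w :: "complex^'n" assume w: "norm w < 1"
    define s where "s = norm w"
    have s: "0 \<le> s" "s < 1" using w by (auto simp: s_def)
    define L where "L = (1 - s\<^sup>2) powr (real q - \<alpha> - 1)"
    have L0: "L \<ge> 0" by (simp add: L_def)
    have Lp: "(1 - (norm w)\<^sup>2) powr (2 * real m - (real CARD('n) + 1 + \<alpha>)) = L"
    proof -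
      have "2 * real m - (real CARD('n) + 1 + \<alpha>) = real q - \<alpha> - 1" using arg_cong[OF m(1), of real] by simp
      then show ?thesis unfolding L_def s_def by (simp only:)
    qed
    have Ls: "L * (1 - s) powr (\<alpha> + 1 - real q) \<le> 2 powr (real q - \<alpha> - 1)"
    proof -
      have "L \<le> (2 * (1 - s)) powr (real q - \<alpha> - 1)"
        unfolding L_def s_def using one_minus_norm2_le[OF w] m(2) by (intro powr_mono2) auto
      also have "\<dots> = 2 powr (real q - \<alpha> - 1) * (1 - s) powr (real q - \<alpha> - 1)" using s by (subst powr_mult) auto
      finally have "L * (1 - s) powr (\<alpha> + 1 - real q) \<le>
          2 powr (real q - \<alpha> - 1) * (1 - s) powr (real q - \<alpha> - 1) * (1 - s) powr (\<alpha> + 1 - real q)"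
        by (rule mult_right_mono) simp
      also have "\<dots> = 2 powr (real q - \<alpha> - 1)" using s by (simp add: powr_add[symmetric] mult.assoc)
      finally show ?thesis .
    qed
    note [measurable] = cinner_measurable
    have [measurable]: "ball (0::complex^'n) 1 \<in> sets borel" by simp
    define \<Phi> where "\<Phi> y = ennreal (L * (1 / cmod (1 - cinner y w) ^ (CARD('n) + q)) * b * (1 - (norm y)\<^sup>2) powr \<alpha>)" for y :: "complex^'n"
    have [measurable]: "\<Phi> \<in> borel_measurable borel" unfolding \<Phi>_def by measurable
    have inner: "(\<integral>\<^sup>+x. \<Phi> (t *\<^sub>R (x /\<^sub>R norm x)) * indicator (ball 0 1) x \<partial>lborel)
        \<le> ennreal (L * Y) * ennreal ((1 - t) powr \<alpha> / (1 - t * s) ^ q)" if t: "0 < t" "t < 1" for t :: real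
    proof -
      have tw: "norm (t *\<^sub>R w) = t * s" using t by (simp add: s_def)
      have ts: "t * s < 1" using t s mult_left_le_one_le[of s t] by simp
      have "(\<integral>\<^sup>+x. \<Phi> (t *\<^sub>R (x /\<^sub>R norm x)) * indicator (ball 0 1) x \<partial>lborel) \<le>
        (\<integral>\<^sup>+x. ennreal (L * b * (1 - t\<^sup>2) powr \<alpha>) * (ennreal (1 / cmod (1 - cinner (x /\<^sub>R norm x) (t *\<^sub>R w)) ^ (CARD('n) + q)) *
          indicator (ball 0 1) x) \<partial>lborel)"
      proof (rule nn_integral_mono_AE, rule AE_mp[OF AE_lborel_singleton[of 0]], rule AE_I2, rule impI)
        fix x :: "complex^'n" assume x: "x \<noteq> 0"
        have n: "norm (t *\<^sub>R (x /\<^sub>R norm x)) = t" using x t by (simp add: abs_mult)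
        have ci: "cinner (t *\<^sub>R (x /\<^sub>R norm x)) w = cinner (x /\<^sub>R norm x) (t *\<^sub>R w)"
          by (simp only: cinner_scaleR_left cinner_scaleR_right mult_ac)
        have "\<Phi> (t *\<^sub>R (x /\<^sub>R norm x)) = ennreal (L * b * (1 - t\<^sup>2) powr \<alpha>) * ennreal (1 / cmod (1 - cinner (x /\<^sub>R norm x) (t *\<^sub>R w)) ^ (CARD('n) + q))"
          unfolding \<Phi>_def n ci using L0 b by (subst ennreal_mult[symmetric]) (auto simp: mult_ac)
        then show "\<Phi> (t *\<^sub>R (x /\<^sub>R norm x)) * indicator (ball 0 1) x \<le>
          ennreal (L * b * (1 - t\<^sup>2) powr \<alpha>) * (ennreal (1 / cmod (1 - cinner (x /\<^sub>R norm x) (t *\<^sub>R w)) ^ (CARD('n) + q)) *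
          indicator (ball 0 1) x)" by (simp only: mult.assoc order_refl)
      qed
      also have "\<dots> = ennreal (L * b * (1 - t\<^sup>2) powr \<alpha>) * (\<integral>\<^sup>+x. ennreal (1 / cmod (1 - cinner (x /\<^sub>R norm x) (t *\<^sub>R w)) ^ (CARD('n) + q)) *
          indicator (ball 0 1) x \<partial>lborel)"
        by (rule nn_integral_cmult) measurable
      also have "\<dots> \<le> ennreal (L * b * (1 - t\<^sup>2) powr \<alpha>) * ennreal (2 * 16 ^ CARD('n) / (1 - norm (t *\<^sub>R w)) ^ q)"
        by (intro mult_left_mono sphere_kernel_bound q1) (use tw ts in auto)
      also have "\<dots> = ennreal (L * b * (1 - t\<^sup>2) powr \<alpha> * (2 * 16 ^ CARD('n) / (1 - t * s) ^ q))"
        unfolding tw using L0 b ts by (subst ennreal_mult[symmetric]) auto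
      also have "\<dots> \<le> ennreal (L * b * (a * (1 - t) powr \<alpha>) * (2 * 16 ^ CARD('n) / (1 - t * s) ^ q))"
        unfolding a_def using L0 b ts t
        by (intro ennreal_leI mult_right_mono mult_left_mono one_minus_square_powr_le) auto
      also have "\<dots> = ennreal ((L * Y) * ((1 - t) powr \<alpha> / (1 - t * s) ^ q))"
        by (simp add: Y_def mult_ac)
      also have "\<dots> = ennreal (L * Y) * ennreal ((1 - t) powr \<alpha> / (1 - t * s) ^ q)"
        by (rule ennreal_mult) (use L0 Y ts in auto)
      finally show ?thesis .
    qed
    have "bergman_norm2 \<alpha> (kernel_test m (real CARD('n) + 1 + \<alpha>) w) = (\<integral>\<^sup>+x. \<Phi> x \<partial>nu_ball)"
      unfolding bergman_norm2_def cmod_kernel_test Lp m(1) b_def[symmetric] \<Phi>_def ..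
    also have "\<dots> = (\<integral>\<^sup>+x. \<Phi> x * indicator (ball 0 1) x \<partial>lborel) / ennreal V"
      unfolding nu_ball_def V(2)[symmetric] by (rule nn_integral_uniform_measure) auto
    also have "\<dots> \<le> ennreal P * (\<integral>\<^sup>+t. (\<integral>\<^sup>+x. \<Phi> (t *\<^sub>R (x /\<^sub>R norm x)) * indicator (ball 0 1) x \<partial>lborel) * indicator {0<..<1} t \<partial>lborel) / ennreal V"
      unfolding P_def mult_1_right by (intro divide_right_mono_ennreal nn_integral_ball_le_polar) measurable
    also have "\<dots> \<le> ennreal P * (\<integral>\<^sup>+t. ennreal (L * Y) * (ennreal ((1 - t) powr \<alpha> / (1 - t * s) ^ q) * indicator {0<..<1} t) \<partial>lborel) / ennreal V"
    proof (intro divide_right_mono_ennreal mult_left_mono nn_integral_mono)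
      fix t :: real
      show "(\<integral>\<^sup>+x. \<Phi> (t *\<^sub>R (x /\<^sub>R norm x)) * indicator (ball 0 1) x \<partial>lborel) * indicator {0<..<1} t
        \<le> ennreal (L * Y) * (ennreal ((1 - t) powr \<alpha> / (1 - t * s) ^ q) * indicator {0<..<1} t)"
        using inner[of t] by (cases "0 < t \<and> t < 1") auto
    qed simp
    also have "\<dots> = ennreal P * (ennreal (L * Y) * (\<integral>\<^sup>+t. ennreal ((1 - t) powr \<alpha> / (1 - t * s) ^ q) * indicator {0<..<1} t \<partial>lborel)) / ennreal V"
      by (subst nn_integral_cmult) auto
    also have "\<dots> \<le> ennreal P * (ennreal (L * Y) * ennreal (K * (1 - s) powr (\<alpha> + 1 - real q))) / ennreal V"
      unfolding K_def by (intro divide_right_mono_ennreal mult_left_mono radial_integral_bound \<alpha> m s) auto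
    also have "\<dots> = ennreal (P * (L * Y * (K * (1 - s) powr (\<alpha> + 1 - real q))) / V)"
      using P V L0 Y K by (simp add: ennreal_mult[symmetric] divide_ennreal)
    also have "\<dots> = ennreal (P * (Y * K) * (L * (1 - s) powr (\<alpha> + 1 - real q)) / V)" by (simp only: mult_ac)
    also have "\<dots> \<le> ennreal (P * (Y * K) * 2 powr (real q - \<alpha> - 1) / V)"
      using P V Y K by (intro ennreal_leI divide_right_mono mult_left_mono Ls) auto
    finally show "bergman_norm2 \<alpha> (kernel_test m (real CARD('n) + 1 + \<alpha>) w) \<le> ennreal (P * (Y * K) * 2 powr (real q - \<alpha> - 1) / V)" .
  qed
qed

subsection \<open>Compactness of the difference\<close>

lemma kernel_test_tendsto_0:
  fixes y :: "complex^'n::finite"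
  assumes y: "norm y < 1" and w: "\<And>n. norm (w n) < 1" "(\<lambda>n. norm (w n)) \<longlonglongrightarrow> 1" and m: "2 * real m > g"
  shows "(\<lambda>n. kernel_test m g (w n) y) \<longlonglongrightarrow> 0"
proof (rule Lim_null_comparison)
  have "(\<lambda>n. 1 - (norm (w n))\<^sup>2) \<longlonglongrightarrow> 1 - 1\<^sup>2" by (intro tendsto_intros w)
  then have 0: "(\<lambda>n. 1 - (norm (w n))\<^sup>2) \<longlonglongrightarrow> 0" by simp
  have "(\<lambda>n. (1 - (norm (w n))\<^sup>2) powr (real m - g / 2)) \<longlonglongrightarrow> 0 powr (real m - g / 2)"
    by (rule tendsto_powr'[OF 0 tendsto_const]) (use m one_minus_norm2_le(2)[OF w(1)] in \<open>auto intro!: always_eventually less_imp_le\<close>)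
  from tendsto_divide[OF this tendsto_const, of "(1 - norm y) ^ m"]
  show "(\<lambda>n. (1 - (norm (w n))\<^sup>2) powr (real m - g / 2) / (1 - norm y) ^ m) \<longlonglongrightarrow> 0" using y by simp
  show "\<forall>\<^sub>F n in sequentially. norm (kernel_test m g (w n) y) \<le> (1 - (norm (w n))\<^sup>2) powr (real m - g / 2) / (1 - norm y) ^ m"
  proof (rule always_eventually, rule allI)
    fix n
    \<comment> \<open>Exchanging the arguments gives a lower bound for the denominator that depends
      on \<open>y\<close> only.\<close>
    have "cmod (1 - cinner y (w n)) = cmod (1 - cinner (w n) y)"
      using cinner_commute[of y "w n"] by (metis complex_cnj_diff complex_cnj_one complex_mod_cnj)
    then have le: "1 - norm y \<le> cmod (1 - cinner y (w n))"
      using one_minus_cinner_ge[of "w n" y] w(1)[of n] by simp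
    have "norm (kernel_test m g (w n) y) = (1 - (norm (w n))\<^sup>2) powr (real m - g / 2) / cmod (1 - cinner y (w n)) ^ m"
      by (simp add: kernel_test_def norm_divide norm_power)
    also have "\<dots> \<le> (1 - (norm (w n))\<^sup>2) powr (real m - g / 2) / (1 - norm y) ^ m"
      using y le by (intro divide_left_mono power_mono mult_pos_pos zero_less_power) (auto intro: less_le_trans[OF _ le])
    finally show "norm (kernel_test m g (w n) y) \<le> (1 - (norm (w n))\<^sup>2) powr (real m - g / 2) / (1 - norm y) ^ m" .
  qed
qed

text \<open>Factoring out the peak value leaves the ratio of the two denominators; the peak has
  square \<open>(1 - |w|^2) powr (- g)\<close>.\<close>

lemma kernel_test_diff:
  assumes w: "norm w < 1"
  shows "(cmod (kernel_test m g w w - kernel_test m g w u))\<^sup>2 =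
    (1 - (norm w)\<^sup>2) powr (- g) * (cmod (1 - (of_real (1 - (norm w)\<^sup>2) / (1 - cinner u w)) ^ m))\<^sup>2"
proof -
  define s where "s = 1 - (norm w)\<^sup>2"
  have s: "s > 0" unfolding s_def by (rule one_minus_norm2_le(2)[OF w])
  have ww: "1 - cinner w w = of_real s" by (simp add: cinner_self s_def)
  define c where "c = s powr (real m - g / 2)"
  have "c / s ^ m = s powr (real m - g / 2) / s powr real m" using s by (simp add: c_def powr_realpow)
  also have "\<dots> = s powr (real m - g / 2 - real m)" by (rule powr_diff[symmetric])
  finally have cm: "c / s ^ m = s powr (- (g / 2))" by simp
  have "kernel_test m g w w - kernel_test m g w u = of_real c / of_real s ^ m - of_real c / (1 - cinner u w) ^ m"
    by (simp only: kernel_test_def ww c_def s_def)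
  also have "\<dots> = of_real (c / s ^ m) * (1 - (of_real s / (1 - cinner u w)) ^ m)"
    using s by (simp add: power_divide right_diff_distrib)
  finally have "(cmod (kernel_test m g w w - kernel_test m g w u))\<^sup>2 =
    (s powr (- (g / 2)))\<^sup>2 * (cmod (1 - (of_real s / (1 - cinner u w)) ^ m))\<^sup>2"
    unfolding cm by (simp add: norm_mult power_mult_distrib)
  also have "(s powr (- (g / 2)))\<^sup>2 = s powr (- g)" by (simp add: power2_eq_square powr_add[symmetric])
  finally show ?thesis by (simp only: s_def)
qed

text \<open>Needed because \<open>asymp_close\<close> is not symmetric and is required in both
  orders.\<close>

lemma compact_op_comp_diff_swap:
  fixes \<phi> \<psi> :: "'a \<Rightarrow> 'a"
  assumes "compact_op H Q (comp_diff \<phi> \<psi>)"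
    and neg: "\<And>f. f \<in> H \<Longrightarrow> (\<lambda>z. - f z) \<in> H" and Q: "\<And>f. Q (\<lambda>z. - f z) = Q f"
  shows "compact_op H Q (comp_diff \<psi> \<phi>)"
proof -
  have sw: "comp_diff \<psi> \<phi> f = (\<lambda>z. - comp_diff \<phi> \<psi> f z)" for f :: "'a \<Rightarrow> complex"
    by (auto simp: comp_diff_def)
  show ?thesis unfolding compact_op_def
  proof (intro conjI ballI allI impI)
    fix f assume "f \<in> H"
    then show "comp_diff \<psi> \<phi> f \<in> H" using assms(1) neg unfolding compact_op_def sw by blast
  next
    fix fs :: "nat \<Rightarrow> 'a \<Rightarrow> complex"
    assume "(\<forall>k. fs k \<in> H) \<and> (\<exists>M::real. \<forall>k. Q (fs k) \<le> ennreal M)"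
    then obtain r g where r: "strict_mono r" "g \<in> H" "(\<lambda>j. Q (\<lambda>z. comp_diff \<phi> \<psi> (fs (r j)) z - g z)) \<longlonglongrightarrow> 0"
      using assms(1) unfolding compact_op_def by blast
    have "Q (\<lambda>z. comp_diff \<psi> \<phi> (fs (r j)) z - - g z) = Q (\<lambda>z. comp_diff \<phi> \<psi> (fs (r j)) z - g z)" for j
      unfolding sw using Q[of "\<lambda>z. comp_diff \<phi> \<psi> (fs (r j)) z - g z"] by simp
    then show "\<exists>r g. strict_mono r \<and> g \<in> H \<and> (\<lambda>j. Q (\<lambda>z. comp_diff \<psi> \<phi> (fs (r j)) z - g z)) \<longlonglongrightarrow> 0"
      using r neg by (intro exI[of _ r] exI[of _ "\<lambda>z. - g z"]) simp
  qed
qed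

text \<open>Compactness gives a norm limit \<open>G\<close> along a subsequence, and evaluation at
  fixed points shows \<open>G = 0\<close> on the ball. Evaluation at the moving points
  \<open>z (r j)\<close> then still tends to 0 after weighting by \<open>(1 - |z|) powr g\<close>;
  the domination by \<open>B\<close> makes this weight cancel the size of the peak.\<close>

lemma compact_imp_power_tendsto_1:
  fixes \<phi> \<psi> :: "complex^'n::finite \<Rightarrow> complex^'n"
  assumes holo: "\<And>f. f \<in> H \<Longrightarrow> holo_ball f"
    and C: "\<And>h z. holo_ball h \<Longrightarrow> z \<in> ball 0 1 \<Longrightarrow> ennreal ((cmod (h z))\<^sup>2 * (1 - norm z) powr g) \<le> ennreal C * Q h"
    and M: "\<And>w. norm w < 1 \<Longrightarrow> kernel_test m g w \<in> H" "\<And>w. norm w < 1 \<Longrightarrow> Q (kernel_test m g w) \<le> ennreal M"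
    and m: "2 * real m > g" and g: "g > 0"
    and comp: "compact_op H Q (comp_diff \<phi> \<psi>)"
    and self: "\<And>z. z \<in> ball 0 1 \<Longrightarrow> norm (\<phi> z) < 1" "\<And>z. z \<in> ball 0 1 \<Longrightarrow> norm (\<psi> z) < 1"
    and z: "\<And>n. z n \<in> ball 0 1" "(\<lambda>n. norm (\<phi> (z n))) \<longlonglongrightarrow> 1"
    and B: "\<And>n. 1 - (norm (\<phi> (z n)))\<^sup>2 \<le> B * (1 - (norm (z n))\<^sup>2)"
  shows "\<exists>r. strict_mono (r :: nat \<Rightarrow> nat) \<and>
    (\<lambda>n. (of_real (1 - (norm (\<phi> (z (r n))))\<^sup>2) / (1 - cinner (\<psi> (z (r n))) (\<phi> (z (r n))))) ^ m) \<longlonglongrightarrow> 1"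
proof -
  define w where "w n = \<phi> (z n)" for n
  have w: "norm (w n) < 1" for n unfolding w_def by (rule self(1)[OF z(1)])
  define T where "T = comp_diff \<phi> \<psi>"
  obtain r G where r: "strict_mono r" and G: "G \<in> H"
    and lim: "(\<lambda>j. Q (\<lambda>x. T (kernel_test m g (w (r j))) x - G x)) \<longlonglongrightarrow> 0"
  proof -
    have "(\<forall>n. kernel_test m g (w n) \<in> H) \<and> (\<exists>M::real. \<forall>n. Q (kernel_test m g (w n)) \<le> ennreal M)"
      using M(1)[OF w] M(2)[OF w] by blast
    from comp[unfolded compact_op_def, THEN conjunct2, rule_format, OF this]
    show thesis using that unfolding T_def by blast
  qed
  have TH: "T f \<in> H" if "f \<in> H" for f using comp that unfolding compact_op_def T_def by blast
  \<comment> \<open>The bound on \<open>a j x\<close> does not depend on \<open>x\<close>, which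
    permits \<open>x\<close> to vary with \<open>j\<close>.\<close>
  define a where "a j x = (cmod (T (kernel_test m g (w (r j))) x - G x))\<^sup>2 * (1 - norm x) powr g" for j x
  have a0: "a j x \<ge> 0" for j x by (simp add: a_def)
  have bound: "ennreal (a j x) \<le> ennreal C * Q (\<lambda>x. T (kernel_test m g (w (r j))) x - G x)" if "x \<in> ball 0 1" for j x
    unfolding a_def by (rule C[OF holo_ball_diff[OF holo holo] that]) (use TH M(1) w G in auto)
  have "(\<lambda>j. ennreal C * Q (\<lambda>x. T (kernel_test m g (w (r j))) x - G x)) \<longlonglongrightarrow> ennreal C * 0"
    by (rule ennreal_tendsto_cmult[OF _ lim]) simp
  then have lim': "(\<lambda>j. ennreal C * Q (\<lambda>x. T (kernel_test m g (w (r j))) x - G x)) \<longlonglongrightarrow> 0" by simp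
  have a_lim: "(\<lambda>j. a j (x j)) \<longlonglongrightarrow> 0" if x: "\<And>j. x j \<in> ball 0 1" for x
  proof -
    have "(\<lambda>j. ennreal (a j (x j))) \<longlonglongrightarrow> 0"
      by (rule tendsto_sandwich[OF _ _ tendsto_const lim']) (auto intro!: always_eventually bound x)
    then have "(\<lambda>j. ennreal (a j (x j))) \<longlonglongrightarrow> ennreal 0" by simp
    then show ?thesis by (rule tendsto_ennrealD) (auto intro!: always_eventually a0)
  qed
  have wr: "(\<lambda>j. norm (w (r j))) \<longlonglongrightarrow> 1"
    using LIMSEQ_subseq_LIMSEQ[OF z(2) r] by (simp add: o_def w_def)
  have G0: "G x = 0" if x: "x \<in> ball 0 1" for x
  proof -
    have T0: "(\<lambda>j. T (kernel_test m g (w (r j))) x) \<longlonglongrightarrow> 0 - 0"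
      unfolding T_def comp_diff_def
      by (intro tendsto_diff kernel_test_tendsto_0[OF _ _ wr m]) (use w self x in auto)
    have "(\<lambda>j. a j x) \<longlonglongrightarrow> (cmod (0 - 0 - G x))\<^sup>2 * (1 - norm x) powr g"
      unfolding a_def by (intro tendsto_mult tendsto_power tendsto_norm tendsto_diff T0 tendsto_const)
    then have "(cmod (0 - 0 - G x))\<^sup>2 * (1 - norm x) powr g = 0"
      by (rule LIMSEQ_unique) (rule a_lim[OF x])
    then show ?thesis using x by simp
  qed
  define p where "p n = of_real (1 - (norm (w n))\<^sup>2) / (1 - cinner (\<psi> (z n)) (w n))" for n
  have B0: "B > 0"
  proof -
    have "0 < 1 - (norm (\<phi> (z 0)))\<^sup>2" "0 < 1 - (norm (z 0))\<^sup>2"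
      using one_minus_norm2_le(2)[OF self(1)[OF z(1)]] one_minus_norm2_le(2)[of "z 0"] z(1)[of 0] by auto
    then show ?thesis using B[of 0] mult_nonpos_nonneg[of B "1 - (norm (z 0))\<^sup>2"] by linarith
  qed
  have le: "(cmod (1 - p (r j) ^ m))\<^sup>2 \<le> (2 * B) powr g * a j (z (r j))" for j
  proof -
    define n where "n = r j"
    have zn: "norm (z n) < 1" using z(1)[of n] by simp
    define s where "s = 1 - (norm (w n))\<^sup>2"
    have s: "s > 0" unfolding s_def by (rule one_minus_norm2_le(2)[OF w])
    have "s \<le> B * (1 - (norm (z n))\<^sup>2)" unfolding s_def w_def by (rule B)
    also have "\<dots> \<le> B * (2 * (1 - norm (z n)))" using B0 by (intro mult_left_mono one_minus_norm2_le zn) auto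
    also have "\<dots> = 2 * B * (1 - norm (z n))" by (simp only: mult_ac)
    finally have "s powr g \<le> (2 * B * (1 - norm (z n))) powr g" using s g by (intro powr_mono2) auto
    also have "\<dots> = (2 * B) powr g * (1 - norm (z n)) powr g" using B0 zn by (subst powr_mult) auto
    finally have 1: "s powr g \<le> (2 * B) powr g * (1 - norm (z n)) powr g" .
    have "a j (z n) = (cmod (kernel_test m g (w n) (w n) - kernel_test m g (w n) (\<psi> (z n))))\<^sup>2 * (1 - norm (z n)) powr g"
      unfolding a_def n_def[symmetric] G0[OF z(1)] by (simp add: T_def comp_diff_def w_def)
    also have "\<dots> = s powr (- g) * (cmod (1 - p n ^ m))\<^sup>2 * (1 - norm (z n)) powr g"
      unfolding kernel_test_diff[OF w] s_def p_def ..
    finally have "(2 * B) powr g * a j (z n) = ((2 * B) powr g * (1 - norm (z n)) powr g) * (s powr (- g) * (cmod (1 - p n ^ m))\<^sup>2)"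
      by (simp only: mult_ac)
    also have "\<dots> \<ge> s powr g * (s powr (- g) * (cmod (1 - p n ^ m))\<^sup>2)"
      by (rule mult_right_mono[OF 1]) simp
    also have "s powr g * (s powr (- g) * (cmod (1 - p n ^ m))\<^sup>2) = (cmod (1 - p n ^ m))\<^sup>2"
      using s by (simp add: powr_minus)
    finally show ?thesis by (simp only: n_def)
  qed
  have "(\<lambda>j. (cmod (1 - p (r j) ^ m))\<^sup>2) \<longlonglongrightarrow> 0"
  proof (rule tendsto_sandwich[OF _ _ tendsto_const])
    show "(\<lambda>j. (2 * B) powr g * a j (z (r j))) \<longlonglongrightarrow> 0"
      using tendsto_mult[OF tendsto_const a_lim[of "\<lambda>j. z (r j)"]] z(1) by simp
  qed (use le in auto)
  then have "(\<lambda>j. cmod (1 - p (r j) ^ m)) \<longlonglongrightarrow> 0" by (simp add: power_tendsto_0_iff)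
  then have "(\<lambda>j. 1 - p (r j) ^ m) \<longlonglongrightarrow> 0" by (rule tendsto_norm_zero_cancel)
  from tendsto_diff[OF tendsto_const this, of 1] have "(\<lambda>j. p (r j) ^ m) \<longlonglongrightarrow> 1" by simp
  then show ?thesis using r unfolding p_def w_def by blast
qed

text \<open>A single exponent only yields \<open>p ^ m\<close> tending to 1, which determines
  \<open>p\<close> up to roots of unity. Exponents \<open>m\<close> and \<open>Suc m\<close> along a
  common subsequence give the limit of \<open>1 / p\<close> as a quotient, and
  \<open>1 / p - 1\<close> is the expression in \<open>asymp_close\<close>.\<close>

lemma compact_imp_asymp_close:
  fixes \<phi> \<psi> :: "complex^'n::finite \<Rightarrow> complex^'n"
  assumes holo: "\<And>f. f \<in> H \<Longrightarrow> holo_ball f"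
    and C: "\<And>h z. holo_ball h \<Longrightarrow> z \<in> ball 0 1 \<Longrightarrow> ennreal ((cmod (h z))\<^sup>2 * (1 - norm z) powr g) \<le> ennreal C * Q h"
    and test: "\<And>m. 2 * real m > g \<Longrightarrow> \<exists>M. \<forall>w. norm w < 1 \<longrightarrow> kernel_test m g w \<in> H \<and> Q (kernel_test m g w) \<le> ennreal M"
    and g: "g > 0"
    and comp: "compact_op H Q (comp_diff \<phi> \<psi>)"
    and self: "\<And>z. z \<in> ball 0 1 \<Longrightarrow> norm (\<phi> z) < 1" "\<And>z. z \<in> ball 0 1 \<Longrightarrow> norm (\<psi> z) < 1"
  shows "asymp_close \<phi> \<psi>"
  unfolding asymp_close_def
proof (intro allI impI)
  fix z assume z: "\<forall>n::nat. z n \<in> ball 0 1" "(\<lambda>n. norm (\<phi> (z n))) \<longlonglongrightarrow> 1"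
    and ex: "\<exists>B. \<forall>n. 1 - (norm (\<phi> (z n)))\<^sup>2 \<le> B * (1 - (norm (z n))\<^sup>2)"
  obtain B where B: "\<And>n. 1 - (norm (\<phi> (z n)))\<^sup>2 \<le> B * (1 - (norm (z n))\<^sup>2)" using ex by blast
  obtain m :: nat where "g < real m" using reals_Archimedean2 by blast
  then have m: "2 * real m > g" "2 * real (Suc m) > g" using g by auto
  obtain M1 where M1: "\<And>w. norm w < 1 \<Longrightarrow> kernel_test m g w \<in> H" "\<And>w. norm w < 1 \<Longrightarrow> Q (kernel_test m g w) \<le> ennreal M1"
    using test[OF m(1)] by blast
  obtain M2 where M2: "\<And>w. norm w < 1 \<Longrightarrow> kernel_test (Suc m) g w \<in> H" "\<And>w. norm w < 1 \<Longrightarrow> Q (kernel_test (Suc m) g w) \<le> ennreal M2"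
    using test[OF m(2)] by blast
  define p where "p n = of_real (1 - (norm (\<phi> (z n)))\<^sup>2) / (1 - cinner (\<psi> (z n)) (\<phi> (z n)))" for n
  have s0: "of_real (1 - (norm (\<phi> (z n)))\<^sup>2) \<noteq> (0::complex)" for n
    using one_minus_norm2_le(2)[OF self(1)[of "z n"]] z(1) by (metis less_irrefl of_real_eq_0_iff)
  have d0: "1 - cinner (\<psi> (z n)) (\<phi> (z n)) \<noteq> 0" for n
    using z(1) by (intro one_minus_cinner_nonzero self) auto
  have p0: "p n \<noteq> 0" for n using s0[of n] d0[of n] unfolding p_def by (simp only: divide_eq_0_iff) simp
  have z1: "z n \<in> ball 0 1" for n using z(1) by blast
  obtain r where r: "strict_mono r" "(\<lambda>n. p (r n) ^ m) \<longlonglongrightarrow> 1"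
    using compact_imp_power_tendsto_1[OF holo C M1 m(1) g comp self z1 z(2) B] unfolding p_def by blast
  have zr: "(\<lambda>n. norm (\<phi> (z (r n)))) \<longlonglongrightarrow> 1" using LIMSEQ_subseq_LIMSEQ[OF z(2) r(1)] by (simp add: o_def)
  obtain t where t: "strict_mono t" "(\<lambda>n. p (r (t n)) ^ Suc m) \<longlonglongrightarrow> 1"
    using compact_imp_power_tendsto_1[OF holo C M2 m(2) g comp self z1 zr B] unfolding p_def by blast
  have "(\<lambda>n. p (r (t n)) ^ m) \<longlonglongrightarrow> 1" using LIMSEQ_subseq_LIMSEQ[OF r(2) t(1)] by (simp add: o_def)
  from tendsto_divide[OF this t(2)] have "(\<lambda>n. 1 / p (r (t n))) \<longlonglongrightarrow> 1" using p0 by simp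
  from tendsto_diff[OF this tendsto_const, of 1] have "(\<lambda>n. 1 / p (r (t n)) - 1) \<longlonglongrightarrow> 0" by simp
  moreover have "1 / p n - 1 = cinner (\<phi> (z n) - \<psi> (z n)) (\<phi> (z n)) / of_real (1 - (norm (\<phi> (z n)))\<^sup>2)" for n
  proof -
    have "cinner (\<phi> (z n) - \<psi> (z n)) (\<phi> (z n)) = (1 - cinner (\<psi> (z n)) (\<phi> (z n))) - of_real (1 - (norm (\<phi> (z n)))\<^sup>2)"
      by (simp add: cinner_diff_left cinner_self)
    then show ?thesis using s0[of n] by (simp add: p_def diff_divide_distrib del: of_real_diff)
  qed
  ultimately show "\<exists>r. strict_mono r \<and> (\<lambda>n. cinner (\<phi> (z (r n)) - \<psi> (z (r n))) (\<phi> (z (r n))) / of_real (1 - (norm (\<phi> (z (r n))))\<^sup>2)) \<longlonglongrightarrow> 0"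
    using strict_mono_o[OF r(1) t(1)] by (intro exI[of _ "r \<circ> t"]) (simp add: o_def)
qed

section \<open>Application to the Hardy and Bergman spaces\<close>

lemma holo_ball_uminus:
  assumes "holo_ball f"
  shows "holo_ball (\<lambda>z. - f z)"
proof -
  have "holo_ball (\<lambda>_. 0)" unfolding holo_ball_def by (intro ballI exI[of _ "\<lambda>_. 0"]) simp
  from holo_ball_diff[OF this assms] show ?thesis by simp
qed

lemma hardy_asymp_close:
  fixes \<phi> \<psi> :: "complex^'n::finite \<Rightarrow> complex^'n"
  assumes "compact_op hardy_space hardy_norm2 (comp_diff \<phi> \<psi>)"
    and "\<And>z. z \<in> ball 0 1 \<Longrightarrow> norm (\<phi> z) < 1" "\<And>z. z \<in> ball 0 1 \<Longrightarrow> norm (\<psi> z) < 1"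
  shows "asymp_close \<phi> \<psi>"
proof -
  obtain C where C: "\<And>(h :: complex^'n \<Rightarrow> complex) z. holo_ball h \<Longrightarrow> z \<in> ball 0 1 \<Longrightarrow>
     ennreal ((cmod (h z))\<^sup>2 * (1 - norm z) powr real CARD('n)) \<le> ennreal C * hardy_norm2 h"
    using hardy_point_eval[where 'n='n] by blast
  show ?thesis
  proof (rule compact_imp_asymp_close[OF _ C _ _ assms])
    fix m assume m: "2 * real m > real CARD('n)"
    then have "2 * m = CARD('n) + (2 * m - CARD('n))" "2 * m - CARD('n) \<ge> 1" by auto
    from hardy_kernel_test_bound[OF this]
    show "\<exists>M. \<forall>w :: complex^'n. norm w < 1 \<longrightarrow> kernel_test m (real CARD('n)) w \<in> hardy_space \<and> hardy_norm2 (kernel_test m (real CARD('n)) w) \<le> ennreal M"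
      unfolding hardy_space_def infinity_ennreal_def mem_Collect_eq
      using holo_ball_kernel_test le_less_trans[OF _ ennreal_less_top] by blast
  qed (auto simp: hardy_space_def)
qed

lemma bergman_asymp_close:
  fixes \<phi> \<psi> :: "complex^'n::finite \<Rightarrow> complex^'n"
  assumes \<alpha>: "\<alpha> > -1" and "compact_op (bergman_space \<alpha>) (bergman_norm2 \<alpha>) (comp_diff \<phi> \<psi>)"
    and "\<And>z. z \<in> ball 0 1 \<Longrightarrow> norm (\<phi> z) < 1" "\<And>z. z \<in> ball 0 1 \<Longrightarrow> norm (\<psi> z) < 1"
  shows "asymp_close \<phi> \<psi>"
proof -
  let ?g = "real CARD('n) + 1 + \<alpha>"
  obtain C where C: "\<And>(h :: complex^'n \<Rightarrow> complex) z. holo_ball h \<Longrightarrow> z \<in> ball 0 1 \<Longrightarrow>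
     ennreal ((cmod (h z))\<^sup>2 * (1 - norm z) powr ?g) \<le> ennreal C * bergman_norm2 \<alpha> h"
    using bergman_point_eval[OF \<alpha>, where 'n='n] by blast
  show ?thesis
  proof (rule compact_imp_asymp_close[OF _ C _ _ assms(2-4)])
    fix m assume m: "2 * real m > ?g"
    \<comment> \<open>Guards the truncated subtraction \<open>2 * m - CARD('n)\<close>, which is the
      \<open>q\<close> of the norm bound.\<close>
    then have "2 * m > CARD('n)" using \<alpha> by linarith
    then have "2 * m = CARD('n) + (2 * m - CARD('n))" "real (2 * m - CARD('n)) > \<alpha> + 1"
      using m by (auto simp: of_nat_diff)
    from bergman_kernel_test_bound[OF \<alpha> this]
    show "\<exists>M. \<forall>w :: complex^'n. norm w < 1 \<longrightarrow> kernel_test m ?g w \<in> bergman_space \<alpha> \<and> bergman_norm2 \<alpha> (kernel_test m ?g w) \<le> ennreal M"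
      unfolding bergman_space_def infinity_ennreal_def mem_Collect_eq
      using holo_ball_kernel_test le_less_trans[OF _ ennreal_less_top] by blast
  qed (use \<alpha> in \<open>auto simp: bergman_space_def intro: add_pos_pos\<close>)
qed

lemma hardy_compact_swap:
  "compact_op hardy_space hardy_norm2 (comp_diff \<phi> \<psi>) \<Longrightarrow> compact_op hardy_space hardy_norm2 (comp_diff \<psi> \<phi>)"
  by (rule compact_op_comp_diff_swap) (auto simp: hardy_space_def hardy_norm2_def holo_ball_uminus)

lemma bergman_compact_swap:
  "compact_op (bergman_space \<alpha>) (bergman_norm2 \<alpha>) (comp_diff \<phi> \<psi>) \<Longrightarrow>
   compact_op (bergman_space \<alpha>) (bergman_norm2 \<alpha>) (comp_diff \<psi> \<phi>)"
  by (rule compact_op_comp_diff_swap) (auto simp: bergman_space_def bergman_norm2_def holo_ball_uminus)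

theorem theorem7:
  fixes \<phi> \<psi> :: "complex^'n::finite \<Rightarrow> complex^'n" and \<alpha> :: real
  assumes "CARD('n) > 1"
    and "lin_frac_selfmap \<phi>" and "lin_frac_selfmap \<psi>"
    and "(SUP z\<in>ball 0 1. norm (\<phi> z)) = 1" and "(SUP z\<in>ball 0 1. norm (\<psi> z)) = 1"
    and "inj_on \<phi> (ball 0 1) \<or> inj_on \<psi> (ball 0 1)"
    and "compact_op hardy_space hardy_norm2 (comp_diff \<phi> \<psi>) \<or>
         (\<alpha> > -1 \<and> compact_op (bergman_space \<alpha>) (bergman_norm2 \<alpha>) (comp_diff \<phi> \<psi>))"
  shows "\<forall>z\<in>ball 0 1. \<phi> z = \<psi> z"
proof -
  note \<phi>lt = lin_frac_closed_ball(3)[OF assms(2,4)] and \<psi>lt = lin_frac_closed_ball(3)[OF assms(3,5)]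
  have "asymp_close \<phi> \<psi> \<and> asymp_close \<psi> \<phi>"
    using assms(7)
  proof
    assume c: "compact_op hardy_space hardy_norm2 (comp_diff \<phi> \<psi>)"
    show ?thesis
      using hardy_asymp_close[OF c \<phi>lt \<psi>lt] hardy_asymp_close[OF hardy_compact_swap[OF c] \<psi>lt \<phi>lt] by blast
  next
    assume c: "\<alpha> > -1 \<and> compact_op (bergman_space \<alpha>) (bergman_norm2 \<alpha>) (comp_diff \<phi> \<psi>)"
    show ?thesis
      using bergman_asymp_close[OF conjunct1[OF c] conjunct2[OF c] \<phi>lt \<psi>lt]
        bergman_asymp_close[OF conjunct1[OF c] bergman_compact_swap[OF conjunct2[OF c]] \<psi>lt \<phi>lt] by blast
  qed
  then show ?thesis
    using lin_frac_eq_if_asymp_close[OF assms(2,4,3,5)] by blast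
qed

end
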